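(* Let $K$ be a field of prime characteristic $p$ and let $G$ be a nonabelian locally finite $p$-group. The subgroup $V_*(KG)$ of unitary normalized units is normal in the group $V(KG)$ of normalized units if and only if $p=2$ and $G$ is the direct product of an elementary abelian group with a group $H$ for which one of the following holds: (i) $H$ has no direct factor of order $2$, but it is a semidirect product of a group $\langle h\rangle$ of order $2$ and an abelian $2$-group $A$ (with $A$ normal), with $h^{-1}ah=a^{-1}$ for all $a\in A$; (ii) $H$ is an extraspecial $2$-group, or the central product of such a group with a cyclic group of order $4$.
   Context: For a commutative ring $K$ with $1$ and a group $G$, $KG$ is the group algebra and $V(KG)$ is the group of normalized units, i.e. units of $KG$ with augmentation (sum of coefficients) $1$. The map $a\mapsto a^*$ is the $K$-linear extension to $KG$ of $g\mapsto g^{-1}$ on $G$; it is an anti-automorphism of $KG$. $V_*(KG)=\{v\in V(KG): v^*=v^{-1}\}$ is the subgroup of unitary normalized units. "Elementary abelian group" here means an elementary abelian $2$-group (possibly trivial, possibly infinite). A $p$-group is extraspecial if its centre, commutator subgroup and Frattini subgroup are equal and have order $p$; the group is not required to be finite. The central product of an extraspecial $2$-group with a cyclic group $C_4$ of order $4$ is the quotient of their direct product identifying the centre (of order $2$) of the extraspecial group with the subgroup of order $2$ of $C_4$. *)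

theory Defs
  imports "HOL-Algebra.Algebra" "HOL-Library.Poly_Mapping"
begin

section \<open>Group algebras and their unitary normalized units\<close>

text \<open>
  Elements of \<open>KG\<close> are the finitely supported maps \<open>'g \<Rightarrow>\<^sub>0 'k\<close> with support in \<open>carrier G\<close>.
  The coefficient ring is the type \<open>'k\<close>, passed as a type argument. Products and the
  involution are the (bi)linear extensions of the operations of \<open>G\<close>; the convolution product
  provided by \<open>Poly_Mapping\<close> itself is for additively written monoids on a whole type.
\<close>

definition group_algebra ::
    "'k::comm_ring_1 itself \<Rightarrow> ('g, 'm) monoid_scheme \<Rightarrow> ('g \<Rightarrow>\<^sub>0 'k) ring" where
  "group_algebra K G =
    \<lparr>carrier = {a. Poly_Mapping.keys a \<subseteq> carrier G},
     monoid.mult = (\<lambda>a b. \<Sum>x\<in>Poly_Mapping.keys a. \<Sum>y\<in>Poly_Mapping.keys b.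
       Poly_Mapping.single (x \<otimes>\<^bsub>G\<^esub> y) (Poly_Mapping.lookup a x * Poly_Mapping.lookup b y)),
     one = Poly_Mapping.single \<one>\<^bsub>G\<^esub> 1,
     ring.zero = 0,
     ring.add = (+)\<rparr>"

definition augmentation :: "('g \<Rightarrow>\<^sub>0 'k::comm_ring_1) \<Rightarrow> 'k" where
  "augmentation a = (\<Sum>x\<in>Poly_Mapping.keys a. Poly_Mapping.lookup a x)"

definition group_star ::
    "('g, 'm) monoid_scheme \<Rightarrow> ('g \<Rightarrow>\<^sub>0 'k::comm_ring_1) \<Rightarrow> ('g \<Rightarrow>\<^sub>0 'k)" where
  "group_star G a =
    (\<Sum>x\<in>Poly_Mapping.keys a. Poly_Mapping.single (inv\<^bsub>G\<^esub> x) (Poly_Mapping.lookup a x))"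

definition normalized_units ::
    "'k::comm_ring_1 itself \<Rightarrow> ('g, 'm) monoid_scheme \<Rightarrow> ('g \<Rightarrow>\<^sub>0 'k) monoid" where
  "normalized_units K G =
    (units_of (group_algebra K G))
      \<lparr>carrier := {v \<in> Units (group_algebra K G). augmentation v = 1}\<rparr>"

definition unitary_normalized_units ::
    "'k::comm_ring_1 itself \<Rightarrow> ('g, 'm) monoid_scheme \<Rightarrow> ('g \<Rightarrow>\<^sub>0 'k) set" where
  "unitary_normalized_units K G =
    {v \<in> carrier (normalized_units K G). group_star G v = inv\<^bsub>normalized_units K G\<^esub> v}"

section \<open>Classes of groups\<close>

text \<open>None of the following notions presupposes finiteness of the group.\<close>

definition p_group :: "nat \<Rightarrow> ('g, 'm) monoid_scheme \<Rightarrow> bool" where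
  "p_group p G \<longleftrightarrow> group G \<and> (\<forall>x\<in>carrier G. \<exists>n. group.ord G x = p ^ n)"

definition locally_finite_group :: "('g, 'm) monoid_scheme \<Rightarrow> bool" where
  "locally_finite_group G \<longleftrightarrow>
    group G \<and> (\<forall>S. S \<subseteq> carrier G \<and> finite S \<longrightarrow> finite (generate G S))"

definition elementary_abelian_2_group :: "('g, 'm) monoid_scheme \<Rightarrow> bool" where
  "elementary_abelian_2_group G \<longleftrightarrow> comm_group G \<and> (\<forall>x\<in>carrier G. x \<otimes>\<^bsub>G\<^esub> x = \<one>\<^bsub>G\<^esub>)"

definition direct_product_of_subgroups ::
    "('g, 'm) monoid_scheme \<Rightarrow> 'g set \<Rightarrow> 'g set \<Rightarrow> bool" where
  "direct_product_of_subgroups G A B \<longleftrightarrow>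
    A \<lhd> G \<and> B \<lhd> G \<and> A \<inter> B = {\<one>\<^bsub>G\<^esub>} \<and> A <#>\<^bsub>G\<^esub> B = carrier G"

definition has_direct_factor_of_order_2 :: "('g, 'm) monoid_scheme \<Rightarrow> bool" where
  "has_direct_factor_of_order_2 G \<longleftrightarrow>
    (\<exists>A B. direct_product_of_subgroups G A B \<and> card A = 2)"

definition inverting_semidirect_product :: "('g, 'm) monoid_scheme \<Rightarrow> bool" where
  "inverting_semidirect_product H \<longleftrightarrow>
    (\<exists>A. \<exists>h\<in>carrier H.
       A \<lhd> H \<and> comm_group (H\<lparr>carrier := A\<rparr>) \<and> p_group 2 (H\<lparr>carrier := A\<rparr>) \<and>
       group.ord H h = 2 \<and>
       generate H {h} \<inter> A = {\<one>\<^bsub>H\<^esub>} \<and> generate H {h} <#>\<^bsub>H\<^esub> A = carrier H \<and>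
       (\<forall>a\<in>A. inv\<^bsub>H\<^esub> h \<otimes>\<^bsub>H\<^esub> a \<otimes>\<^bsub>H\<^esub> h = inv\<^bsub>H\<^esub> a))"

definition group_centre :: "('g, 'm) monoid_scheme \<Rightarrow> 'g set" where
  "group_centre G = {z \<in> carrier G. \<forall>x\<in>carrier G. z \<otimes>\<^bsub>G\<^esub> x = x \<otimes>\<^bsub>G\<^esub> z}"

definition maximal_subgroup :: "'g set \<Rightarrow> ('g, 'm) monoid_scheme \<Rightarrow> bool" where
  "maximal_subgroup M G \<longleftrightarrow>
    subgroup M G \<and> M \<noteq> carrier G \<and>
    (\<forall>L. subgroup L G \<and> M \<subseteq> L \<longrightarrow> L = M \<or> L = carrier G)"

text \<open>A group without maximal subgroups is its own Frattini subgroup.\<close>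

definition frattini_subgroup :: "('g, 'm) monoid_scheme \<Rightarrow> 'g set" where
  "frattini_subgroup G = carrier G \<inter> \<Inter> {M. maximal_subgroup M G}"

definition extraspecial :: "nat \<Rightarrow> ('g, 'm) monoid_scheme \<Rightarrow> bool" where
  "extraspecial p G \<longleftrightarrow>
    p_group p G \<and>
    group_centre G = derived G (carrier G) \<and>
    derived G (carrier G) = frattini_subgroup G \<and>
    card (group_centre G) = p"

text \<open>
  \<open>integer_mod_group 4\<close> is \<open>{0, 1, 2, 3}\<close> under addition, so \<open>2\<close> is its involution. For \<open>Q\<close> with
  centre \<open>{\<one>, z}\<close> the subgroup factored out is \<open>{(\<one>, 0), (z, 2)}\<close>, which identifies \<open>z\<close> with \<open>2\<close>.
\<close>

definition central_product_C4 :: "('g, 'm) monoid_scheme \<Rightarrow> ('g \<times> int) set monoid" where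
  "central_product_C4 Q =
    (Q \<times>\<times> integer_mod_group 4) Mod
      insert (\<one>\<^bsub>Q\<^esub>, 0) ((\<lambda>z. (z, 2)) ` (group_centre Q - {\<one>\<^bsub>Q\<^esub>}))"

text \<open>
  It is enough to let the extraspecial factor \<open>Q\<close> range over groups with elements in the type
  of \<open>H\<close>, because it embeds in the central product.
\<close>

definition extraspecial_central_product_C4 :: "('g, 'm) monoid_scheme \<Rightarrow> bool" where
  "extraspecial_central_product_C4 H \<longleftrightarrow>
    (\<exists>Q :: 'g monoid. extraspecial 2 Q \<and> H \<cong> central_product_C4 Q)"

end

theory Submission
  imports Defs
begin

text \<open>
  Since \<open>G\<close> consists of unitary units, \<open>V\<^sub>*(KG)\<close> is normal in \<open>V(KG)\<close> iff \<open>u\<^sup>* u\<close> is central for every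
  \<open>u \<in> V(KG)\<close>. For odd \<open>p\<close> the unit \<open>(1 + g) / 2\<close> shows that \<open>g + g\<^sup>-\<^sup>1\<close> is central, and as \<open>g\<close> and
  \<open>g\<^sup>-\<^sup>1\<close> are not conjugate in a group without involutions, \<open>G\<close> is abelian. For \<open>p = 2\<close> the unit
  \<open>1 + g + x\<^sup>-\<^sup>1\<close> shows that, if \<open>g\<^sup>2 \<noteq> 1\<close>, each \<open>x\<close> centralizes or inverts \<open>g\<close>. Conversely, in
  characteristic \<open>2\<close> this property makes all \<open>c + c\<^sup>*\<close> central, hence also \<open>u\<^sup>* u\<close>.

  If two elements \<open>a\<close>, \<open>b\<close> with \<open>a\<^sup>2 \<noteq> 1 \<noteq> b\<^sup>2\<close> do not commute in a group with this property, then they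
  generate a quaternion group and all squares lie in \<open>{1, a\<^sup>2}\<close>, a central subgroup; splitting off a
  complement of \<open>\<langle>a\<^sup>2\<rangle>\<close> in the elements of order at most \<open>2\<close> of the centre leaves a group of type (ii).
  Otherwise the centralizer of all \<open>g\<close> with \<open>g\<^sup>2 \<noteq> 1\<close> is an abelian subgroup of index \<open>2\<close> that is
  inverted by the elements outside, and splitting off the involutions of height \<open>0\<close> leaves type (i).
\<close>

section \<open>Unitary units of group algebras\<close>

text \<open>The field may be infinite and the group need not be finitely generated, so units cannot
  be counted and groups cannot be listed. Units are therefore built in a finite subgroup and with
  coefficients 0 and 1 only, where an injective map is onto. The summand x^-1 is put into 1 + g +
  x^-1 because its own trace x + x^-1 commutes with x; only g, g^-1 and the mixed products g^-1
  x^-1, x g remain to be compared.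

  On the group side every splitting is linear algebra over the field with two elements: modulo a
  subgroup containing all squares a group is a vector space, where Zorn's lemma provides
  complements. One such statement yields maximal subgroups avoiding a given element outside the
  centre, the extraspecial factor and the elementary abelian factors. It also replaces
  decompositions into cyclic groups, which abelian 2-groups such as the quasicyclic one do not have:
  a subgroup of exponent 2 of an abelian group that contains no square except 1 is pure and bounded
  and hence splits off.\<close>

lemma poly_mapping_keys_induct [consumes 1, case_names zero add]:
  fixes a :: "'g \<Rightarrow>\<^sub>0 'k::comm_monoid_add"
  assumes "Poly_Mapping.keys a \<subseteq> S"
    and "P 0"
    and "\<And>x c b. x \<in> S \<Longrightarrow> Poly_Mapping.keys b \<subseteq> S \<Longrightarrow> P b \<Longrightarrow> P (Poly_Mapping.single x c + b)"
  shows "P a"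
proof -
  have "P (\<Sum>x\<in>F. Poly_Mapping.single x (Poly_Mapping.lookup a x))"
    if "finite F" "F \<subseteq> S" for F
    using that
  proof (induction F rule: finite_induct)
    case empty
    then show ?case using assms(2) by simp
  next
    case (insert x F)
    have "Poly_Mapping.keys (\<Sum>x\<in>F. Poly_Mapping.single x (Poly_Mapping.lookup a x)) \<subseteq> S"
      using insert.prems by (intro order_trans[OF keys_sum]) (auto split: if_splits)
    then show ?case using insert assms(3) by simp
  qed
  moreover have "(\<Sum>x\<in>Poly_Mapping.keys a. Poly_Mapping.single x (Poly_Mapping.lookup a x)) = a"
    by (rule poly_mapping_eqI) (simp add: lookup_sum lookup_single when_def in_keys_iff)
  ultimately show ?thesis using assms(1) by (metis finite_keys)
qed

text \<open>The product of \<open>group_algebra K G\<close> freed from the record and from the type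
  argument, so that bilinearity can be stated on the whole type, without membership
  conditions.\<close>

definition conv :: "('g, 'm) monoid_scheme \<Rightarrow> ('g \<Rightarrow>\<^sub>0 'k::comm_ring_1) \<Rightarrow> ('g \<Rightarrow>\<^sub>0 'k) \<Rightarrow> ('g \<Rightarrow>\<^sub>0 'k)" where
  "conv G a b = (\<Sum>x\<in>Poly_Mapping.keys a. \<Sum>y\<in>Poly_Mapping.keys b.
       Poly_Mapping.single (x \<otimes>\<^bsub>G\<^esub> y) (Poly_Mapping.lookup a x * Poly_Mapping.lookup b y))"

text \<open>Cancellation can make the support of a sum smaller than those of its summands, so the
  defining sums do not add up termwise. Over one finite set containing all the supports they do, the
  extra terms being zero.\<close>

lemma conv_superset:
  assumes "finite A" "finite B" "Poly_Mapping.keys a \<subseteq> A" "Poly_Mapping.keys b \<subseteq> B"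
  shows "conv G a b = (\<Sum>x\<in>A. \<Sum>y\<in>B.
       Poly_Mapping.single (x \<otimes>\<^bsub>G\<^esub> y) (Poly_Mapping.lookup a x * Poly_Mapping.lookup b y))"
proof -
  have "(\<Sum>y\<in>Poly_Mapping.keys b. Poly_Mapping.single (x \<otimes>\<^bsub>G\<^esub> y) (Poly_Mapping.lookup a x * Poly_Mapping.lookup b y))
     = (\<Sum>y\<in>B. Poly_Mapping.single (x \<otimes>\<^bsub>G\<^esub> y) (Poly_Mapping.lookup a x * Poly_Mapping.lookup b y))" for x
    using assms by (intro sum.mono_neutral_left) (auto simp: in_keys_iff)
  then show ?thesis
    unfolding conv_def
    using assms by (simp, intro sum.mono_neutral_left) (auto simp: in_keys_iff)
qed

lemma conv_add_left: "conv G (a + b) c = conv G a c + conv G b c"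
proof -
  define A where "A = Poly_Mapping.keys a \<union> Poly_Mapping.keys b"
  have A: "finite A" "Poly_Mapping.keys a \<subseteq> A" "Poly_Mapping.keys b \<subseteq> A" "Poly_Mapping.keys (a+b) \<subseteq> A"
    unfolding A_def using Poly_Mapping.keys_add[of a b] by auto
  have c: "finite (Poly_Mapping.keys c)" "Poly_Mapping.keys c \<subseteq> Poly_Mapping.keys c" by auto
  show ?thesis
    by (simp add: conv_superset[OF A(1) c(1) A(2) c(2)] conv_superset[OF A(1) c(1) A(3) c(2)]
        conv_superset[OF A(1) c(1) A(4) c(2)] lookup_add ring_distribs single_add sum.distrib)
qed

lemma conv_add_right: "conv G c (a + b) = conv G c a + conv G c b"
proof -
  define A where "A = Poly_Mapping.keys a \<union> Poly_Mapping.keys b"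
  have A: "finite A" "Poly_Mapping.keys a \<subseteq> A" "Poly_Mapping.keys b \<subseteq> A" "Poly_Mapping.keys (a+b) \<subseteq> A"
    unfolding A_def using Poly_Mapping.keys_add[of a b] by auto
  have c: "finite (Poly_Mapping.keys c)" "Poly_Mapping.keys c \<subseteq> Poly_Mapping.keys c" by auto
  show ?thesis
    by (simp add: conv_superset[OF c(1) A(1) c(2) A(2)] conv_superset[OF c(1) A(1) c(2) A(3)]
        conv_superset[OF c(1) A(1) c(2) A(4)] lookup_add ring_distribs single_add sum.distrib)
qed

lemma conv_zero_left [simp]: "conv G 0 a = 0" and conv_zero_right [simp]: "conv G a 0 = 0"
  by (simp_all add: conv_def)

lemma conv_single [simp]:
  "conv G (Poly_Mapping.single x c) (Poly_Mapping.single y d) = Poly_Mapping.single (x \<otimes>\<^bsub>G\<^esub> y) (c * d)"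
  by (subst conv_superset[of "{x}" "{y}"]) auto

lemmas conv_distrib = conv_add_left conv_add_right

lemma augmentation_superset:
  assumes "finite A" "Poly_Mapping.keys a \<subseteq> A"
  shows "augmentation a = (\<Sum>x\<in>A. Poly_Mapping.lookup a x)"
  unfolding augmentation_def using assms by (intro sum.mono_neutral_left) (auto simp: in_keys_iff)

lemma augmentation_add: "augmentation (a + b) = augmentation a + augmentation b"
  using augmentation_superset[of "Poly_Mapping.keys a \<union> Poly_Mapping.keys b" "a + b"]
    augmentation_superset[of "Poly_Mapping.keys a \<union> Poly_Mapping.keys b" a]
    augmentation_superset[of "Poly_Mapping.keys a \<union> Poly_Mapping.keys b" b]
    Poly_Mapping.keys_add[of a b]
  by (simp add: lookup_add sum.distrib)

lemma augmentation_zero [simp]: "augmentation 0 = 0"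
  by (simp add: augmentation_def)

lemma augmentation_single [simp]: "augmentation (Poly_Mapping.single x c) = c"
  by (simp add: augmentation_def)

lemma augmentation_conv: "augmentation (conv G a b) = augmentation a * augmentation b"
proof -
  have "augmentation (conv G (Poly_Mapping.single x c) b) = c * augmentation b" for x c
    using subset_UNIV
    by (induction b rule: poly_mapping_keys_induct)
      (simp_all add: conv_distrib augmentation_add ring_distribs)
  with subset_UNIV show ?thesis
    by (induction a rule: poly_mapping_keys_induct)
      (simp_all add: conv_distrib augmentation_add ring_distribs)
qed

lemma star_superset:
  assumes "finite A" "Poly_Mapping.keys a \<subseteq> A"
  shows "group_star G a = (\<Sum>x\<in>A. Poly_Mapping.single (inv\<^bsub>G\<^esub> x) (Poly_Mapping.lookup a x))"
  unfolding group_star_def using assms by (intro sum.mono_neutral_left) (auto simp: in_keys_iff)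

lemma star_add: "group_star G (a + b) = group_star G a + group_star G b"
  using star_superset[of "Poly_Mapping.keys a \<union> Poly_Mapping.keys b" "a + b" G]
    star_superset[of "Poly_Mapping.keys a \<union> Poly_Mapping.keys b" a G]
    star_superset[of "Poly_Mapping.keys a \<union> Poly_Mapping.keys b" b G]
    Poly_Mapping.keys_add[of a b]
  by (simp add: lookup_add single_add sum.distrib)

lemma star_zero [simp]: "group_star G 0 = 0"
  by (simp add: group_star_def)

lemma star_single [simp]:
  "group_star G (Poly_Mapping.single x c) = Poly_Mapping.single (inv\<^bsub>G\<^esub> x) c"
  by (simp add: group_star_def)

lemma augmentation_star [simp]: "augmentation (group_star G a) = augmentation a"
  using subset_UNIV
  by (induction a rule: poly_mapping_keys_induct) (simp_all add: star_add augmentation_add)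

definition galg :: "('g, 'm) monoid_scheme \<Rightarrow> ('g \<Rightarrow>\<^sub>0 'k::comm_ring_1) set" where
  "galg G = {a. Poly_Mapping.keys a \<subseteq> carrier G}"

lemma galg_add: "a \<in> galg G \<Longrightarrow> b \<in> galg G \<Longrightarrow> a + b \<in> galg G"
  using Poly_Mapping.keys_add[of a b] by (auto simp: galg_def)

lemma galg_single: "x \<in> carrier G \<Longrightarrow> Poly_Mapping.single x c \<in> galg G"
  by (simp add: galg_def)

lemma galg_zero: "0 \<in> galg G"
  by (simp add: galg_def)

text \<open>The step does not ask that \<open>x\<close> is outside the support of \<open>b\<close>:
  an additive identity only has to be checked on multiples of group elements. The quadratic
  expression star(u) u is treated with the same rule.\<close>

lemma galg_induct [consumes 1, case_names zero add]:
  assumes "a \<in> galg G" "P 0"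
    "\<And>x c b. x \<in> carrier G \<Longrightarrow> b \<in> galg G \<Longrightarrow> P b \<Longrightarrow> P (Poly_Mapping.single x c + b)"
  shows "P a"
  using assms poly_mapping_keys_induct[of a "carrier G" P] by (auto simp: galg_def)

lemma galg_sum: "(\<And>x. x \<in> S \<Longrightarrow> f x \<in> galg G) \<Longrightarrow> sum f S \<in> galg G"
  by (induction S rule: infinite_finite_induct) (simp_all add: galg_zero galg_add)

lemmas galg_intros = galg_add galg_single galg_zero

text \<open>
  In characteristic \<open>2\<close> the following condition makes \<open>c + c\<^sup>*\<close> central for every \<open>c\<close>,
  which is what normality of the unitary subgroup amounts to.
\<close>

definition fixed_or_inverted :: "('g, 'm) monoid_scheme \<Rightarrow> bool" where
  "fixed_or_inverted G \<longleftrightarrow> (\<forall>g\<in>carrier G. g \<otimes>\<^bsub>G\<^esub> g = \<one>\<^bsub>G\<^esub> \<or>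
    (\<forall>x\<in>carrier G. g \<otimes>\<^bsub>G\<^esub> x = x \<otimes>\<^bsub>G\<^esub> g \<or> g \<otimes>\<^bsub>G\<^esub> x = x \<otimes>\<^bsub>G\<^esub> inv\<^bsub>G\<^esub> g))"

section \<open>Laws of the convolution, normalized units and normality of the unitary
  subgroup\<close>

context group
begin

lemma conv_closed:
  assumes "a \<in> galg G" "b \<in> galg G" shows "conv G a b \<in> galg G"
proof -
  have "conv G (Poly_Mapping.single x c) b \<in> galg G" if "x \<in> carrier G" for x c
    using assms(2)
    by (induction b rule: galg_induct) (use that in \<open>simp_all add: conv_distrib galg_intros\<close>)
  with assms(1) show ?thesis
    by (induction a rule: galg_induct) (simp_all add: conv_distrib galg_intros)
qed

lemma star_closed: "a \<in> galg G \<Longrightarrow> group_star G a \<in> galg G"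
  by (induction a rule: galg_induct) (simp_all add: star_add galg_intros)

lemma conv_assoc:
  assumes "a \<in> galg G" "b \<in> galg G" "c \<in> galg G"
  shows "conv G (conv G a b) c = conv G a (conv G b c)"
proof -
  have 1: "conv G (conv G (Poly_Mapping.single x d) (Poly_Mapping.single y e)) c
      = conv G (Poly_Mapping.single x d) (conv G (Poly_Mapping.single y e) c)"
    if "x \<in> carrier G" "y \<in> carrier G" for x y d e
    using assms(3)
    by (induction c rule: galg_induct)
      (use that in \<open>simp_all add: conv_add_right m_assoc mult.assoc\<close>)
  have 2: "conv G (conv G (Poly_Mapping.single x d) b) c
      = conv G (Poly_Mapping.single x d) (conv G b c)" if "x \<in> carrier G" for x d
    using assms(2)
    by (induction b rule: galg_induct) (use 1 that in \<open>simp_all add: conv_distrib del: conv_single\<close>)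
  show ?thesis
    using assms(1) by (induction a rule: galg_induct) (use 2 in \<open>simp_all add: conv_distrib\<close>)
qed

lemma conv_one_left [simp]: "a \<in> galg G \<Longrightarrow> conv G (Poly_Mapping.single \<one> 1) a = a"
  by (induction a rule: galg_induct) (simp_all add: conv_distrib)

lemma conv_one_right [simp]: "a \<in> galg G \<Longrightarrow> conv G a (Poly_Mapping.single \<one> 1) = a"
  by (induction a rule: galg_induct) (simp_all add: conv_distrib)

lemma star_star: "a \<in> galg G \<Longrightarrow> group_star G (group_star G a) = a"
  by (induction a rule: galg_induct) (simp_all add: star_add)

lemma star_conv:
  assumes "a \<in> galg G" "b \<in> galg G"
  shows "group_star G (conv G a b) = conv G (group_star G b) (group_star G a)"
proof -
  have "group_star G (conv G (Poly_Mapping.single x d) b)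
      = conv G (group_star G b) (group_star G (Poly_Mapping.single x d))" if "x \<in> carrier G" for x d
    using assms(2)
    by (induction b rule: galg_induct)
      (use that in \<open>simp_all add: conv_distrib star_add inv_mult_group mult.commute\<close>)
  with assms(1) show ?thesis
    by (induction a rule: galg_induct) (simp_all add: conv_distrib star_add)
qed

lemma group_algebra_simps:
  "carrier (group_algebra K G) = galg G"
  "monoid.mult (group_algebra K G) = conv G"
  "one (group_algebra K G) = Poly_Mapping.single \<one> 1"
  by (simp_all add: group_algebra_def conv_def galg_def fun_eq_iff)

lemma normalized_units_simps:
  "monoid.mult (normalized_units K G) = conv G"
  "one (normalized_units K G) = Poly_Mapping.single \<one> 1"
  by (simp_all add: normalized_units_def units_of_def group_algebra_simps)

lemma normalized_units_iff:
  "u \<in> carrier (normalized_units K G) \<longleftrightarrow> u \<in> galg G \<and> augmentation u = 1 \<and>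
    (\<exists>w\<in>galg G. conv G u w = Poly_Mapping.single \<one> 1 \<and> conv G w u = Poly_Mapping.single \<one> 1)"
  unfolding normalized_units_def Units_def by (auto simp: group_algebra_simps)

lemma normalized_unit_inverse:
  fixes u w :: "'a \<Rightarrow>\<^sub>0 'k::comm_ring_1"
  assumes "u \<in> carrier (normalized_units K G)"
    "w \<in> galg G" "conv G u w = Poly_Mapping.single \<one> 1" "conv G w u = Poly_Mapping.single \<one> 1"
  shows "w \<in> carrier (normalized_units K G)"
proof -
  have "augmentation u * augmentation w = 1"
    using assms(3) augmentation_conv[of G u w] by simp
  then show ?thesis using assms normalized_units_iff by (metis mult_1)
qed

lemma group_normalized_units: "group (normalized_units K G)"
proof (rule groupI, unfold normalized_units_simps)
  fix x y assume x: "x \<in> carrier (normalized_units K G)" and y: "y \<in> carrier (normalized_units K G)"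
  obtain x' where x': "x' \<in> galg G" "conv G x x' = Poly_Mapping.single \<one> 1"
    "conv G x' x = Poly_Mapping.single \<one> 1" using x normalized_units_iff by blast
  obtain y' where y': "y' \<in> galg G" "conv G y y' = Poly_Mapping.single \<one> 1"
    "conv G y' y = Poly_Mapping.single \<one> 1" using y normalized_units_iff by blast
  have g: "x \<in> galg G" "y \<in> galg G" "augmentation x = 1" "augmentation y = 1"
    using x y normalized_units_iff by blast+
  have "conv G (conv G x y) (conv G y' x') = conv G x (conv G (conv G y y') x')"
    by (simp only: conv_assoc conv_closed g x'(1) y'(1))
  then have 1: "conv G (conv G x y) (conv G y' x') = Poly_Mapping.single \<one> 1"
    using g x' y' by simp
  have "conv G (conv G y' x') (conv G x y) = conv G y' (conv G (conv G x' x) y)"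
    by (simp only: conv_assoc conv_closed g x'(1) y'(1))
  then have 2: "conv G (conv G y' x') (conv G x y) = Poly_Mapping.single \<one> 1"
    using g x' y' by simp
  show "conv G x y \<in> carrier (normalized_units K G)"
    unfolding normalized_units_iff
    using g x'(1) y'(1) 1 2 conv_closed[OF y'(1) x'(1)] conv_closed[OF g(1,2)]
    by (auto simp: augmentation_conv)
next
  show "Poly_Mapping.single \<one> 1 \<in> carrier (normalized_units K G)"
    unfolding normalized_units_iff
    by (auto simp: galg_single intro!: bexI[of _ "Poly_Mapping.single \<one> 1"])
next
  fix x assume "x \<in> carrier (normalized_units K G)"
  then show "\<exists>y\<in>carrier (normalized_units K G). conv G y x = Poly_Mapping.single \<one> 1"
    using normalized_units_iff normalized_unit_inverse by blast
qed (auto simp: normalized_units_iff conv_assoc)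

lemma inv_normalized_units:
  assumes "u \<in> carrier (normalized_units K G)"
  shows "inv\<^bsub>normalized_units K G\<^esub> u \<in> carrier (normalized_units K G)"
    "conv G u (inv\<^bsub>normalized_units K G\<^esub> u) = Poly_Mapping.single \<one> 1"
    "conv G (inv\<^bsub>normalized_units K G\<^esub> u) u = Poly_Mapping.single \<one> 1"
  using group.inv_closed[OF group_normalized_units assms] group.r_inv[OF group_normalized_units assms]
    group.l_inv[OF group_normalized_units assms]
  by (simp_all add: normalized_units_simps)

text \<open>Replaces the inverse taken in the group of normalized units by two equations for the
  convolution. They make star v a normalized unit as well, so uniqueness of inverses
  applies.\<close>

lemma unitary_iff:
  "v \<in> unitary_normalized_units K G \<longleftrightarrow> v \<in> galg G \<and> augmentation v = 1 \<and>
    conv G v (group_star G v) = Poly_Mapping.single \<one> 1 \<and>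
    conv G (group_star G v) v = Poly_Mapping.single \<one> 1"
proof
  assume "v \<in> unitary_normalized_units K G"
  then show "v \<in> galg G \<and> augmentation v = 1 \<and>
    conv G v (group_star G v) = Poly_Mapping.single \<one> 1 \<and>
    conv G (group_star G v) v = Poly_Mapping.single \<one> 1"
    using inv_normalized_units[of v K] unfolding unitary_normalized_units_def normalized_units_iff
    by auto
next
  assume r: "v \<in> galg G \<and> augmentation v = 1 \<and>
    conv G v (group_star G v) = Poly_Mapping.single \<one> 1 \<and>
    conv G (group_star G v) v = Poly_Mapping.single \<one> 1"
  then have v: "v \<in> carrier (normalized_units K G)"
    using star_closed[of v] unfolding normalized_units_iff by blast
  moreover from r v have "group_star G v \<in> carrier (normalized_units K G)"
    using normalized_unit_inverse star_closed by blast
  ultimately show "v \<in> unitary_normalized_units K G"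
    using r group.inv_equality[OF group_normalized_units[where K=K], of "group_star G v" v]
    by (simp add: unitary_normalized_units_def normalized_units_simps)
qed

lemma unitary_single: "g \<in> carrier G \<Longrightarrow> Poly_Mapping.single g 1 \<in> unitary_normalized_units K G"
  unfolding unitary_iff by (simp add: galg_single)

lemma star_normalized_unit:
  assumes "u \<in> carrier (normalized_units K G)"
  shows "group_star G u \<in> carrier (normalized_units K G)"
proof -
  obtain w where w: "w \<in> galg G" "conv G u w = Poly_Mapping.single \<one> 1"
    "conv G w u = Poly_Mapping.single \<one> 1" using assms normalized_units_iff by blast
  have u: "u \<in> galg G" "augmentation u = 1" using assms normalized_units_iff by blast+
  have "conv G (group_star G w) (group_star G u) = group_star G (conv G u w)"
    "conv G (group_star G u) (group_star G w) = group_star G (conv G w u)"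
    by (simp_all only: star_conv[OF u(1) w(1)] star_conv[OF w(1) u(1)])
  then have "conv G (group_star G w) (group_star G u) = Poly_Mapping.single \<one> 1"
    "conv G (group_star G u) (group_star G w) = Poly_Mapping.single \<one> 1"
    unfolding w by simp_all
  then show ?thesis
    unfolding normalized_units_iff using u star_closed[OF u(1)] star_closed[OF w(1)] by auto
qed

text \<open>Group elements are unitary, so normality makes x = u g u^-1 unitary. Written out,
  star(x) x = 1 says that g commutes with star(u) u.\<close>

lemma unitary_normal_imp:
  fixes K :: "'k::comm_ring_1 itself"
  assumes N: "unitary_normalized_units K G \<lhd> normalized_units K G"
    and u: "u \<in> carrier (normalized_units K G)" and g: "g \<in> carrier G"
  shows "conv G (conv G (group_star G u) u) (Poly_Mapping.single g 1)
       = conv G (Poly_Mapping.single g 1) (conv G (group_star G u) u)"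
proof -
  interpret V: group "normalized_units K G" by (rule group_normalized_units)
  let ?V = "normalized_units K G"
  let ?g = "Poly_Mapping.single g (1::'k)"
  define w where "w = inv\<^bsub>?V\<^esub> u"
  have w: "w \<in> carrier ?V" "conv G u w = Poly_Mapping.single \<one> 1"
    "conv G w u = Poly_Mapping.single \<one> 1"
    unfolding w_def using inv_normalized_units[OF u] by auto
  define x where "x = conv G u (conv G ?g w)"
  have gg: "?g \<in> galg G" "u \<in> galg G" "w \<in> galg G"
    using g u w normalized_units_iff by (blast intro: galg_single)+
  have "conv G (conv G u ?g) w \<in> unitary_normalized_units K G"
    using V.normal_inv_iff N unitary_single[OF g] u unfolding w_def
    by (metis normalized_units_simps(1))
  then have x: "x \<in> unitary_normalized_units K G" unfolding x_def by (simp only: conv_assoc gg)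
  define s where "s = group_star G u"
  define s' where "s' = group_star G w"
  define h where "h = group_star G ?g"
  have ss: "s \<in> galg G" "s' \<in> galg G" "h \<in> galg G"
    unfolding s_def s'_def h_def using star_closed gg by blast+
  have hg: "conv G h ?g = Poly_Mapping.single \<one> 1" "conv G ?g h = Poly_Mapping.single \<one> 1"
    unfolding h_def using g by simp_all
  have s's: "conv G s s' = Poly_Mapping.single \<one> 1" "conv G s' s = Poly_Mapping.single \<one> 1"
    unfolding s_def s'_def star_conv[OF gg(2,3), symmetric] star_conv[OF gg(3,2), symmetric] w by simp_all
  have sx: "group_star G x = conv G s' (conv G h s)"
    unfolding x_def s_def s'_def h_def
    by (simp only: star_conv gg conv_closed star_closed conv_assoc)
  have x1: "conv G (group_star G x) x = Poly_Mapping.single \<one> 1" using x unitary_iff by blast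
  \<comment> \<open>The identity is inserted between \<open>s\<close> and \<open>u\<close> and
    replaced by star(x) x, which is the product of \<open>s'\<close>, \<open>h\<close>,
    \<open>s\<close>, \<open>u\<close>, \<open>?g\<close>, \<open>w\<close>. Then \<open>s\<close>
    cancels \<open>s'\<close>, \<open>w\<close> cancels \<open>u\<close>, and finally
    \<open>?g\<close> cancels \<open>h\<close>.\<close>
  have "conv G ?g (conv G s u) = conv G ?g (conv G s (conv G u (Poly_Mapping.single \<one> 1)))"
    using gg by simp
  also have "\<dots> = conv G ?g (conv G (conv G s (Poly_Mapping.single \<one> 1)) u)"
    using gg ss by simp
  also have "\<dots> = conv G ?g (conv G (conv G s (conv G (group_star G x) x)) u)"
    using x1 by simp
  also have "\<dots> = conv G ?g (conv G (conv G s s') (conv G h (conv G s (conv G u (conv G ?g (conv G w u))))))"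
    unfolding sx unfolding x_def by (simp only: conv_assoc gg ss conv_closed)
  also have "\<dots> = conv G ?g (conv G h (conv G s (conv G u ?g)))"
    unfolding s's w using g gg ss by (simp add: conv_closed galg_single)
  also have "\<dots> = conv G (conv G ?g h) (conv G (conv G s u) ?g)"
    by (simp only: conv_assoc gg ss conv_closed)
  also have "\<dots> = conv G (conv G s u) ?g"
    unfolding hg using g gg ss by (simp add: conv_closed galg_single)
  finally show ?thesis unfolding s_def ..
qed

text \<open>For x = u v u^-1 the factor star(u) u stands in the middle of star(x) x. Moving it past
  v leaves star(v) v = 1, after which u and its inverse cancel.\<close>

lemma unitary_normal_if:
  fixes K :: "'k::comm_ring_1 itself"
  assumes c: "\<And>u v :: 'a \<Rightarrow>\<^sub>0 'k. u \<in> galg G \<Longrightarrow> v \<in> galg G \<Longrightarrow>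
    conv G (conv G (group_star G u) u) v = conv G v (conv G (group_star G u) u)"
  shows "unitary_normalized_units K G \<lhd> normalized_units K G"
proof -
  interpret V: group "normalized_units K G" by (rule group_normalized_units)
  let ?V = "normalized_units K G"
  let ?one = "Poly_Mapping.single \<one> 1"
  have sub: "subgroup (unitary_normalized_units K G) ?V"
  proof (rule V.subgroupI)
    show "unitary_normalized_units K G \<subseteq> carrier ?V" by (auto simp: unitary_normalized_units_def)
    show "unitary_normalized_units K G \<noteq> {}" using unitary_single by blast
  next
    fix v assume v: "v \<in> unitary_normalized_units K G"
    then have "inv\<^bsub>?V\<^esub> v = group_star G v" by (simp add: unitary_normalized_units_def)
    with v show "inv\<^bsub>?V\<^esub> v \<in> unitary_normalized_units K G"
      unfolding unitary_iff using star_closed[of v] star_star[of v] by auto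
  next
    fix v w assume "v \<in> unitary_normalized_units K G" "w \<in> unitary_normalized_units K G"
    then have v: "v \<in> galg G" "augmentation v = 1" "conv G v (group_star G v) = ?one"
      "conv G (group_star G v) v = ?one" and w: "w \<in> galg G" "augmentation w = 1"
      "conv G w (group_star G w) = ?one" "conv G (group_star G w) w = ?one"
      using unitary_iff by blast+
    have s: "group_star G v \<in> galg G" "group_star G w \<in> galg G" using v w star_closed by blast+
    have "conv G (conv G v w) (group_star G (conv G v w))
        = conv G v (conv G (conv G w (group_star G w)) (group_star G v))"
      by (simp only: star_conv v(1) w(1) s conv_assoc conv_closed)
    moreover have "conv G (group_star G (conv G v w)) (conv G v w)
        = conv G (group_star G w) (conv G (conv G (group_star G v) v) w)"
      by (simp only: star_conv v(1) w(1) s conv_assoc conv_closed)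
    ultimately show "v \<otimes>\<^bsub>?V\<^esub> w \<in> unitary_normalized_units K G"
      unfolding unitary_iff normalized_units_simps using v w s conv_closed
      by (simp add: augmentation_conv)
  qed
  have "u \<otimes>\<^bsub>?V\<^esub> v \<otimes>\<^bsub>?V\<^esub> inv\<^bsub>?V\<^esub> u \<in> unitary_normalized_units K G"
    if u: "u \<in> carrier ?V" and vu: "v \<in> unitary_normalized_units K G" for u v
  proof -
    from vu have v: "v \<in> galg G" "augmentation v = 1" "conv G v (group_star G v) = ?one"
      "conv G (group_star G v) v = ?one" using unitary_iff by blast+
    have vV: "v \<in> carrier ?V" using vu sub subgroup.mem_carrier by metis
    define w where "w = inv\<^bsub>?V\<^esub> u"
    have w: "w \<in> carrier ?V" "conv G u w = ?one" "conv G w u = ?one"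
      unfolding w_def using inv_normalized_units[OF u] by auto
    have gg: "u \<in> galg G" "w \<in> galg G" "augmentation u = 1" "augmentation w = 1"
      using u w normalized_units_iff by blast+
    define s where "s = group_star G u"
    define s' where "s' = group_star G w"
    define v' where "v' = group_star G v"
    have ss: "s \<in> galg G" "s' \<in> galg G" "v' \<in> galg G"
      unfolding s_def s'_def v'_def using star_closed gg v by blast+
    have s's: "conv G s s' = ?one" "conv G s' s = ?one"
      unfolding s_def s'_def star_conv[OF gg(1,2), symmetric] star_conv[OF gg(2,1), symmetric] w by simp_all
    define x where "x = conv G u (conv G v w)"
    have xV: "x \<in> carrier ?V" unfolding x_def
      using V.m_closed[OF u V.m_closed[OF vV w(1)]] by (simp add: normalized_units_simps)
    have sx: "group_star G x = conv G s' (conv G v' s)"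
      unfolding x_def s_def s'_def v'_def
      by (simp only: star_conv gg v(1) conv_closed star_closed conv_assoc)
    have "conv G (group_star G x) x = conv G s' (conv G v' (conv G (conv G (conv G s u) v) w))"
      unfolding sx unfolding x_def by (simp only: conv_assoc gg ss v(1) conv_closed)
    also have "\<dots> = conv G s' (conv G v' (conv G (conv G v (conv G s u)) w))"
      using c[OF gg(1) v(1)] by (simp add: s_def)
    also have "\<dots> = conv G s' (conv G (conv G v' v) (conv G s (conv G u w)))"
      by (simp only: conv_assoc gg ss v(1) conv_closed)
    also have "\<dots> = ?one"
      unfolding w using v ss s's by (simp add: v'_def)
    finally have left: "conv G (group_star G x) x = ?one" .
    \<comment> \<open>Both factors lie in the group of normalized units, where a left inverse is
      also a right inverse; this gives the second equation of unitarity.\<close>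
    have "group_star G x \<in> carrier ?V" using xV star_normalized_unit by blast
    with left xV have "conv G x (group_star G x) = ?one"
      using V.inv_comm[of "group_star G x" x] by (simp add: normalized_units_simps)
    with left xV have "x \<in> unitary_normalized_units K G"
      unfolding unitary_iff using normalized_units_iff by blast
    then show ?thesis
      unfolding normalized_units_simps w_def[symmetric] x_def by (simp only: conv_assoc gg v)
  qed
  with sub show ?thesis using V.normal_inv_iff by blast
qed


section \<open>Central elements star(u) u in characteristic 2\<close>

text \<open>The hypothesis means h = x^-1 g x, and conjugation commutes with inversion. The cases of
  interest are h = g and h = g^-1.\<close>

lemma commute_inv:
  assumes "g \<in> carrier G" "x \<in> carrier G" "h \<in> carrier G" "g \<otimes> x = x \<otimes> h"
  shows "inv g \<otimes> x = x \<otimes> inv h"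
proof -
  have "inv g \<otimes> x = inv g \<otimes> (x \<otimes> h) \<otimes> inv h" using assms(1-3) by (simp add: m_assoc)
  also have "\<dots> = x \<otimes> inv h" using assms(1-3) by (simp add: assms(4)[symmetric] m_assoc[symmetric])
  finally show ?thesis .
qed

lemma central_single_imp_central:
  assumes "c \<in> galg G" "v \<in> galg G"
    "\<And>x d. x \<in> carrier G \<Longrightarrow> conv G c (Poly_Mapping.single x d) = conv G (Poly_Mapping.single x d) c"
  shows "conv G c v = conv G v c"
  using assms(2) by (induction v rule: galg_induct) (simp_all add: conv_distrib assms(3))

text \<open>c + star c is a sum of multiples of g + g^-1. Such a term vanishes in characteristic 2
  if g^2 = 1; otherwise conjugation by x fixes or interchanges g and g^-1.\<close>

lemma trace_central:
  fixes c :: "'a \<Rightarrow>\<^sub>0 'k::comm_ring_1"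
  assumes two: "\<And>a::'k. a + a = 0" and fi: "fixed_or_inverted G"
    and c: "c \<in> galg G" and v: "v \<in> galg G"
  shows "conv G (c + group_star G c) v = conv G v (c + group_star G c)"
proof (rule central_single_imp_central[OF _ v])
  show "c + group_star G c \<in> galg G" using c star_closed galg_add by blast
  fix x :: 'a and d :: 'k assume x: "x \<in> carrier G"
  have *: "conv G (Poly_Mapping.single g e + Poly_Mapping.single (inv g) e) (Poly_Mapping.single x d)
      = conv G (Poly_Mapping.single x d) (Poly_Mapping.single g e + Poly_Mapping.single (inv g) e)"
    if g: "g \<in> carrier G" for g e
  proof -
    consider "g \<otimes> g = \<one>" | "g \<otimes> x = x \<otimes> g" | "g \<otimes> x = x \<otimes> inv g"
      using fi g x unfolding fixed_or_inverted_def by blast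
    then show ?thesis
    proof cases
      case 1
      then have "inv g = g" using g by (simp add: inv_equality)
      then show ?thesis by (simp add: single_add[symmetric] two)
    next
      case 2
      then have "inv g \<otimes> x = x \<otimes> inv g"
        using g x commute_inv by blast
      with 2 show ?thesis by (simp add: conv_distrib mult.commute)
    next
      case 3
      then have "inv g \<otimes> x = x \<otimes> g"
        using g x commute_inv[of g x "inv g"] by simp
      with 3 show ?thesis by (simp add: conv_distrib mult.commute add.commute)
    qed
  qed
  show "conv G (c + group_star G c) (Poly_Mapping.single x d)
      = conv G (Poly_Mapping.single x d) (c + group_star G c)"
    using c
  proof (induction c rule: galg_induct)
    case (add g e b)
    define t r where "t = Poly_Mapping.single g e + Poly_Mapping.single (inv g) e"
      and "r = b + group_star G b"
    have "Poly_Mapping.single g e + b + group_star G (Poly_Mapping.single g e + b) = t + r"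
      by (simp add: star_add t_def r_def)
    with add(3) *[OF add(1), of e] show ?case
      by (simp only: conv_distrib flip: t_def r_def)
  qed simp
qed

text \<open>In the expansion of star(u) u the diagonal terms are scalars, since x^-1 x = 1, and the
  other terms pair up to traces e + star e. Adding a multiple of x to b contributes one scalar and
  the trace of star(b) times this multiple.\<close>

lemma star_mult_self_central:
  fixes u :: "'a \<Rightarrow>\<^sub>0 'k::comm_ring_1"
  assumes two: "\<And>a::'k. a + a = 0" and fi: "fixed_or_inverted G"
    and u: "u \<in> galg G" and v: "v \<in> galg G"
  shows "conv G (conv G (group_star G u) u) v = conv G v (conv G (group_star G u) u)"
  using u
proof (induction u rule: galg_induct)
  case (add x c b)
  define e where "e = conv G (group_star G b) (Poly_Mapping.single x c)"
  have b': "group_star G b \<in> galg G" using add star_closed by blast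
  have e: "e \<in> galg G" unfolding e_def by (rule conv_closed[OF b' galg_single[OF add(1)]])
  have 1: "conv G (Poly_Mapping.single \<one> (c * c)) v = conv G v (Poly_Mapping.single \<one> (c * c))"
    using v by (induction v rule: galg_induct) (simp_all add: conv_distrib mult.commute)
  have se: "group_star G e = conv G (Poly_Mapping.single (inv x) c) b"
    unfolding e_def using add b' by (simp add: star_conv galg_single star_star)
  define t where "t = e + group_star G e"
  have t: "conv G t v = conv G v t" unfolding t_def using trace_central[OF two fi e v] .
  have "conv G (group_star G (Poly_Mapping.single x c + b)) (Poly_Mapping.single x c + b)
      = Poly_Mapping.single \<one> (c * c) + t + conv G (group_star G b) b"
    unfolding t_def se using add(1) by (simp add: star_add conv_distrib e_def)
  then show ?case
    using add 1 t by (simp only: conv_distrib)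
qed simp

end

section \<open>Units with three terms, by counting in finite 2-groups\<close>

lemma (in group) ord_subgroup:
  assumes "subgroup H G" "x \<in> H"
  shows "group.ord (G\<lparr>carrier := H\<rparr>) x = ord x"
proof -
  interpret H: group "G\<lparr>carrier := H\<rparr>" using assms subgroup_imp_group by blast
  show ?thesis unfolding ord_def H.ord_def by (simp add: nat_pow_consistent[symmetric])
qed

text \<open>Cauchy's theorem, taken from Sylow's theorem with exponent 1: a nontrivial element of a
  subgroup of order q has an order that divides q and is a power of p.\<close>

lemma (in group) finite_p_group_prime_dvd:
  assumes "finite (carrier G)" "\<forall>x\<in>carrier G. \<exists>n. ord x = p ^ n"
    "Factorial_Ring.prime (p::nat)" "Factorial_Ring.prime q" "q dvd order G"
  shows "q = p"
proof -
  obtain m where "order G = q ^ 1 * m" using assms(5) by auto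
  then obtain H where H: "subgroup H G" "card H = q ^ 1"
    using sylow_thm[OF assms(4) is_group _ assms(1)] by blast
  interpret H: group "G\<lparr>carrier := H\<rparr>" using H subgroup_imp_group by blast
  have "card H > 1" using H(2) prime_gt_1_nat[OF assms(4)] by simp
  then have "\<not> H \<subseteq> {\<one>}" using card_mono[of "{\<one>}" H] by fastforce
  then obtain x where x: "x \<in> H" "x \<noteq> \<one>" by blast
  have xG: "x \<in> carrier G" using x H subgroup.mem_carrier by metis
  have "x [^]\<^bsub>G\<lparr>carrier := H\<rparr>\<^esub> order (G\<lparr>carrier := H\<rparr>) = \<one>"
    using H.pow_order_eq_1[of x] x by simp
  then have "x [^] q = \<one>" using H by (simp add: order_def nat_pow_consistent[symmetric])
  then have d: "ord x dvd q" using pow_eq_id xG by blast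
  obtain n where n: "ord x = p ^ n" using assms(2) xG by blast
  have "ord x \<noteq> 1" using ord_eq_1 xG x by blast
  then have "n \<noteq> 0" using n by auto
  then have "p dvd q" using d n dvd_trans[OF dvd_power] by (metis gr0I)
  then show "q = p" using primes_dvd_imp_eq assms by blast
qed

text \<open>Orbit lengths divide the group order, so each is 1 or even. The orbit of x has length 1;
  if all others were even, the total would be odd.\<close>

lemma (in group_action) even_card_imp_second_fixed_point:
  assumes two: "\<And>q::nat. Factorial_Ring.prime q \<Longrightarrow> q dvd order G \<Longrightarrow> q = 2"
    and "finite E" "even (card E)" "x \<in> E" "\<And>g. g \<in> carrier G \<Longrightarrow> \<phi> g x = x"
  obtains y where "y \<in> E" "y \<noteq> x" "\<And>g. g \<in> carrier G \<Longrightarrow> \<phi> g y = y"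
proof (rule ccontr)
  assume no: "\<not> thesis"
  note second = that
  interpret group G using group_hom group_hom.axioms(1) by blast
  have ox: "orbit G \<phi> x = {x}" using assms(5) unfolding orbit_def by force
  have fin: "finite (orbits G E \<phi>)"
    using assms(2) by (auto simp: orbits_def)
  have ev: "even (card orb)" if "orb \<in> orbits G E \<phi>" "orb \<noteq> {x}" for orb
  proof -
    obtain y where y: "y \<in> E" "orb = orbit G \<phi> y" using \<open>orb \<in> orbits G E \<phi>\<close> by (auto simp: orbits_def)
    have "card orb \<noteq> 1"
    proof
      assume "card orb = 1"
      then have "orb = {y}" using orbit_refl[OF y(1)] y(2) by (metis card_1_singletonE singletonD)
      then have "\<phi> g y = y" if "g \<in> carrier G" for g using that y(2) by (auto simp: orbit_def)
      moreover have "y \<noteq> x" using \<open>orb = {y}\<close> \<open>orb \<noteq> {x}\<close> by blast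
      ultimately show False using no second[OF y(1)] by blast
    qed
    then obtain q :: nat where q: "Factorial_Ring.prime q" "q dvd card orb" using prime_factor_nat by blast
    then have "q dvd order G" using orbit_stabilizer_theorem[OF y(1)] y(2) by (metis dvd_mult2)
    then show ?thesis using two q by blast
  qed
  have "card E = (\<Sum>orb\<in>orbits G E \<phi>. card orb)"
    using disjoint_sum[OF assms(2), of "\<lambda>_. 1::nat"] by simp
  also have "\<dots> = card {x} + (\<Sum>orb\<in>orbits G E \<phi> - {{x}}. card orb)"
    using fin ox assms(4) by (intro sum.remove) (auto simp: orbits_def)
  finally have "card E = 1 + (\<Sum>orb\<in>orbits G E \<phi> - {{x}}. card orb)" by simp
  moreover have "even (\<Sum>orb\<in>orbits G E \<phi> - {{x}}. card orb)" using ev by (intro dvd_sum) auto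
  ultimately show False using assms(3) by simp
qed


lemma even_card_involution:
  assumes "finite A" "\<And>a. a \<in> A \<Longrightarrow> f a \<in> A" "\<And>a. a \<in> A \<Longrightarrow> f (f a) = a" "\<And>a. a \<in> A \<Longrightarrow> f a \<noteq> a"
  shows "even (card A)"
  using assms
proof (induction A rule: finite_psubset_induct)
  case (psubset A)
  show ?case
  proof (cases "A = {}")
    case False
    then obtain a where a: "a \<in> A" by blast
    let ?B = "A - {a, f a}"
    have "even (card ?B)"
    proof (rule psubset.IH)
      show "?B \<subset> A" using a by blast
      show "f b \<in> ?B" if "b \<in> ?B" for b using that a psubset.prems by (metis Diff_iff insert_iff singletonD)
    qed (use psubset.prems in auto)
    moreover have "card A = card ?B + card {a, f a}"
      using a psubset by (metis Un_Diff_cancel2 card_Un_disjoint Diff_disjoint Int_commute finite_Diff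
          finite.emptyI finite_insert insert_subset empty_subsetI sup.absorb1)
    moreover have "card {a, f a} = 2" using psubset.prems(3)[OF a] by (simp add: card_insert_if)
    ultimately show ?thesis by simp
  qed simp
qed

text \<open>In characteristic 2 the sum of two such elements of finite sets belongs to the symmetric
  difference. The subsets of a finite subgroup thus give a copy of its group algebra over the field
  with two elements, a finite set even if the coefficient ring is infinite.\<close>

definition indicator_element :: "'g set \<Rightarrow> ('g \<Rightarrow>\<^sub>0 'k::comm_ring_1)" where
  "indicator_element S = (\<Sum>x\<in>S. Poly_Mapping.single x 1)"

lemma lookup_indicator_element:
  "finite S \<Longrightarrow> Poly_Mapping.lookup (indicator_element S) x = (if x \<in> S then 1 else 0)"
  by (simp add: indicator_element_def lookup_sum lookup_single when_def)

lemma indicator_element_eq_iff: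
  assumes "finite S" "finite T"
  shows "(indicator_element S :: 'g \<Rightarrow>\<^sub>0 'k::comm_ring_1) = indicator_element T \<longleftrightarrow> S = T"
proof
  assume "(indicator_element S :: 'g \<Rightarrow>\<^sub>0 'k) = indicator_element T"
  then have "(if x \<in> S then 1 else 0 :: 'k) = (if x \<in> T then 1 else 0)" for x
    using lookup_indicator_element[OF assms(1)] lookup_indicator_element[OF assms(2)] by metis
  then show "S = T" by (metis subsetI subset_antisym zero_neq_one)
qed simp

lemma indicator_element_add:
  assumes "\<And>a::'k::comm_ring_1. a + a = 0" "finite S" "finite T"
  shows "(indicator_element S :: 'g \<Rightarrow>\<^sub>0 'k) + indicator_element T = indicator_element ((S - T) \<union> (T - S))"
  by (rule poly_mapping_eqI)
    (use assms(2,3) in \<open>auto simp only: lookup_add lookup_indicator_element finite_Un finite_Diff assms(1)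
      Un_iff Diff_iff if_True if_False add_0_left add_0_right simp_thms split: if_splits\<close>)

lemma conv_sum_left: "conv G (sum f S) c = (\<Sum>x\<in>S. conv G (f x) c)"
  by (induction S rule: infinite_finite_induct) (simp_all add: conv_add_left)

lemma conv_sum_right: "conv G c (sum f S) = (\<Sum>x\<in>S. conv G c (f x))"
  by (induction S rule: infinite_finite_induct) (simp_all add: conv_add_right)

context group
begin

lemma conv_indicator_right:
  assumes "S \<subseteq> carrier G" "g \<in> carrier G"
  shows "conv G (indicator_element S) (Poly_Mapping.single g 1) = indicator_element ((\<lambda>x. x \<otimes> g) ` S)"
proof -
  have "inj_on (\<lambda>x. x \<otimes> g) S" using assms by (intro inj_onI) (metis r_cancel subsetD)
  then show ?thesis by (simp add: indicator_element_def conv_sum_left sum.reindex)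
qed

lemma conv_indicator_left:
  assumes "S \<subseteq> carrier G" "g \<in> carrier G"
  shows "conv G (Poly_Mapping.single g 1) (indicator_element S) = indicator_element ((\<lambda>x. g \<otimes> x) ` S)"
proof -
  have "inj_on (\<lambda>x. g \<otimes> x) S" using assms by (intro inj_onI) (metis l_cancel subsetD)
  then show ?thesis by (simp add: indicator_element_def conv_sum_right sum.reindex)
qed

text \<open>
  The elements with coefficients \<open>0\<close> and \<open>1\<close> supported on a finite subgroup \<open>P\<close> form a finite set,
  so it suffices that right multiplication by \<open>1 + g + x\<close> is injective on it. Its kernel is
  permuted by the \<open>2\<close>-group \<open>P\<close>; if nonzero it has even cardinality and thus contains a nonzero
  element fixed by \<open>P\<close>, which can only be the sum of \<open>P\<close>; but that one is mapped to itself.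
\<close>

lemma left_inverse_sum_of_three:
  assumes two: "\<And>a::'k::comm_ring_1. a + a = 0"
    and P: "subgroup P G" "finite P" "\<forall>x\<in>P. \<exists>n. ord x = 2 ^ n"
    and g: "g \<in> P" and x: "x \<in> P"
  shows "\<exists>y\<in>galg G. conv G y (Poly_Mapping.single \<one> (1::'k) + Poly_Mapping.single g 1 + Poly_Mapping.single x 1)
    = Poly_Mapping.single \<one> 1"
proof -
  interpret P: group "G\<lparr>carrier := P\<rparr>" using P(1) subgroup_imp_group by blast
  have PG: "P \<subseteq> carrier G" using P(1) subgroup.subset by blast
  define R where "R = (indicator_element ` Pow P :: ('a \<Rightarrow>\<^sub>0 'k) set)"
  define f where "f y = conv G y (Poly_Mapping.single \<one> (1::'k) + Poly_Mapping.single g 1 + Poly_Mapping.single x 1)" for y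
  have finR: "finite R" using P(2) by (simp add: R_def)
  have fS: "finite S" if "S \<subseteq> P" for S using that P(2) finite_subset by blast
  have Rgalg: "y \<in> galg G" if y: "y \<in> R" for y
  proof -
    obtain S where S: "S \<subseteq> P" "y = indicator_element S" using y by (auto simp: R_def)
    show ?thesis unfolding S(2) galg_def
      using S(1) PG fS[OF S(1)] by (auto simp: lookup_indicator_element in_keys_iff split: if_splits)
  qed
  have Radd: "y + y' \<in> R" if y: "y \<in> R" "y' \<in> R" for y y'
  proof -
    obtain S T where S: "S \<subseteq> P" "y = indicator_element S" and T: "T \<subseteq> P" "y' = indicator_element T"
      using y by (auto simp: R_def)
    have "y + y' = indicator_element ((S - T) \<union> (T - S))"
      unfolding S T using indicator_element_add[OF two] fS S T by blast
    then show ?thesis using S T by (auto simp: R_def)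
  qed
  have Rmul: "conv G y (Poly_Mapping.single h 1) \<in> R" "conv G (Poly_Mapping.single h 1) y \<in> R"
    if y: "y \<in> R" and h: "h \<in> P" for y h
  proof -
    obtain S where S: "S \<subseteq> P" "y = indicator_element S" using y by (auto simp: R_def)
    have "(\<lambda>x. x \<otimes> h) ` S \<subseteq> P" "(\<lambda>x. h \<otimes> x) ` S \<subseteq> P"
      using S(1) h subgroup.m_closed[OF P(1)] by auto
    then show "conv G y (Poly_Mapping.single h 1) \<in> R" "conv G (Poly_Mapping.single h 1) y \<in> R"
      using conv_indicator_right[of S h] conv_indicator_left[of S h] S order_trans[OF S(1) PG] subsetD[OF PG h]
      by (auto simp: R_def)
  qed
  have f: "f y = y + conv G y (Poly_Mapping.single g 1) + conv G y (Poly_Mapping.single x 1)" if "y \<in> R" for y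
    unfolding f_def using Rgalg[OF that] by (simp add: conv_distrib)
  have fR: "f ` R \<subseteq> R" using f Radd Rmul g x by auto
  have fadd: "f (y + y') = f y + f y'" for y y' by (simp add: f_def conv_distrib)
  have two': "y + y = 0" for y :: "'a \<Rightarrow>\<^sub>0 'k"
    by (rule poly_mapping_eqI) (simp add: lookup_add two)
  have "inj_on f R"
  proof (rule inj_onI, rule ccontr)
    fix y y' assume y: "y \<in> R" "y' \<in> R" "f y = f y'" "y \<noteq> y'"
    define k where "k = y + y'"
    define L where "L = {y \<in> R. f y = 0}"
    have "k \<noteq> 0"
    proof
      assume "k = 0"
      then have "y + y' = y' + y'" using two'[of y'] by (simp add: k_def)
      then show False using y(4) by simp
    qed
    have kL: "k \<in> L" using y Radd by (simp add: L_def k_def fadd two')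
    have finL: "finite L" using finR by (simp add: L_def)
    \<comment> \<open>\<open>k\<close> is the difference of \<open>y\<close> and \<open>y'\<close>,
      as signs do not matter. Translation of the kernel \<open>L\<close> by it is an involution
      without fixed points.\<close>
    have "even (card L)"
      by (rule even_card_involution[of _ "\<lambda>y. y + k"])
        (use finL kL \<open>k \<noteq> 0\<close> Radd in \<open>auto simp: L_def fadd add.assoc two'\<close>)
    have zL: "0 \<in> L"
      using two'[of k] kL Radd[of k k] fadd[of k k] by (simp add: L_def two')
    \<comment> \<open>Restricted to \<open>L\<close>, because \<open>BijGroup L\<close> consists of
      functions that are undefined outside \<open>L\<close>. Left multiplication preserves
      \<open>L\<close> since \<open>f\<close> multiplies on the right.\<close>
    define \<phi> where "\<phi> p = (\<lambda>y\<in>L. conv G (Poly_Mapping.single p (1::'k)) y)" for p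
    have Lmul: "conv G (Poly_Mapping.single p 1) y \<in> L" if "p \<in> P" "y \<in> L" for p y
    proof -
      have "f (conv G (Poly_Mapping.single p 1) y) = conv G (Poly_Mapping.single p 1) (f y)"
        unfolding f_def using that PG g x
        by (intro conv_assoc) (auto simp: L_def Rgalg intro!: galg_intros)
      then show ?thesis using that Rmul by (simp add: L_def)
    qed
    have comp: "conv G (Poly_Mapping.single p 1) (conv G (Poly_Mapping.single q 1) y)
        = conv G (Poly_Mapping.single (p \<otimes> q) 1) y" if "p \<in> P" "q \<in> P" "y \<in> L" for p q y
      using that PG by (subst conv_assoc[symmetric]) (auto simp: L_def Rgalg intro!: galg_intros)
    have one: "conv G (Poly_Mapping.single \<one> 1) y = y" if "y \<in> L" for y
      using that by (simp add: L_def Rgalg)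
    have inv_P: "inv p \<in> P" "p \<otimes> inv p = \<one>" "inv p \<otimes> p = \<one>" if "p \<in> P" for p
      using that P(1) PG by (auto simp: subgroup.m_inv_closed subsetD)
    interpret A: group_action "G\<lparr>carrier := P\<rparr>" L \<phi>
    proof (unfold group_action_def group_hom_def group_hom_axioms_def, intro conjI homI)
      show "group (G\<lparr>carrier := P\<rparr>)" by (rule P.is_group)
      show "group (BijGroup L)" by (rule group_BijGroup)
      show B: "\<phi> p \<in> carrier (BijGroup L)" if "p \<in> carrier (G\<lparr>carrier := P\<rparr>)" for p
      proof -
        have "bij_betw (conv G (Poly_Mapping.single p 1)) L L"
          using that inv_P by (intro bij_betw_byWitness[of _ "conv G (Poly_Mapping.single (inv p) 1)"])
            (auto simp: comp one Lmul)
        then have "bij_betw (\<phi> p) L L" unfolding \<phi>_def by (subst bij_betw_restrict_eq) 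
        then show ?thesis by (simp add: BijGroup_def Bij_def \<phi>_def)
      qed
      show "\<phi> (p \<otimes>\<^bsub>G\<lparr>carrier := P\<rparr>\<^esub> q) = \<phi> p \<otimes>\<^bsub>BijGroup L\<^esub> \<phi> q"
        if "p \<in> carrier (G\<lparr>carrier := P\<rparr>)" "q \<in> carrier (G\<lparr>carrier := P\<rparr>)" for p q
        using B[OF that(1)] B[OF that(2)] that
        by (auto simp: BijGroup_def compose_def \<phi>_def comp Lmul fun_eq_iff restrict_def)
    qed
    have "\<exists>n. group.ord (G\<lparr>carrier := P\<rparr>) p = 2 ^ n" if "p \<in> P" for p
      using that P(3) ord_subgroup[OF P(1)] by simp
    then have pr: "q = 2" if "Factorial_Ring.prime q" "q dvd order (G\<lparr>carrier := P\<rparr>)" for q :: nat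
      using P.finite_p_group_prime_dvd[of 2 q] that P(2) by simp
    obtain y where y: "y \<in> L" "y \<noteq> 0" "\<And>p. p \<in> P \<Longrightarrow> \<phi> p y = y"
      using A.even_card_imp_second_fixed_point[OF pr finL \<open>even (card L)\<close> zL]
      by (auto simp: \<phi>_def zL)
    obtain S where S: "S \<subseteq> P" "y = indicator_element S" using y(1) by (auto simp: L_def R_def)
    have "S \<noteq> {}" using S(2) y(2) by (auto simp: indicator_element_def)
    then obtain s where s: "s \<in> S" by blast
    \<comment> \<open>The support of a fixed element is invariant under left multiplication, which
      is transitive on \<open>P\<close>.\<close>
    have "P \<subseteq> S"
    proof
      fix q assume q: "q \<in> P"
      define p where "p = q \<otimes> inv s"
      have p: "p \<in> P" "p \<otimes> s = q" unfolding p_def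
        using q s S(1) PG P(1) inv_P by (auto simp: subgroup.m_closed m_assoc subset_iff)
      have "conv G (Poly_Mapping.single p 1) y = y" using y(3)[OF p(1)] y(1) by (simp add: \<phi>_def)
      then have "indicator_element ((\<lambda>x. p \<otimes> x) ` S) = (indicator_element S :: 'a \<Rightarrow>\<^sub>0 'k)"
        unfolding S(2) by (simp add: conv_indicator_left order_trans[OF S(1) PG] subsetD[OF PG p(1)])
      then have "(\<lambda>x. p \<otimes> x) ` S = S"
        by (simp add: indicator_element_eq_iff fS[OF S(1)])
      then show "q \<in> S" using s p(2) by blast
    qed
    then have yP: "y = indicator_element P" using S by auto
    have tr: "conv G y (Poly_Mapping.single h 1) = y" if "h \<in> P" for h
    proof -
      have "(\<lambda>x. x \<otimes> h) ` P = P"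
      proof
        show "(\<lambda>x. x \<otimes> h) ` P \<subseteq> P" using that P(1) by (auto simp: subgroup.m_closed)
        have "p = (p \<otimes> inv h) \<otimes> h \<and> p \<otimes> inv h \<in> P" if "p \<in> P" for p
          using \<open>h \<in> P\<close> that PG P(1) inv_P by (auto simp: subgroup.m_closed m_assoc subset_iff)
        then show "P \<subseteq> (\<lambda>x. x \<otimes> h) ` P" by blast
      qed
      then show ?thesis using yP conv_indicator_right[OF PG, of h] that PG by auto
    qed
    have "f y = y + y + y" using f[of y] y(1) tr g x by (simp add: L_def)
    then show False using y(1,2) by (simp add: L_def two')
  qed
  then have "f ` R = R" using endo_inj_surj finR fR by blast
  moreover have "Poly_Mapping.single \<one> 1 \<in> R"
    using P(1) subgroup.one_closed by (force simp: R_def indicator_element_def)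
  ultimately obtain y where "y \<in> R" "f y = Poly_Mapping.single \<one> 1" by (metis imageE)
  then show ?thesis using Rgalg unfolding f_def by blast
qed

text \<open>So far there are only left inverses. The involution turns one of 1 + g^-1 + x^-1 into a
  right inverse of 1 + g + x, and a left and a right inverse agree. The augmentation is 3 =
  1.\<close>

lemma sum_of_three_normalized_unit:
  fixes K :: "'k::comm_ring_1 itself"
  assumes two: "\<And>a::'k. a + a = 0"
    and P: "subgroup P G" "finite P" "\<forall>x\<in>P. \<exists>n. ord x = 2 ^ n"
    and g: "g \<in> P" and x: "x \<in> P"
  shows "Poly_Mapping.single \<one> 1 + Poly_Mapping.single g 1 + Poly_Mapping.single x 1
    \<in> carrier (normalized_units K G)"
proof -
  let ?u = "\<lambda>g x. Poly_Mapping.single \<one> (1::'k) + Poly_Mapping.single g 1 + Poly_Mapping.single x 1"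
  have G: "g \<in> carrier G" "x \<in> carrier G" using assms subgroup.mem_carrier by metis+
  have u: "?u g x \<in> galg G" using G by (intro galg_intros) auto
  obtain y where y: "y \<in> galg G" "conv G y (?u g x) = Poly_Mapping.single \<one> 1"
    using left_inverse_sum_of_three[OF two P g x] by blast
  have "inv g \<in> P" "inv x \<in> P" using P(1) g x subgroup.m_inv_closed by metis+
  then obtain w where w: "w \<in> galg G" "conv G w (?u (inv g) (inv x)) = Poly_Mapping.single \<one> 1"
    using left_inverse_sum_of_three[OF two P] by blast
  have "group_star G (?u (inv g) (inv x)) = ?u g x" using G by (simp add: star_add)
  moreover have "?u (inv g) (inv x) \<in> galg G" using G by (intro galg_intros) auto
  ultimately have w': "conv G (?u g x) (group_star G w) = Poly_Mapping.single \<one> 1"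
    using star_conv[OF w(1), of "?u (inv g) (inv x)"] w(2) by simp
  have sw: "group_star G w \<in> galg G" using w star_closed by blast
  have "y = conv G y (conv G (?u g x) (group_star G w))" unfolding w' using y by simp
  also have "\<dots> = conv G (conv G y (?u g x)) (group_star G w)"
    using conv_assoc[OF y(1) u sw] by simp
  also have "\<dots> = group_star G w" unfolding y using sw by simp
  finally have "y = group_star G w" .
  then have "conv G (?u g x) y = Poly_Mapping.single \<one> 1" using w' by simp
  moreover have "augmentation (?u g x) = 1" using two[of 1] by (simp add: augmentation_add)
  ultimately show ?thesis unfolding normalized_units_iff using y u by blast
qed


section \<open>What normality says about conjugation in the group\<close>

text \<open>For u = 1 + g + x^-1 one finds star(u) u = 1 + (g + g^-1) + (x + x^-1) + (w + w^-1) with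
  w = g^-1 x^-1. Hence the commutators of g + g^-1 and of w + w^-1 with x are equal. The first is
  not zero, so the second contains w x = g^-1. But g^-1 occurs in the first only if x is 1 or g^-2,
  and then x commutes with g.\<close>

lemma normal_imp_fixed_or_inverted:
  fixes K :: "'k::comm_ring_1 itself"
  assumes two: "\<And>a::'k. a + a = 0" and lf: "locally_finite_group G" and pG: "p_group 2 G"
    and N: "unitary_normalized_units K G \<lhd> normalized_units K G"
  shows "fixed_or_inverted G"
proof (rule ccontr)
  assume "\<not> fixed_or_inverted G"
  then obtain g x where g: "g \<in> carrier G" and x: "x \<in> carrier G" and gg: "g \<otimes> g \<noteq> \<one>"
    and gx: "g \<otimes> x \<noteq> x \<otimes> g" "g \<otimes> x \<noteq> x \<otimes> inv g"
    unfolding fixed_or_inverted_def by blast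
  \<comment> \<open>The commutator of y + y^-1 with x; in characteristic 2 it needs no
    signs.\<close>
  define D where "D y = Poly_Mapping.single (y \<otimes> x) (1::'k) + Poly_Mapping.single (inv y \<otimes> x) 1
      + Poly_Mapping.single (x \<otimes> y) 1 + Poly_Mapping.single (x \<otimes> inv y) 1" for y
  have two': "y + y = 0" "y + (y + z) = z" for y z :: "'a \<Rightarrow>\<^sub>0 'k"
    by (rule poly_mapping_eqI, simp add: lookup_add two add.assoc[symmetric])+
  have eq0: "y = z" if "y + z = 0" for y z :: "'a \<Rightarrow>\<^sub>0 'k"
    using two'(2)[of z y] that by (simp add: add.commute)
  have D_lookup: "Poly_Mapping.lookup (D y) (y \<otimes> x) = 1"
    if y: "y \<in> carrier G" "y \<otimes> y \<noteq> \<one>" "y \<otimes> x \<noteq> x \<otimes> y" "y \<otimes> x \<noteq> x \<otimes> inv y" for y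
  proof -
    have "inv y \<otimes> x \<noteq> y \<otimes> x"
      using y(1,2) x by (metis r_cancel inv_closed l_inv)
    then show ?thesis using y(3,4) unfolding D_def by (simp add: lookup_add lookup_single when_def)
  qed
  have D_zero: "D y = 0"
    if y: "y \<in> carrier G" "y \<otimes> y = \<one> \<or> y \<otimes> x = x \<otimes> y \<or> y \<otimes> x = x \<otimes> inv y" for y
  proof -
    consider "inv y = y" | "y \<otimes> x = x \<otimes> y" "inv y \<otimes> x = x \<otimes> inv y"
      | "y \<otimes> x = x \<otimes> inv y" "inv y \<otimes> x = x \<otimes> y"
      using y x commute_inv[of y x y] commute_inv[of y x "inv y"] inv_equality[of y y] by auto
    then show ?thesis by cases (simp_all add: D_def two' add_ac)
  qed
  define w where "w = inv g \<otimes> inv x"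
  have w: "w \<in> carrier G" "w \<otimes> x = inv g" "inv w = x \<otimes> g"
    using g x by (simp_all add: w_def m_assoc inv_mult_group)
  define P where "P = generate G {g, inv x}"
  have P: "subgroup P G" "finite P" "g \<in> P" "inv x \<in> P"
    unfolding P_def using g x lf generate_is_subgroup[of "{g, inv x}"] generate.incl[of _ "{g, inv x}" G]
    by (auto simp: locally_finite_group_def)
  have P2: "\<forall>x\<in>P. \<exists>n. ord x = 2 ^ n" using pG P(1) subgroup.subset by (fastforce simp: p_group_def)
  define u where "u = Poly_Mapping.single \<one> (1::'k) + Poly_Mapping.single g 1 + Poly_Mapping.single (inv x) 1"
  have u: "u \<in> carrier (normalized_units K G)"
    unfolding u_def by (rule sum_of_three_normalized_unit[OF two P(1,2) P2 P(3,4)])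
  have "D g + D w + (conv G (conv G (group_star G u) u) (Poly_Mapping.single x 1)
      + conv G (Poly_Mapping.single x 1) (conv G (group_star G u) u)) = 0"
    using g x w by (simp add: u_def D_def star_add conv_distrib two' add_ac m_assoc[symmetric] w_def[symmetric])
  then have "D g + D w = 0" using unitary_normal_imp[OF N u x] by (simp add: two')
  then have DD: "D g = D w" by (rule eq0)
  have "Poly_Mapping.lookup (D g) (g \<otimes> x) = 1" using D_lookup g gg gx by blast
  then have "D w \<noteq> 0" using DD by auto
  \<comment> \<open>By \<open>D_zero\<close> and \<open>D_lookup\<close>, \<open>D w\<close> is
    either zero or has coefficient 1 at \<open>w \<otimes> x\<close>, which is
    \<open>inv g\<close>.\<close>
  then have "Poly_Mapping.lookup (D w) (w \<otimes> x) = 1" using D_lookup D_zero w(1) by blast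
  then have "Poly_Mapping.lookup (D g) (inv g) \<noteq> 0" using DD w by simp
  then consider "inv g = g \<otimes> x" | "inv g = inv g \<otimes> x" | "inv g = x \<otimes> g" | "inv g = x \<otimes> inv g"
    unfolding D_def by (auto simp: lookup_add lookup_single when_def split: if_splits)
  then have "g \<otimes> x = x \<otimes> g"
  proof cases
    case 1
    then have "x = inv g \<otimes> inv g" using g x by (metis inv_solve_left inv_closed)
    then show ?thesis using g by (simp add: m_assoc[symmetric]) (simp add: m_assoc)
  next
    case 2
    then have "x = \<one>" using g x by (metis inv_closed r_one l_cancel one_closed)
    then show ?thesis using g by simp
  next
    case 3
    then have "x = inv g \<otimes> inv g" using g x by (metis inv_solve_right inv_closed)
    then show ?thesis using g by (simp add: m_assoc[symmetric]) (simp add: m_assoc)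
  next
    case 4
    then have "x = \<one>" using g x by (metis inv_closed l_one r_cancel one_closed)
    then show ?thesis using g by simp
  qed
  then show False using gx by blast
qed

text \<open>c (1 + g) times the sum of the powers (-g)^i with i < n telescopes to c (1 - (-g)^n).
  For odd n = ord g this is 2 c, which is 1 for c = 1/2.\<close>

lemma geometric_sum_conv:
  fixes c :: "'k::comm_ring_1"
  assumes "g \<in> carrier G"
  defines "w \<equiv> (\<lambda>n. \<Sum>i<n. Poly_Mapping.single (g [^] (i::nat)) ((- 1) ^ i :: 'k))"
  defines "u \<equiv> Poly_Mapping.single \<one> c + Poly_Mapping.single g c"
  shows "conv G u (w n) = Poly_Mapping.single \<one> c - Poly_Mapping.single (g [^] n) ((- 1) ^ n * c)"
    and "conv G (w n) u = Poly_Mapping.single \<one> c - Poly_Mapping.single (g [^] n) ((- 1) ^ n * c)"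
proof -
  show "conv G u (w n) = Poly_Mapping.single \<one> c - Poly_Mapping.single (g [^] n) ((- 1) ^ n * c)"
  proof (induction n)
    case (Suc n)
    then show ?case using assms(1) nat_pow_Suc2[of g n]
      by (simp add: w_def u_def conv_distrib single_uminus mult.commute del: nat_pow_Suc)
  qed (simp add: w_def)
  show "conv G (w n) u = Poly_Mapping.single \<one> c - Poly_Mapping.single (g [^] n) ((- 1) ^ n * c)"
  proof (induction n)
    case (Suc n)
    then show ?case using assms(1)
      by (simp add: w_def u_def conv_distrib single_uminus mult.commute eq_diff_eq add_ac)
  qed (simp add: w_def)
qed

text \<open>For u = (1 + g)/2 the element star(u) u is (2 + g + g^-1)/4, so conjugation by x maps g
  to g or g^-1. In the second case x^2 centralizes g, and x is a power of x^2 because its order is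
  odd.\<close>

lemma normal_imp_commute_if_odd:
  fixes K :: "'k::field itself"
  assumes two: "(2::'k) \<noteq> 0" and odd: "\<And>x. x \<in> carrier G \<Longrightarrow> odd (ord x)"
    and N: "unitary_normalized_units K G \<lhd> normalized_units K G"
    and g: "g \<in> carrier G" and x: "x \<in> carrier G"
  shows "g \<otimes> x = x \<otimes> g"
proof -
  define u where "u = Poly_Mapping.single \<one> (1 / 2 :: 'k) + Poly_Mapping.single g (1 / 2)"
  define w where "w = (\<Sum>i\<in>{..<ord g}. Poly_Mapping.single (g [^] i) ((- 1 :: 'k) ^ i))"
  have ww: "w \<in> galg G"
    unfolding w_def using g by (intro galg_sum galg_single) simp
  have "conv G u w = Poly_Mapping.single \<one> (1 / 2) - Poly_Mapping.single \<one> (- (1 / 2))"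
    "conv G w u = Poly_Mapping.single \<one> (1 / 2) - Poly_Mapping.single \<one> (- (1 / 2))"
    unfolding u_def w_def geometric_sum_conv[OF g] using g odd[OF g] by simp_all
  moreover have "Poly_Mapping.single \<one> (1 / 2) - Poly_Mapping.single \<one> (- (1 / 2)) = Poly_Mapping.single \<one> (1::'k)"
    unfolding single_diff[symmetric] using two by (simp add: field_simps)
  ultimately have "conv G u w = Poly_Mapping.single \<one> 1" "conv G w u = Poly_Mapping.single \<one> 1"
    by simp_all
  moreover have "u \<in> galg G" unfolding u_def using g by (intro galg_intros) auto
  moreover have "augmentation u = 1" using two by (simp add: u_def augmentation_add field_simps)
  ultimately have u: "u \<in> carrier (normalized_units K G)"
    unfolding normalized_units_iff using ww by blast
  have "Poly_Mapping.single (g \<otimes> x) (1 / 4 :: 'k) + Poly_Mapping.single (inv g \<otimes> x) (1 / 4)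
      = Poly_Mapping.single (x \<otimes> g) (1 / 4) + Poly_Mapping.single (x \<otimes> inv g) (1 / 4)"
    using unitary_normal_imp[OF N u x] g x by (simp add: u_def star_add conv_distrib add_ac)
  then have "Poly_Mapping.lookup (Poly_Mapping.single (g \<otimes> x) (1 / 4 :: 'k) + Poly_Mapping.single (inv g \<otimes> x) (1 / 4)) (g \<otimes> x)
      = Poly_Mapping.lookup (Poly_Mapping.single (x \<otimes> g) (1 / 4) + Poly_Mapping.single (x \<otimes> inv g) (1 / 4)) (g \<otimes> x)"
    by simp
  \<comment> \<open>The coefficient of the left side at \<open>g \<otimes> x\<close> is 1/4, or 1/4
    + 1/4 if \<open>inv g \<otimes> x\<close> is the same element. Neither may vanish.\<close>
  moreover have "(1 / 4 :: 'k) \<noteq> 0" "(1 / 4 :: 'k) + 1 / 4 \<noteq> 0"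
    using two by (auto simp: field_simps) (metis mult_eq_0_iff numeral_Bit0 mult_2 numeral_times_numeral)+
  ultimately have "g \<otimes> x = x \<otimes> g \<or> g \<otimes> x = x \<otimes> inv g"
    by (auto simp: lookup_add lookup_single when_def split: if_splits)
  then show ?thesis
  proof
    assume a: "g \<otimes> x = x \<otimes> inv g"
    then have "inv g \<otimes> x = x \<otimes> g" using commute_inv[of g x "inv g"] g x by simp
    with a have "g \<otimes> (x \<otimes> x) = (x \<otimes> x) \<otimes> g" using g x by (metis m_assoc inv_closed)
    then have *: "g \<otimes> (x \<otimes> x) [^] n = (x \<otimes> x) [^] n \<otimes> g" for n :: nat
      using group_commutes_pow[of "x \<otimes> x" g n] g x by simp
    obtain k where k: "ord x = 2 * k + 1" using odd[OF x] by (elim oddE)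
    have "(x \<otimes> x) [^] (k + 1) = x [^] (2 * (k + 1))"
      using x nat_pow_pow[OF x, of 2 "k + 1"] by (simp add: numeral_2_eq_2)
    also have "\<dots> = x [^] ord x \<otimes> x" unfolding k using x by (simp add: m_assoc nat_pow_mult[symmetric])
    also have "\<dots> = x" using x by simp
    finally show ?thesis using *[of "k + 1"] by simp
  qed
qed

lemma fixed_or_inverted_imp_normal:
  fixes K :: "'k::comm_ring_1 itself"
  assumes "\<And>a::'k. a + a = 0" "fixed_or_inverted G"
  shows "unitary_normalized_units K G \<lhd> normalized_units K G"
  using unitary_normal_if star_mult_self_central assms by blast

end

section \<open>Structure of the groups\<close>

text \<open>Common to extraspecial 2-groups and their central products with a cyclic group of order
  4, also after adding an elementary abelian direct factor. It controls inversion and commutation up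
  to a factor z; the value z = 1 is allowed.\<close>

definition squares_central :: "('g, 'm) monoid_scheme \<Rightarrow> 'g \<Rightarrow> bool" where
  "squares_central G z \<longleftrightarrow> z \<in> group_centre G \<and>
    (\<forall>x\<in>carrier G. x \<otimes>\<^bsub>G\<^esub> x = \<one>\<^bsub>G\<^esub> \<or> x \<otimes>\<^bsub>G\<^esub> x = z)"

context group
begin

lemma inv_cancel_left:
  assumes "x \<in> carrier G" "y \<in> carrier G"
  shows "inv x \<otimes> (x \<otimes> y) = y" "x \<otimes> (inv x \<otimes> y) = y"
  using assms by (simp_all add: m_assoc[symmetric])

lemmas word_simps = m_assoc inv_mult_group inv_cancel_left

text \<open>The extension step of the maximality arguments; it also builds the cyclic group of order
  4 and the factor of type (i). Closure under inverses comes from (m y)^-1 = y^-2 (y m^-1).\<close>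

lemma subgroup_Un_rcoset:
  assumes M: "subgroup M G" and y: "y \<in> carrier G" "y \<otimes> y \<in> M"
    and conj: "\<And>m. m \<in> M \<Longrightarrow> y \<otimes> m \<otimes> inv y \<in> M"
  shows "subgroup (M \<union> (\<lambda>m. m \<otimes> y) ` M) G"
proof -
  note MG = subgroup.mem_carrier[OF M] and Mm = subgroup.m_closed[OF M] and Mi = subgroup.m_inv_closed[OF M]
  let ?N = "M \<union> (\<lambda>m. m \<otimes> y) ` M"
  have 1: "y \<otimes> m \<in> (\<lambda>m. m \<otimes> y) ` M" if "m \<in> M" for m
  proof
    show "y \<otimes> m = (y \<otimes> m \<otimes> inv y) \<otimes> y" using that y MG by (simp add: m_assoc)
  qed (use conj that in auto)
  have 2: "m \<otimes> n \<in> ?N" if "m \<in> M" "n \<in> ?N" for m n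
    using that y MG Mm by (auto simp: m_assoc[symmetric])
  have 3: "y \<otimes> n \<in> ?N" if n: "n \<in> ?N" for n
  proof (cases "n \<in> M")
    case False
    then obtain m where m: "m \<in> M" "n = m \<otimes> y" using n by auto
    have "y \<otimes> n = (y \<otimes> m \<otimes> inv y) \<otimes> (y \<otimes> y)" using m y MG by (simp add: word_simps)
    then show ?thesis using conj[OF m(1)] y Mm by simp
  qed (use 1 in auto)
  show ?thesis
  proof (rule subgroupI)
    show "?N \<subseteq> carrier G" using MG y by auto
    show "?N \<noteq> {}" using subgroup.one_closed[OF M] by auto
  next
    fix a b assume a: "a \<in> ?N" and b: "b \<in> ?N"
    show "a \<otimes> b \<in> ?N"
    proof (cases "a \<in> M")
      case True then show ?thesis using 2 b by blast
    next
      case False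
      then obtain m where m: "m \<in> M" "a = m \<otimes> y" using a by auto
      have "b \<in> carrier G" using b MG y by auto
      then have "a \<otimes> b = m \<otimes> (y \<otimes> b)" using m y MG by (simp add: m_assoc)
      then show ?thesis using 2[OF m(1) 3[OF b]] by simp
    qed
  next
    fix a assume a: "a \<in> ?N"
    show "inv a \<in> ?N"
    proof (cases "a \<in> M")
      case True then show ?thesis using Mi by blast
    next
      case False
      then obtain m where m: "m \<in> M" "a = m \<otimes> y" using a by auto
      have "inv a = inv (y \<otimes> y) \<otimes> (y \<otimes> inv m)" using m y MG by (simp add: word_simps)
      moreover have "y \<otimes> inv m \<in> ?N" using 3 Mi[OF m(1)] by blast
      ultimately show ?thesis using 2 Mi[OF y(2)] by simp
    qed
  qed
qed

text \<open>Conjugates are products of squares and elements of \<open>B\<close>: x b x^-1 = (x b)^2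
  b^-1 x^-2.\<close>

lemma normal_if_squares:
  assumes B: "subgroup B G" and sq: "\<And>x. x \<in> carrier G \<Longrightarrow> x \<otimes> x \<in> B"
  shows "B \<lhd> G"
  unfolding normal_inv_iff
proof (intro conjI ballI B)
  fix x b assume x: "x \<in> carrier G" and b: "b \<in> B"
  have bG: "b \<in> carrier G" using B b subgroup.mem_carrier by metis
  have "x \<otimes> b \<otimes> inv x = (x \<otimes> b) \<otimes> (x \<otimes> b) \<otimes> inv b \<otimes> inv (x \<otimes> x)"
    using x bG by (simp add: word_simps)
  then show "x \<otimes> b \<otimes> inv x \<in> B"
    using sq x b bG B by (simp add: subgroup.m_closed subgroup.m_inv_closed)
qed

lemma subgroup_Union_chain:
  assumes "C \<noteq> {}" "\<And>B. B \<in> C \<Longrightarrow> subgroup B G" "\<And>A B. A \<in> C \<Longrightarrow> B \<in> C \<Longrightarrow> A \<subseteq> B \<or> B \<subseteq> A"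
  shows "subgroup (\<Union>C) G"
proof (rule subgroupI)
  show "\<Union>C \<subseteq> carrier G" using assms(2) subgroup.subset by blast
  show "\<Union>C \<noteq> {}" using assms(1,2) subgroup.one_closed by (metis UnionI ex_in_conv)
  show "inv a \<in> \<Union>C" if "a \<in> \<Union>C" for a
    using that assms(2) subgroup.m_inv_closed by (metis Union_iff)
  show "a \<otimes> b \<in> \<Union>C" if "a \<in> \<Union>C" "b \<in> \<Union>C" for a b
  proof -
    obtain A B where "A \<in> C" "a \<in> A" "B \<in> C" "b \<in> B" using \<open>a \<in> \<Union>C\<close> \<open>b \<in> \<Union>C\<close> by blast
    then show ?thesis using assms(2,3) subgroup.m_closed by (metis UnionI subsetD)
  qed
qed

text \<open>Modulo \<open>P\<close> the group is a vector space over the field with two elements.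
  \<open>B\<close> is maximal among the subgroups above \<open>P\<close> that meet \<open>E\<close>
  only inside \<open>P\<close>; for a outside \<open>B\<close>, maximality yields some b a in
  \<open>E\<close>, and a = b^-1 (b a). As \<open>E\<close> is any set containing the identity,
  \<open>E = {\<one>, h}\<close> is possible.\<close>

lemma exists_relative_complement:
  assumes P: "subgroup P G" and sq: "\<And>x. x \<in> carrier G \<Longrightarrow> x \<otimes> x \<in> P"
    and E: "E \<subseteq> carrier G" "\<one> \<in> E"
  obtains B where "subgroup B G" "P \<subseteq> B" "B \<inter> E \<subseteq> P" "B <#> E = carrier G"
proof -
  define \<A> where "\<A> = {B. subgroup B G \<and> P \<subseteq> B \<and> B \<inter> E \<subseteq> P}"
  have "\<exists>B\<in>\<A>. \<forall>U\<in>\<A>. B \<subseteq> U \<longrightarrow> U = B"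
  proof (rule subset_Zorn_nonempty)
    show "\<A> \<noteq> {}" using P by (auto simp: \<A>_def)
    fix C assume C: "C \<noteq> {}" "subset.chain \<A> C"
    then have CA: "B \<in> \<A>" if "B \<in> C" for B using that by (auto simp: subset.chain_def)
    have "subgroup (\<Union>C) G"
      by (rule subgroup_Union_chain) (use C CA in \<open>auto simp: subset_chain_def \<A>_def\<close>)
    then show "\<Union>C \<in> \<A>" using CA C(1) unfolding \<A>_def by blast
  qed
  then obtain B where "B \<in> \<A>" and max': "\<And>U. U \<in> \<A> \<Longrightarrow> B \<subseteq> U \<Longrightarrow> U = B" by blast
  then have B: "subgroup B G" "P \<subseteq> B" "B \<inter> E \<subseteq> P" by (auto simp: \<A>_def)
  have max: "\<And>U. subgroup U G \<Longrightarrow> P \<subseteq> U \<Longrightarrow> U \<inter> E \<subseteq> P \<Longrightarrow> B \<subseteq> U \<Longrightarrow> U = B"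
    using max' by (simp add: \<A>_def)
  have BG: "B \<subseteq> carrier G" using B subgroup.subset by blast
  have nB: "B \<lhd> G" using normal_if_squares B sq by blast
  have "a \<in> B <#> E" if a: "a \<in> carrier G" for a
  proof (cases "a \<in> B")
    case True
    then have "a = a \<otimes> \<one>" using a by simp
    then show ?thesis using True E unfolding set_mult_def by blast
  next
    case False
    let ?N = "B \<union> (\<lambda>m. m \<otimes> a) ` B"
    have N: "subgroup ?N G"
      by (rule subgroup_Un_rcoset[OF B(1) a]) (use sq[OF a] B nB a in \<open>auto simp: normal_inv_iff\<close>)
    have "a \<in> ?N" using a subgroup.one_closed[OF B(1)] by (force intro: image_eqI[of _ _ "\<one>"])
    then have "\<not> ?N \<inter> E \<subseteq> P" using False max[OF N] B(2) by blast
    then obtain e where e: "e \<in> E" "e \<in> ?N" "e \<notin> P" by blast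
    then obtain b where b: "b \<in> B" "e = b \<otimes> a" using B(3) by blast
    have "a = inv b \<otimes> e" using b a BG by (simp add: subsetD inv_cancel_left)
    then show ?thesis using e b subgroup.m_inv_closed[OF B(1)] unfolding set_mult_def by blast
  qed
  moreover have "B <#> E \<subseteq> carrier G" using BG E set_mult_closed by blast
  ultimately show thesis using that B by blast
qed

lemma exists_relative_complement_in_subgroup:
  assumes V: "subgroup V G" and P: "subgroup P G" "P \<subseteq> V" and sq: "\<And>x. x \<in> V \<Longrightarrow> x \<otimes> x \<in> P"
    and E: "E \<subseteq> V" "\<one> \<in> E"
  obtains B where "subgroup B G" "P \<subseteq> B" "B \<subseteq> V" "B \<inter> E \<subseteq> P" "B <#> E = V"
proof -
  interpret V: group "G\<lparr>carrier := V\<rparr>" using subgroup_imp_group[OF V] .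
  obtain B where B: "subgroup B (G\<lparr>carrier := V\<rparr>)" "P \<subseteq> B" "B \<inter> E \<subseteq> P"
    "B <#>\<^bsub>G\<lparr>carrier := V\<rparr>\<^esub> E = carrier (G\<lparr>carrier := V\<rparr>)"
    by (rule V.exists_relative_complement[OF subgroup_incl[OF P(1) V P(2)], of E]) (use sq E in auto)
  have "B <#> E = V" using B(4) by (simp add: set_mult_def)
  then show thesis using that[OF incl_subgroup[OF V B(1)] B(2) _ B(3)] subgroup.subset[OF B(1)] by simp
qed

lemma group_centreD: "z \<in> group_centre G \<Longrightarrow> z \<in> carrier G"
  "z \<in> group_centre G \<Longrightarrow> x \<in> carrier G \<Longrightarrow> z \<otimes> x = x \<otimes> z"
  by (auto simp: group_centre_def)

lemma group_centre_subgroup: "subgroup (group_centre G) G"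
proof (rule subgroupI)
  show "group_centre G \<subseteq> carrier G" "group_centre G \<noteq> {}"
    by (auto simp: group_centre_def intro: exI[of _ \<one>])
  show "inv a \<in> group_centre G" if a: "a \<in> group_centre G" for a
    unfolding group_centre_def
  proof (intro CollectI conjI ballI)
    fix x assume x: "x \<in> carrier G"
    show "inv a \<otimes> x = x \<otimes> inv a"
      by (rule commute_inv) (use group_centreD[OF a] x in blast)+
  qed (use group_centreD(1)[OF a] in simp)
  show "a \<otimes> b \<in> group_centre G" if a: "a \<in> group_centre G" and b: "b \<in> group_centre G" for a b
    unfolding group_centre_def
  proof (intro CollectI conjI ballI)
    fix x assume x: "x \<in> carrier G"
    have "a \<otimes> b \<otimes> x = a \<otimes> (x \<otimes> b)" 
      using group_centreD(1)[OF a] group_centreD(1)[OF b] group_centreD(2)[OF b x] x by (simp add: m_assoc)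
    also have "\<dots> = a \<otimes> x \<otimes> b"
      using group_centreD(1)[OF a] group_centreD(1)[OF b] x by (simp add: m_assoc)
    also have "\<dots> = x \<otimes> a \<otimes> b" using group_centreD(2)[OF a x] by simp
    finally show "a \<otimes> b \<otimes> x = x \<otimes> (a \<otimes> b)"
      using group_centreD(1)[OF a] group_centreD(1)[OF b] x by (simp add: m_assoc)
  qed (use group_centreD(1)[OF a] group_centreD(1)[OF b] in simp)
qed

lemma squares_central_involution:
  assumes "squares_central G z" shows "z \<otimes> z = \<one>"
  using assms unfolding squares_central_def group_centre_def by (metis (no_types, lifting) l_cancel_one mem_Collect_eq)

lemma squares_central_inv:
  assumes "squares_central G z" "x \<in> carrier G"
  shows "inv x = (if x \<otimes> x = \<one> then x else z \<otimes> x)"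
proof -
  have z: "z \<in> carrier G" "z \<otimes> z = \<one>"
    using assms squares_central_involution group_centreD unfolding squares_central_def by blast+
  have "(if x \<otimes> x = \<one> then x else z \<otimes> x) \<otimes> x = \<one>"
    using assms z by (auto simp: squares_central_def m_assoc)
  then show ?thesis using assms(2) z by (intro inv_equality) auto
qed

text \<open>x y is the inverse of y^-1 x^-1, and inverting an element changes it at most by the
  factor z, which is central.\<close>

lemma squares_central_commute:
  assumes sc: "squares_central G z" and x: "x \<in> carrier G" and y: "y \<in> carrier G"
  shows "x \<otimes> y = y \<otimes> x \<or> x \<otimes> y = z \<otimes> (y \<otimes> x)"
proof -
  have zc: "z \<in> group_centre G" using sc by (simp add: squares_central_def)
  note z = group_centreD(1)[OF zc] group_centreD(2)[OF zc, symmetric] squares_central_involution[OF sc]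
  have zz: "z \<otimes> (z \<otimes> w) = w" if "w \<in> carrier G" for w using that z(1,3) by (simp add: m_assoc[symmetric])
  have zl: "y \<otimes> (z \<otimes> x) = z \<otimes> (y \<otimes> x)"
    using x y z(1) z(2)[OF y] by (simp add: m_assoc[symmetric])
  define p where "p = inv y \<otimes> inv x"
  have p: "p \<in> carrier G" "p = y \<otimes> x \<or> p = z \<otimes> (y \<otimes> x)"
    unfolding p_def squares_central_inv[OF sc x] squares_central_inv[OF sc y]
    using x y z(1) by (auto simp: m_assoc zz zl)
  have "x \<otimes> y = inv p" unfolding p_def using x y by (simp add: inv_mult_group)
  then have "x \<otimes> y = p \<or> x \<otimes> y = z \<otimes> p" using squares_central_inv[OF sc p(1)] by presburger
  then show ?thesis using p(2) zz[OF m_closed[OF y x]] by auto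
qed

text \<open>If g^2 is not 1, then it is z, so g^-1 = z g, and commuting up to the factor z means
  being fixed or inverted.\<close>

lemma squares_central_imp_fixed_or_inverted:
  assumes sc: "squares_central G z" shows "fixed_or_inverted G"
  unfolding fixed_or_inverted_def
proof (intro ballI disjCI)
  fix g x assume g: "g \<in> carrier G" and x: "x \<in> carrier G"
    and n: "\<not> (\<forall>x\<in>carrier G. g \<otimes> x = x \<otimes> g \<or> g \<otimes> x = x \<otimes> inv g)"
  show "g \<otimes> g = \<one>"
  proof (rule ccontr)
    assume "g \<otimes> g \<noteq> \<one>"
    then have i: "inv g = z \<otimes> g" using squares_central_inv[OF sc g] by simp
    have zc: "z \<in> group_centre G" using sc by (simp add: squares_central_def)
    note z = group_centreD(1)[OF zc] group_centreD(2)[OF zc, symmetric]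
    have "x \<otimes> inv g = z \<otimes> (x \<otimes> g)" if "x \<in> carrier G" for x
      unfolding i using g z that by (metis m_assoc)
    then show False using n squares_central_commute[OF sc g] by metis
  qed
qed


section \<open>Extraspecial 2-groups, finite or infinite\<close>

lemma group_centre_left_commute:
  assumes "z \<in> group_centre G" "x \<in> carrier G" "y \<in> carrier G"
  shows "x \<otimes> (z \<otimes> y) = z \<otimes> (x \<otimes> y)"
  using group_centreD[OF assms(1)] assms(2,3) by (metis m_assoc)

text \<open>If M misses z, then G is the union of M and M z. Removing central factors z from a and b
  leaves a noncommuting pair in M, whose commutator is z.\<close>

lemma centre_generator_in_maximal_subgroup:
  assumes sc: "squares_central G z" and ab: "a \<in> carrier G" "b \<in> carrier G" "a \<otimes> b \<noteq> b \<otimes> a"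
    and M: "maximal_subgroup M G"
  shows "z \<in> M"
proof (rule ccontr)
  assume zM: "z \<notin> M"
  have zc: "z \<in> group_centre G" using sc by (simp add: squares_central_def)
  note z = group_centreD(1)[OF zc]
  have Ms: "subgroup M G" and max: "\<And>L. subgroup L G \<Longrightarrow> M \<subseteq> L \<Longrightarrow> L = M \<or> L = carrier G"
    using M by (auto simp: maximal_subgroup_def)
  note MG = subgroup.mem_carrier[OF Ms]
  let ?N = "M \<union> (\<lambda>m. m \<otimes> z) ` M"
  have "z \<otimes> m \<otimes> inv z \<in> M" if "m \<in> M" for m
    using that z MG group_centreD(2)[OF zc MG[OF that]] by (simp add: m_assoc)
  then have N: "subgroup ?N G"
    using subgroup_Un_rcoset[OF Ms z] squares_central_involution[OF sc] subgroup.one_closed[OF Ms] by simp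
  have "z \<in> ?N" using z subgroup.one_closed[OF Ms] by (force intro: image_eqI[of _ _ "\<one>"])
  then have "?N = carrier G" using max[OF N] zM by blast
  then have split: "\<exists>m\<in>M. g = m \<or> g = z \<otimes> m" if "g \<in> carrier G" for g
    using that group_centreD(2)[OF zc] MG by (metis (no_types, lifting) UnE imageE)
  obtain m n where m: "m \<in> M" "a = m \<or> a = z \<otimes> m" and n: "n \<in> M" "b = n \<or> b = z \<otimes> n"
    using split ab by meson
  have "m \<otimes> n \<noteq> n \<otimes> m"
    using ab(3) m n MG z group_centre_left_commute[OF zc MG MG, of m n]
      group_centre_left_commute[OF zc MG MG, of n m] by (auto simp: m_assoc)
  then have e: "m \<otimes> n = z \<otimes> (n \<otimes> m)" using squares_central_commute[OF sc] m n MG by blast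
  have "z = m \<otimes> n \<otimes> inv (n \<otimes> m)" unfolding e using m n MG z by (simp add: m_assoc)
  then show False using zM m n Ms by (metis subgroup.m_closed subgroup.m_inv_closed)
qed

text \<open>Commutators lie in {1, z}, and a and b make z occur. An h outside {1, z} is not in the
  Frattini subgroup, because a relative complement of {1, h} over {1, z} is a subgroup of index 2
  without h.\<close>

lemma extraspecialI:
  assumes p: "p_group 2 G" and sc: "squares_central G z" and Z: "group_centre G = {\<one>, z}" and z1: "z \<noteq> \<one>"
    and ab: "a \<in> carrier G" "b \<in> carrier G" "a \<otimes> b \<noteq> b \<otimes> a"
  shows "extraspecial 2 G"
proof -
  have zc: "z \<in> group_centre G" using sc by (simp add: squares_central_def)
  note z = group_centreD(1)[OF zc]
  have Zs: "subgroup {\<one>, z} G" using group_centre_subgroup Z by simp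
  have comm: "x \<otimes> y \<otimes> inv x \<otimes> inv y = (if x \<otimes> y = y \<otimes> x then \<one> else z)"
    if "x \<in> carrier G" "y \<in> carrier G" for x y
  proof -
    have "x \<otimes> y \<otimes> inv x \<otimes> inv y = x \<otimes> y \<otimes> inv (y \<otimes> x)"
      using that by (simp add: word_simps)
    moreover have "z \<otimes> (y \<otimes> x) \<otimes> inv (y \<otimes> x) = z" "y \<otimes> x \<otimes> inv (y \<otimes> x) = \<one>"
      using that z by (simp_all add: m_assoc)
    ultimately show ?thesis using squares_central_commute[OF sc that] by auto
  qed
  have D: "derived G (carrier G) = {\<one>, z}"
  proof
    show "derived G (carrier G) \<subseteq> {\<one>, z}"
      unfolding derived_def by (rule generate_subgroup_incl[OF _ Zs]) (auto simp: comm)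
    have "z \<in> derived_set G (carrier G)" using ab comm[OF ab(1,2)] by force
    then have "z \<in> derived G (carrier G)" unfolding derived_def by (rule generate.incl)
    moreover have "\<one> \<in> derived G (carrier G)" unfolding derived_def by (rule generate.one)
    ultimately show "{\<one>, z} \<subseteq> derived G (carrier G)" by blast
  qed
  have F: "frattini_subgroup G = {\<one>, z}"
  proof
    show "{\<one>, z} \<subseteq> frattini_subgroup G"
      using centre_generator_in_maximal_subgroup[OF sc ab] z
      by (auto simp: frattini_subgroup_def maximal_subgroup_def subgroup.one_closed)
    show "frattini_subgroup G \<subseteq> {\<one>, z}"
    proof (rule subsetI, rule ccontr)
      fix h assume h: "h \<in> frattini_subgroup G" "h \<notin> {\<one>, z}"
      then have hG: "h \<in> carrier G" by (simp add: frattini_subgroup_def)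
      obtain B where B: "subgroup B G" "{\<one>, z} \<subseteq> B" "B \<inter> {\<one>, h} \<subseteq> {\<one>, z}" "B <#> {\<one>, h} = carrier G"
        using exists_relative_complement[OF Zs, of "{\<one>, h}"] hG sc by (auto simp: squares_central_def)
      note BG = subgroup.mem_carrier[OF B(1)]
      have hB: "h \<notin> B" using B(3) h(2) by blast
      have "maximal_subgroup B G"
        unfolding maximal_subgroup_def
      proof (intro conjI allI impI B)
        show "B \<noteq> carrier G" using hB hG by blast
        fix L assume L: "subgroup L G \<and> B \<subseteq> L"
        show "L = B \<or> L = carrier G"
        proof (rule disjCI)
          assume "L \<noteq> carrier G"
          show "L = B"
          proof (rule ccontr)
            assume "L \<noteq> B"
            then obtain l where l: "l \<in> L" "l \<notin> B" using L by blast
            then have "l \<in> B <#> {\<one>, h}" using B(4) L subgroup.mem_carrier by metis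
            then obtain b where b: "b \<in> B" "l = b \<otimes> h" using l BG by (auto simp: set_mult_def)
            then have "h = inv b \<otimes> l" using BG hG by (simp add: inv_cancel_left)
            then have "h \<in> L" using L l b by (metis subgroup.m_closed subgroup.m_inv_closed subsetD)
            then have "B <#> {\<one>, h} \<subseteq> L"
              using L subgroup.m_closed subgroup.one_closed by (fastforce simp: set_mult_def)
            then show False using \<open>L \<noteq> carrier G\<close> B(4) L subgroup.subset by blast
          qed
        qed
      qed
      then show False using h(1) hB by (auto simp: frattini_subgroup_def)
    qed
  qed
  show ?thesis unfolding extraspecial_def Z D F using p z1 by (simp add: card_insert_if)
qed

text \<open>Squares have to lie in every maximal subgroup M, for then they lie in the Frattini
  subgroup, that is, in the centre. As M contains all commutators, it is closed under conjugation.
  If g^2 were outside M, then so would be g^4, g^8 and so on, although one of these is 1.\<close>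

lemma extraspecial_imp_squares_central:
  assumes es: "extraspecial 2 G"
  obtains z where "squares_central G z" "group_centre G = {\<one>, z}" "z \<noteq> \<one>"
proof -
  have Z: "group_centre G = derived G (carrier G)" "derived G (carrier G) = frattini_subgroup G"
    "card (group_centre G) = 2" and p: "\<And>x. x \<in> carrier G \<Longrightarrow> \<exists>n. ord x = 2 ^ n"
    using es by (auto simp: extraspecial_def p_group_def)
  have "\<one> \<in> group_centre G" using group_centre_subgroup subgroup.one_closed by blast
  then obtain z where z: "group_centre G = {\<one>, z}" "z \<noteq> \<one>"
    using Z(3) unfolding card_2_iff by fastforce
  have "g \<otimes> g \<in> M" if M: "maximal_subgroup M G" and g: "g \<in> carrier G" for g M
  proof (rule ccontr)
    assume ggM: "g \<otimes> g \<notin> M"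
    have Ms: "subgroup M G" and max: "\<And>L. subgroup L G \<Longrightarrow> M \<subseteq> L \<Longrightarrow> L = M \<or> L = carrier G"
      using M by (auto simp: maximal_subgroup_def)
    note MG = subgroup.mem_carrier[OF Ms]
    have DM: "derived G (carrier G) \<subseteq> M" unfolding Z(2) frattini_subgroup_def using M by blast
    have conj: "x \<otimes> m \<otimes> inv x \<in> M" if "x \<in> carrier G" "m \<in> M" for x m
    proof -
      have "x \<otimes> m \<otimes> inv x \<otimes> inv m \<in> derived G (carrier G)"
        unfolding derived_def using that MG by (intro generate.incl UN_I[of x] UN_I[of m]) simp_all
      then have "x \<otimes> m \<otimes> inv x \<otimes> inv m \<otimes> m \<in> M"
        by (intro subgroup.m_closed[OF Ms] subsetD[OF DM] that(2))
      then show ?thesis using that MG by (simp add: m_assoc)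
    qed
    \<comment> \<open>If w^4 is in M but w^2 is not, then M and M w^2 together are all of G. As w is
      not in M, it has the form m w^2 with m in M, so w = m^-1 is in M after all.\<close>
    have step: "(w \<otimes> w) \<otimes> (w \<otimes> w) \<notin> M" if w: "w \<in> carrier G" "w \<otimes> w \<notin> M" for w
    proof
      assume w4: "(w \<otimes> w) \<otimes> (w \<otimes> w) \<in> M"
      let ?N = "M \<union> (\<lambda>m. m \<otimes> (w \<otimes> w)) ` M"
      have N: "subgroup ?N G" by (rule subgroup_Un_rcoset[OF Ms _ w4]) (use w conj in auto)
      have "w \<otimes> w \<in> ?N" using w subgroup.one_closed[OF Ms] by (force intro: image_eqI[of _ _ "\<one>"])
      then have "?N = carrier G" using max[OF N] w(2) by blast
      moreover have wM: "w \<notin> M" using w(2) subgroup.m_closed[OF Ms] by blast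
      ultimately obtain m where m: "m \<in> M" "w = m \<otimes> (w \<otimes> w)" using w(1) by blast
      then have "\<one> \<otimes> w = m \<otimes> w \<otimes> w" using w MG by (simp add: m_assoc)
      then have "m \<otimes> w = \<one>" using w MG m(1) by (metis r_cancel m_closed one_closed)
      then have "w = inv m" using w MG m(1) by (metis inv_equality inv_comm inv_inv)
      then show False using wM subgroup.m_inv_closed[OF Ms m(1)] by simp
    qed
    have "g [^] ((2::nat) ^ Suc k) \<notin> M" for k
    proof (induction k)
      case 0 then show ?case using ggM g by (simp add: numeral_2_eq_2)
    next
      case (Suc k)
      have "g [^] ((2::nat) ^ Suc k) = g [^] ((2::nat) ^ k) \<otimes> g [^] ((2::nat) ^ k)"
        "g [^] ((2::nat) ^ Suc (Suc k)) = g [^] ((2::nat) ^ Suc k) \<otimes> g [^] ((2::nat) ^ Suc k)"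
        using g by (simp_all only: nat_pow_mult) (simp_all add: mult_2)
      then show ?case using step[of "g [^] ((2::nat) ^ k)"] Suc g by auto
    qed
    moreover obtain n where n: "ord g = 2 ^ n" using p g by blast
    have "g [^] ((2::nat) ^ Suc n) = \<one>" using pow_eq_id[OF g] n by simp
    ultimately show False using subgroup.one_closed[OF Ms] by metis
  qed
  then have "g \<otimes> g \<in> group_centre G" if "g \<in> carrier G" for g
    unfolding Z(1) Z(2) frattini_subgroup_def using that by blast
  then have "squares_central G z" unfolding squares_central_def using z by auto
  then show thesis using that z by blast
qed

section \<open>The listed groups satisfy the conjugation condition\<close>

text \<open>Elements of \<open>A\<close> commute with \<open>A\<close> and are inverted by
  everything outside. An element h a outside \<open>A\<close> has square h (a h) a = h h a^-1 a =
  1.\<close>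

lemma inverting_imp_fixed_or_inverted:
  assumes "inverting_semidirect_product G"
  shows "fixed_or_inverted G"
proof -
  obtain A h where h: "h \<in> carrier G" and A: "A \<lhd> G" and Ac: "comm_group (G\<lparr>carrier := A\<rparr>)"
    and o: "ord h = 2" and gen: "generate G {h} <#> A = carrier G"
    and conj: "\<And>a. a \<in> A \<Longrightarrow> inv h \<otimes> a \<otimes> h = inv a"
    using assms unfolding inverting_semidirect_product_def by blast
  have As: "subgroup A G" using A normal_imp_subgroup by blast
  note AG = subgroup.mem_carrier[OF As]
  have Acomm: "a \<otimes> b = b \<otimes> a" if "a \<in> A" "b \<in> A" for a b
    using comm_groupE(4)[OF Ac] that by simp
  have hh: "h \<otimes> h = \<one>" using pow_ord_eq_1[OF h] o h by (simp add: numeral_2_eq_2)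
  then have ih: "inv h = h" using h by (simp add: inv_equality)
  have "subgroup {\<one>, h} G" by (rule subgroupI) (use h hh ih in auto)
  then have "generate G {h} \<subseteq> {\<one>, h}" by (intro generate_subgroup_incl) auto
  then have split: "g \<in> A \<or> (\<exists>a\<in>A. g = h \<otimes> a)" if "g \<in> carrier G" for g
    using that gen AG unfolding set_mult_def by fastforce
  have ah: "a \<otimes> h = h \<otimes> inv a" if "a \<in> A" for a
    using conj[OF that, symmetric] that h AG by (simp add: word_simps)
  show ?thesis
    unfolding fixed_or_inverted_def
  proof (intro ballI)
    fix g assume g: "g \<in> carrier G"
    show "g \<otimes> g = \<one> \<or> (\<forall>x\<in>carrier G. g \<otimes> x = x \<otimes> g \<or> g \<otimes> x = x \<otimes> inv g)"
    proof (cases "g \<in> A")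
      case True
      have "g \<otimes> x = x \<otimes> g \<or> g \<otimes> x = x \<otimes> inv g" if x: "x \<in> carrier G" for x
      proof (cases "x \<in> A")
        case False
        then obtain b where b: "b \<in> A" "x = h \<otimes> b" using split x by blast
        have "g \<otimes> x = (g \<otimes> h) \<otimes> b" using True b h AG by (simp add: m_assoc)
        also have "\<dots> = h \<otimes> (inv g \<otimes> b)" using True b h AG by (simp add: ah m_assoc)
        also have "\<dots> = h \<otimes> (b \<otimes> inv g)"
          using Acomm[OF subgroup.m_inv_closed[OF As True] b(1)] by simp
        finally show ?thesis using True b h AG by (simp add: m_assoc)
      qed (use Acomm True in blast)
      then show ?thesis by blast
    next
      case False
      then obtain a where a: "a \<in> A" "g = h \<otimes> a" using split g by blast
      have "g \<otimes> g = h \<otimes> (a \<otimes> h) \<otimes> a" using a h AG by (simp add: m_assoc)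
      also have "\<dots> = \<one>" using a h AG hh by (simp add: ah m_assoc[symmetric])
      finally show ?thesis by blast
    qed
  qed
qed

text \<open>A factor from \<open>E\<close> is central and its own inverse, so it cancels from each
  alternative for e h, leaving that for h. \<open>E\<close> and \<open>H\<close> commute because a
  commutator of normal subgroups lies in their intersection.\<close>

lemma direct_product_fixed_or_inverted:
  assumes dp: "direct_product_of_subgroups G E H"
    and E: "elementary_abelian_2_group (G\<lparr>carrier := E\<rparr>)"
    and fi: "fixed_or_inverted (G\<lparr>carrier := H\<rparr>)"
  shows "fixed_or_inverted G"
proof -
  have EH: "E \<lhd> G" "H \<lhd> G" "E \<inter> H = {\<one>}" "E <#> H = carrier G"
    using dp by (auto simp: direct_product_of_subgroups_def)
  have Es: "subgroup E G" and Hs: "subgroup H G" using EH normal_imp_subgroup by blast+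
  note EG = subgroup.mem_carrier[OF Es] and HG = subgroup.mem_carrier[OF Hs]
  have Ecomm: "a \<otimes> b = b \<otimes> a" if "a \<in> E" "b \<in> E" for a b
    using E that comm_groupE(4) by (fastforce simp: elementary_abelian_2_group_def)
  have Einv: "inv a = a" if "a \<in> E" for a
    using E that EG by (intro inv_equality) (auto simp: elementary_abelian_2_group_def)
  have comm: "h \<otimes> e = e \<otimes> h" if e: "e \<in> E" and h: "h \<in> H" for e h
  proof -
    have c: "e \<otimes> h \<otimes> inv e \<otimes> inv h = \<one>"
    proof -
      have "e \<otimes> h \<otimes> inv e \<in> H" "h \<otimes> inv e \<otimes> inv h \<in> E"
        using EH(1,2) e h EG HG subgroup.m_inv_closed[OF Es e] unfolding normal_inv_iff by blast+
      then have "e \<otimes> h \<otimes> inv e \<otimes> inv h \<in> H" "e \<otimes> (h \<otimes> inv e \<otimes> inv h) \<in> E"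
        using e h Es Hs by (auto simp: subgroup.m_closed subgroup.m_inv_closed)
      then show ?thesis using EH(3) e h EG HG by (simp add: m_assoc) blast
    qed
    have "e \<otimes> h = (e \<otimes> h \<otimes> inv e \<otimes> inv h) \<otimes> (h \<otimes> e)" using e h EG HG by (simp add: word_simps)
    then show ?thesis using c e h EG HG by simp
  qed
  have split: "\<exists>e\<in>E. \<exists>h\<in>H. g = e \<otimes> h" if "g \<in> carrier G" for g
    using that EH(4) unfolding set_mult_def by blast
  have swap: "(e \<otimes> h) \<otimes> (e' \<otimes> h') = (e \<otimes> e') \<otimes> (h \<otimes> h')"
    if "e \<in> E" "h \<in> H" "e' \<in> E" "h' \<in> H" for e h e' h'
  proof -
    have "(e \<otimes> h) \<otimes> (e' \<otimes> h') = e \<otimes> (h \<otimes> e') \<otimes> h'" using that EG HG by (simp add: m_assoc)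
    also have "\<dots> = e \<otimes> (e' \<otimes> h) \<otimes> h'" using comm that by simp
    finally show ?thesis using that EG HG by (simp add: m_assoc)
  qed
  show ?thesis
    unfolding fixed_or_inverted_def
  proof (intro ballI)
    fix g assume "g \<in> carrier G"
    then obtain e h where g: "e \<in> E" "h \<in> H" "g = e \<otimes> h" using split by blast
    have ee: "e \<otimes> e = \<one>" using g E by (simp add: elementary_abelian_2_group_def)
    have ig: "inv g = e \<otimes> inv h"
      using g comm[OF g(1) subgroup.m_inv_closed[OF Hs g(2)]] EG HG by (simp add: inv_mult_group Einv)
    have "h \<otimes> h = \<one> \<or> (\<forall>x\<in>H. h \<otimes> x = x \<otimes> h \<or> h \<otimes> x = x \<otimes> inv h)"
      using bspec[OF fi[unfolded fixed_or_inverted_def], of h] g(2) by (simp add: m_inv_consistent[OF Hs])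
    then show "g \<otimes> g = \<one> \<or> (\<forall>x\<in>carrier G. g \<otimes> x = x \<otimes> g \<or> g \<otimes> x = x \<otimes> inv g)"
    proof
      assume "h \<otimes> h = \<one>"
      then have "g \<otimes> g = \<one>" using swap[OF g(1,2) g(1,2)] g ee by simp
      then show ?thesis ..
    next
      assume hx: "\<forall>x\<in>H. h \<otimes> x = x \<otimes> h \<or> h \<otimes> x = x \<otimes> inv h"
      have "g \<otimes> x = x \<otimes> g \<or> g \<otimes> x = x \<otimes> inv g" if xG: "x \<in> carrier G" for x
      proof -
        obtain f k where x: "f \<in> E" "k \<in> H" "x = f \<otimes> k" using split[OF xG] by blast
        have "g \<otimes> x = f \<otimes> e \<otimes> (h \<otimes> k)"
          using swap[OF g(1,2) x(1,2)] Ecomm[OF g(1) x(1)] g(3) x(3) by simp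
        moreover have "x \<otimes> g = f \<otimes> e \<otimes> (k \<otimes> h)"
          using swap[OF x(1,2) g(1,2)] g(3) x(3) by simp
        moreover have "x \<otimes> inv g = f \<otimes> e \<otimes> (k \<otimes> inv h)"
          using swap[OF x(1,2) g(1) subgroup.m_inv_closed[OF Hs g(2)]] ig x(3) by simp
        moreover have "h \<otimes> k = k \<otimes> h \<or> h \<otimes> k = k \<otimes> inv h" using hx x(2) by blast
        ultimately show ?thesis by presburger
      qed
      then show ?thesis by blast
    qed
  qed
qed


end

text \<open>Squares are restricted only after applying \<open>h\<close>. In the product of an
  extraspecial group with a cyclic group of order 4 there can be four of them, which collapse to two
  in the central product.\<close>

lemma (in group_hom) squares_central_image:
  assumes surj: "h ` carrier G = carrier H" and w: "w \<in> group_centre G"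
    and sq: "\<And>x. x \<in> carrier G \<Longrightarrow> h (x \<otimes> x) = \<one>\<^bsub>H\<^esub> \<or> h (x \<otimes> x) = h w"
  shows "squares_central H (h w)"
  unfolding squares_central_def group_centre_def
proof (intro conjI CollectI ballI)
  have wG: "w \<in> carrier G" using w G.group_centreD(1) by blast
  then show "h w \<in> carrier H" by simp
  fix y assume "y \<in> carrier H"
  then obtain x where x: "x \<in> carrier G" "y = h x" using surj by blast
  show "h w \<otimes>\<^bsub>H\<^esub> y = y \<otimes>\<^bsub>H\<^esub> h w"
    using x wG G.group_centreD(2)[OF w x(1)] by (simp flip: hom_mult)
  show "y \<otimes>\<^bsub>H\<^esub> y = \<one>\<^bsub>H\<^esub> \<or> y \<otimes>\<^bsub>H\<^esub> y = h w"
    using sq[OF x(1)] x by simp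
qed

text \<open>A square in the direct product is (1 or z, 0 or 2). Factoring out (z, 2) identifies (1,
  2) with (z, 0), whose image is the required element.\<close>

lemma (in group) central_product_C4_squares_central:
  assumes "extraspecial_central_product_C4 G"
  obtains w where "squares_central G w"
proof -
  obtain Q :: "'a monoid" where es: "extraspecial 2 Q" and iso: "G \<cong> central_product_C4 Q"
    using assms unfolding extraspecial_central_product_C4_def by blast
  interpret Q: group Q using es by (simp add: extraspecial_def p_group_def)
  obtain z where z: "squares_central Q z" "group_centre Q = {\<one>\<^bsub>Q\<^esub>, z}" "z \<noteq> \<one>\<^bsub>Q\<^esub>"
    using Q.extraspecial_imp_squares_central[OF es] by blast
  have zc: "z \<in> group_centre Q" using z(1) by (simp add: squares_central_def)
  note zQ = Q.group_centreD(1)[OF zc] Q.squares_central_involution[OF z(1)]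
  note zcomm = Q.group_centreD(2)[OF zc]
  define Z4 where "Z4 = integer_mod_group 4"
  have Z4: "carrier Z4 = {0..<4}" "monoid.mult Z4 = (\<lambda>x y. (x + y) mod 4)" "one Z4 = 0" "group Z4"
    by (simp_all add: Z4_def carrier_integer_mod_group)
  define P where "P = Q \<times>\<times> Z4"
  interpret P: group P unfolding P_def by (rule DirProd_group[OF Q.is_group Z4(4)])
  have Pc: "carrier P = carrier Q \<times> {0..<4}" "one P = (\<one>\<^bsub>Q\<^esub>, 0)"
    and Pm: "\<And>a i b j. (a, i) \<otimes>\<^bsub>P\<^esub> (b, j) = (a \<otimes>\<^bsub>Q\<^esub> b, (i + j) mod 4)"
    by (auto simp: P_def DirProd_def Z4)
  define N where "N = {(\<one>\<^bsub>Q\<^esub>, 0 :: int), (z, 2)}"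
  have N: "N = insert (\<one>\<^bsub>Q\<^esub>, 0) ((\<lambda>z. (z, 2)) ` (group_centre Q - {\<one>\<^bsub>Q\<^esub>}))"
    using z by (auto simp: N_def)
  have NP: "N \<subseteq> carrier P" using zQ by (auto simp: N_def Pc)
  have Ncomm: "n \<otimes>\<^bsub>P\<^esub> x = x \<otimes>\<^bsub>P\<^esub> n" if n: "n \<in> N" and x: "x \<in> carrier P" for n x
  proof -
    obtain a i where a: "x = (a, i)" "a \<in> carrier Q" using x by (auto simp: Pc)
    show ?thesis using n a(2) by (auto simp: N_def a(1) Pm zcomm[OF a(2)] add.commute)
  qed
  have Nm: "n \<otimes>\<^bsub>P\<^esub> m \<in> N" if "n \<in> N" "m \<in> N" for n m using that zQ by (auto simp: N_def Pm)
  have Ns: "subgroup N P"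
  proof (rule P.subgroupI)
    show "inv\<^bsub>P\<^esub> n \<in> N" if n: "n \<in> N" for n
    proof -
      have "n \<otimes>\<^bsub>P\<^esub> n = \<one>\<^bsub>P\<^esub>" using n zQ by (auto simp: N_def Pm Pc)
      then show ?thesis using n NP P.inv_equality[of n n] by auto
    qed
  qed (use NP Nm in \<open>auto simp: N_def\<close>)
  have Nn: "N \<lhd> P"
    unfolding P.normal_inv_iff
  proof (intro conjI ballI Ns)
    fix x n assume x: "x \<in> carrier P" and n: "n \<in> N"
    have "x \<otimes>\<^bsub>P\<^esub> n \<otimes>\<^bsub>P\<^esub> inv\<^bsub>P\<^esub> x = n"
      using x subsetD[OF NP n] by (simp add: Ncomm[OF n x, symmetric] P.m_assoc)
    then show "x \<otimes>\<^bsub>P\<^esub> n \<otimes>\<^bsub>P\<^esub> inv\<^bsub>P\<^esub> x \<in> N" using n by simp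
  qed
  interpret N: normal N P by (rule Nn)
  have CP: "central_product_C4 Q = P Mod N"
    by (simp add: central_product_C4_def N P_def Z4_def)
  obtain \<psi> where \<psi>: "\<psi> \<in> iso (P Mod N) G"
    using iso_sym[OF iso[unfolded CP]] unfolding is_iso_def by blast
  \<comment> \<open>The quotient map followed by an isomorphism onto \<open>G\<close>; it lets all
    computations take place with pairs.\<close>
  define f where "f = (\<lambda>x. \<psi> (N #>\<^bsub>P\<^esub> x))"
  have "\<psi> \<circ> (\<lambda>x. N #>\<^bsub>P\<^esub> x) \<in> hom P G"
    using Group.hom_compose[OF N.r_coset_hom_Mod] \<psi> by (auto simp: iso_def)
  then interpret f: group_hom P G f
    by unfold_locales (simp add: f_def o_def)
  have surj: "f ` carrier P = carrier G"
  proof -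
    have "(\<lambda>x. N #>\<^bsub>P\<^esub> x) ` carrier P = carrier (P Mod N)" by (auto simp: FactGroup_def RCOSETS_def)
    moreover have "\<psi> ` carrier (P Mod N) = carrier G" using \<psi> by (auto simp: iso_def bij_betw_def)
    ultimately show ?thesis unfolding f_def by (metis image_image)
  qed
  have "N #>\<^bsub>P\<^esub> (z, 2) = N #>\<^bsub>P\<^esub> \<one>\<^bsub>P\<^esub>"
    using P.coset_join2[OF _ Ns, of "(z, 2)"] P.coset_join2[OF _ Ns, of "\<one>\<^bsub>P\<^esub>"] NP by (auto simp: N_def Pc)
  then have f1: "f (z, 2) = \<one>" using f.hom_one by (simp add: f_def)
  have f2: "f (\<one>\<^bsub>Q\<^esub>, 2) = f (z, 0)"
  proof -
    have "f (z, 0) = f ((z, 2) \<otimes>\<^bsub>P\<^esub> (\<one>\<^bsub>Q\<^esub>, 2))" using zQ by (simp add: Pm)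
    then show ?thesis using f1 zQ by (simp add: Pc)
  qed
  have "squares_central G (f (z, 0))"
  proof (rule f.squares_central_image[OF surj])
    have "(z, 0) \<otimes>\<^bsub>P\<^esub> x = x \<otimes>\<^bsub>P\<^esub> (z, 0)" if x: "x \<in> carrier P" for x
    proof -
      obtain a i where a: "x = (a, i)" "a \<in> carrier Q" using x by (auto simp: Pc)
      show ?thesis by (simp add: a(1) Pm zcomm[OF a(2)])
    qed
    then show "(z, 0) \<in> group_centre P" using zQ by (simp add: group_centre_def Pc)
    fix x assume "x \<in> carrier P"
    then obtain q i where x: "x = (q, i)" "q \<in> carrier Q" "i \<in> {0..<4}" by (auto simp: Pc)
    have "(i + i) mod 4 = 0 \<or> (i + i) mod 4 = 2" using x(3) by auto presburger
    moreover have "q \<otimes>\<^bsub>Q\<^esub> q = \<one>\<^bsub>Q\<^esub> \<or> q \<otimes>\<^bsub>Q\<^esub> q = z" using z(1) x(2) by (auto simp: squares_central_def)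
    ultimately show "f (x \<otimes>\<^bsub>P\<^esub> x) = \<one> \<or> f (x \<otimes>\<^bsub>P\<^esub> x) = f (z, 0)"
      using f1 f2 f.hom_one by (auto simp: x Pm Pc(2))
  qed
  then show thesis using that by blast
qed


section \<open>Recognizing central products with a cyclic group of order 4\<close>

context group
begin

lemma p_group_subgroup:
  assumes "p_group p G" "subgroup H G" shows "p_group p (G\<lparr>carrier := H\<rparr>)"
  using assms subgroup_imp_group ord_subgroup[OF assms(2)] subgroup.mem_carrier[OF assms(2)]
  by (auto simp: p_group_def)

text \<open>In \<open>extraspecial_central_product_C4\<close> the extraspecial factor has a plain
  \<open>monoid\<close> type, whereas \<open>G\<close> may carry further record fields. Hence the
  subgroup becomes a new record instead of a carrier update.\<close>

lemma group_reduct_subgroup: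
  assumes "subgroup B G" shows "group \<lparr>carrier = B, monoid.mult = (\<otimes>), one = \<one>\<rparr>"
proof (rule groupI)
  show "\<exists>y\<in>carrier \<lparr>carrier = B, monoid.mult = (\<otimes>), one = \<one>\<rparr>.
      y \<otimes>\<^bsub>\<lparr>carrier = B, monoid.mult = (\<otimes>), one = \<one>\<rparr>\<^esub> x = \<one>\<^bsub>\<lparr>carrier = B, monoid.mult = (\<otimes>), one = \<one>\<rparr>\<^esub>"
    if "x \<in> carrier \<lparr>carrier = B, monoid.mult = (\<otimes>), one = \<one>\<rparr>" for x
    using that subgroup.m_inv_closed[OF assms] subgroup.mem_carrier[OF assms] by (intro bexI[of _ "inv x"]) simp_all
qed (use assms in \<open>auto simp: subgroup.m_closed subgroup.one_closed subgroup.mem_carrier m_assoc\<close>)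

lemma p_group_reduct_subgroup:
  assumes "p_group p G" "subgroup B G"
  shows "p_group p \<lparr>carrier = B, monoid.mult = (\<otimes>), one = \<one>\<rparr>" (is "p_group p ?B")
proof -
  interpret B: group ?B by (rule group_reduct_subgroup[OF assms(2)])
  have "x [^]\<^bsub>?B\<^esub> (n::nat) = x [^] n" for x n
    by (induction n) simp_all
  then have "B.ord x = ord x" for x unfolding B.ord_def ord_def by simp
  then show ?thesis using assms subgroup.mem_carrier[OF assms(2)] B.is_group by (auto simp: p_group_def)
qed

text \<open>The extraspecial factor is a relative complement \<open>B\<close> of the centre over {1,
  z}. Since \<open>B\<close> and the centre together make up \<open>G\<close>, what is central in
  \<open>B\<close> is central in \<open>G\<close>, hence in {1, z}. Multiplication then maps the
  product of \<open>B\<close> with the powers of c onto \<open>G\<close>.\<close>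

lemma extraspecial_central_product_C4I:
  assumes p: "p_group 2 G" and sc: "squares_central G z" and z1: "z \<noteq> \<one>"
    and c: "c \<in> group_centre G" "c \<otimes> c = z" and Z: "group_centre G = {\<one>, z, c, z \<otimes> c}"
    and ab: "a \<in> carrier G" "b \<in> carrier G" "a \<otimes> b \<noteq> b \<otimes> a"
  shows "extraspecial_central_product_C4 G"
proof -
  have zc: "z \<in> group_centre G" using sc by (simp add: squares_central_def)
  note zG = group_centreD(1)[OF zc] and cG = group_centreD(1)[OF c(1)]
  note zz = squares_central_involution[OF sc]
  have "subgroup {\<one>, z} G"
    by (rule subgroupI) (use zG zz inv_equality[OF zz zG zG] in auto)
  then obtain B where B: "subgroup B G" "{\<one>, z} \<subseteq> B" "B \<inter> group_centre G \<subseteq> {\<one>, z}"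
    "B <#> group_centre G = carrier G"
    using exists_relative_complement[of "{\<one>, z}" "group_centre G"] sc group_centre_subgroup
    by (auto simp: squares_central_def subgroup.one_closed subgroup.subset)
  note BG = subgroup.mem_carrier[OF B(1)]
  define Q where "Q = \<lparr>carrier = B, monoid.mult = (\<otimes>), one = \<one>\<rparr>"
  interpret Q: group Q unfolding Q_def by (rule group_reduct_subgroup[OF B(1)])
  have Q: "carrier Q = B" "monoid.mult Q = (\<otimes>)" "one Q = \<one>" by (simp_all add: Q_def)
  have split: "\<exists>q\<in>B. \<exists>e\<in>group_centre G. g = q \<otimes> e" if "g \<in> carrier G" for g
    using that B(4) unfolding set_mult_def by blast
  have central: "q \<in> group_centre G" if q: "q \<in> B" "\<And>r. r \<in> B \<Longrightarrow> q \<otimes> r = r \<otimes> q" for q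
    unfolding group_centre_def
  proof (intro CollectI conjI ballI)
    fix g assume "g \<in> carrier G"
    then obtain r e where g: "r \<in> B" "e \<in> group_centre G" "g = r \<otimes> e" using split by blast
    have "q \<otimes> g = r \<otimes> (q \<otimes> e)"
      using g q(1) BG group_centreD(1)[OF g(2)] q(2)[OF g(1)] by (simp add: m_assoc[symmetric])
    also have "\<dots> = g \<otimes> q"
      using g q(1) BG group_centreD(1)[OF g(2)] group_centreD(2)[OF g(2) BG[OF q(1)]] by (simp add: m_assoc)
    finally show "q \<otimes> g = g \<otimes> q" .
  qed (use q BG in blast)
  have ZQ: "group_centre Q = {\<one>, z}"
  proof
    show "group_centre Q \<subseteq> {\<one>, z}"
    proof
      fix q assume "q \<in> group_centre Q"
      then have "q \<in> B" "\<And>r. r \<in> B \<Longrightarrow> q \<otimes> r = r \<otimes> q" unfolding group_centre_def Q by blast+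
      then show "q \<in> {\<one>, z}" using central B(3) by blast
    qed
    have "z \<in> group_centre Q" unfolding group_centre_def Q using B(2) BG group_centreD(2)[OF zc] by blast
    then show "{\<one>, z} \<subseteq> group_centre Q"
      using subgroup.one_closed[OF Q.group_centre_subgroup] by (simp add: Q)
  qed
  have scQ: "squares_central Q z"
    using sc BG ZQ by (simp add: squares_central_def Q)
  have "\<exists>q\<in>B. \<exists>r\<in>B. q \<otimes> r \<noteq> r \<otimes> q"
  proof (rule ccontr)
    assume "\<not> ?thesis"
    then have "B \<subseteq> group_centre G" using central by blast
    then have "B <#> group_centre G \<subseteq> group_centre G"
      using subgroup.m_closed[OF group_centre_subgroup] by (auto simp: set_mult_def)
    then have "carrier G \<subseteq> group_centre G" using B(4) by simp
    then show False using ab group_centreD(2) by blast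
  qed
  then obtain q r where qr: "q \<in> B" "r \<in> B" "q \<otimes> r \<noteq> r \<otimes> q" by blast
  have es: "extraspecial 2 Q"
    by (rule Q.extraspecialI[of z q r])
      (use p_group_reduct_subgroup[OF p B(1), folded Q_def] scQ ZQ z1 qr in \<open>simp_all add: Q\<close>)
  define Z4 where "Z4 = integer_mod_group 4"
  have Z4: "carrier Z4 = {0..<4}" "monoid.mult Z4 = (\<lambda>x y. (x + y) mod 4)" "one Z4 = 0" "group Z4"
    by (simp_all add: Z4_def carrier_integer_mod_group)
  define P where "P = Q \<times>\<times> Z4"
  interpret P: group P unfolding P_def by (rule DirProd_group[OF Q.is_group Z4(4)])
  \<comment> \<open>The integer i stands for c^i; reduction mod 4 is compatible because c has order
    4. Since c^2 = z and z^2 = 1, the pair (z, 2) is mapped to 1.\<close>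
  define f where "f = (\<lambda>(x, i::int). x \<otimes> c [^] i)"
  have c2: "c [^] (2::int) = z" using c(2) cG int_pow_mult[OF cG, of 1 1] by simp
  have c3: "c [^] (3::int) = z \<otimes> c" using c2 cG int_pow_mult[OF cG, of 2 1] by simp
  have c4: "c [^] (4::int) = \<one>" using c2 zz cG int_pow_mult[OF cG, of 2 2] by simp
  have cmod: "c [^] (i mod 4) = c [^] i" for i :: int
  proof -
    have "c [^] i = c [^] (4 * (i div 4) + i mod 4)" by simp
    also have "\<dots> = (c [^] (4::int)) [^] (i div 4) \<otimes> c [^] (i mod 4)"
      using int_pow_mult[OF cG] int_pow_pow[OF cG] by metis
    finally show ?thesis using c4 cG by simp
  qed
  have cpow: "c [^] i \<in> group_centre G" for i :: int
    using subgroup_int_pow_closed[OF group_centre_subgroup c(1)] .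
  interpret f: group_hom P G f
  proof unfold_locales
    show "f \<in> hom P G"
    proof (rule homI)
      fix u assume "u \<in> carrier P"
      then show "f u \<in> carrier G" using BG cG by (auto simp: f_def P_def Q)
    next
      fix u v assume "u \<in> carrier P" "v \<in> carrier P"
      then obtain x i y j where u: "u = (x, i)" "v = (y, j)" "x \<in> B" "y \<in> B" by (auto simp: P_def Q)
      have "f (u \<otimes>\<^bsub>P\<^esub> v) = x \<otimes> y \<otimes> (c [^] i \<otimes> c [^] j)"
        by (simp add: f_def P_def Q Z4 u cmod int_pow_mult[OF cG])
      also have "\<dots> = x \<otimes> (y \<otimes> c [^] i) \<otimes> c [^] j" using u BG cG by (simp add: m_assoc)
      also have "\<dots> = x \<otimes> (c [^] i \<otimes> y) \<otimes> c [^] j" using group_centreD(2)[OF cpow BG[OF u(4)]] by simp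
      finally show "f (u \<otimes>\<^bsub>P\<^esub> v) = f u \<otimes> f v" using u BG cG by (simp add: f_def m_assoc)
    qed
  qed
  have surj: "f ` carrier P = carrier G"
  proof
    show "carrier G \<subseteq> f ` carrier P"
    proof
      fix g assume "g \<in> carrier G"
      then obtain x e where g: "x \<in> B" "e \<in> group_centre G" "g = x \<otimes> e" using split by blast
      have "\<exists>i::int. i \<in> {0..<4} \<and> e = c [^] i"
      proof -
        consider "e = c [^] (0::int)" | "e = c [^] (1::int)" | "e = c [^] (2::int)" | "e = c [^] (3::int)"
          using g(2) c2 c3 cG unfolding Z by auto
        then show ?thesis by cases (rule exI, rule conjI[rotated], assumption, simp)+
      qed
      then obtain i :: int where i: "i \<in> {0..<4}" "e = c [^] i" by blast
      then have "(x, i) \<in> carrier P" "g = f (x, i)" using g by (simp_all add: P_def Q Z4 f_def)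
      then show "g \<in> f ` carrier P" by blast
    qed
  qed auto
  have "kernel P G f = insert (\<one>\<^bsub>Q\<^esub>, 0) ((\<lambda>z. (z, 2)) ` (group_centre Q - {\<one>\<^bsub>Q\<^esub>}))"
  proof -
    \<comment> \<open>For odd i the power c^i is c or z c. Neither lies in \<open>B\<close>, so
      neither is the inverse of an element of \<open>B\<close>.\<close>
    have "x \<otimes> c [^] i = \<one> \<longleftrightarrow> x = \<one> \<and> i = 0 \<or> x = z \<and> i = 2" if x: "x \<in> B" and i: "i \<in> {0..<4}" for x and i :: int
    proof -
      have c': "c \<noteq> \<one>" "c \<noteq> z" using c(2) z1 zz by auto
      have zc': "z \<otimes> c \<noteq> \<one>" "z \<otimes> c \<noteq> z"
        using c' zG cG zz by (metis l_cancel, metis r_one l_cancel one_closed)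
      have cB: "c \<notin> B" "z \<otimes> c \<notin> B" using B(3) c' zc' Z by auto
      have czc: "c \<otimes> (z \<otimes> c) = \<one>"
        using zG cG c(2) zz group_centreD(2)[OF c(1) zG] by (metis m_assoc)
      have e1: "x \<otimes> c \<noteq> \<one>"
      proof
        assume "x \<otimes> c = \<one>"
        then have "x \<otimes> c \<otimes> (z \<otimes> c) = z \<otimes> c" using zG cG by simp
        then have "x = z \<otimes> c" using czc zG cG BG[OF x] by (simp add: m_assoc)
        then show False using cB x by simp
      qed
      have e3: "x \<otimes> (z \<otimes> c) \<noteq> \<one>"
      proof
        assume "x \<otimes> (z \<otimes> c) = \<one>"
        then have "x \<otimes> (z \<otimes> c) \<otimes> c = c" using cG by simp
        then have "x = c" using czc zG cG BG[OF x] c(2) zz by (simp add: m_assoc)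
        then show False using cB x by simp
      qed
      have e2: "x \<otimes> z = \<one> \<longleftrightarrow> x = z" using zG zz BG[OF x] by (metis r_cancel)
      consider "i = 0" | "i = 1" | "i = 2" | "i = 3" using i by force
      then show ?thesis
        by cases (use e1 e2 e3 c2 c3 BG[OF x] cG in simp_all)
    qed
    then have "kernel P G f = {(\<one>, 0), (z, 2)}"
      using B(2) by (auto simp: kernel_def f_def P_def Q Z4)
    then show ?thesis using ZQ z1 by (auto simp: Q)
  qed
  then have "central_product_C4 Q \<cong> G"
    using f.FactGroup_iso[OF surj] by (simp add: central_product_C4_def P_def Z4_def)
  moreover have "group (central_product_C4 Q)"
    using normal.factorgroup_is_group[OF f.normal_kernel]
      \<open>kernel P G f = insert (\<one>\<^bsub>Q\<^esub>, 0) ((\<lambda>z. (z, 2)) ` (group_centre Q - {\<one>\<^bsub>Q\<^esub>}))\<close>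
    by (simp add: central_product_C4_def P_def Z4_def)
  ultimately have "G \<cong> central_product_C4 Q" by (rule group.iso_sym[rotated])
  then show ?thesis unfolding extraspecial_central_product_C4_def using es by blast
qed

lemma direct_product_centralI:
  assumes E: "subgroup E G" "E \<subseteq> group_centre G" and H: "H \<lhd> G" and "H \<inter> E \<subseteq> {\<one>}" "H <#> E = carrier G"
  shows "direct_product_of_subgroups G E H"
proof -
  have Hs: "subgroup H G" using H normal_imp_subgroup by blast
  note EG = subgroup.mem_carrier[OF E(1)] and HG = subgroup.mem_carrier[OF Hs]
  have comm: "e \<otimes> x = x \<otimes> e" if "e \<in> E" "x \<in> carrier G" for e x
    using that E(2) group_centreD(2) by blast
  have "E \<lhd> G"
    unfolding normal_inv_iff
  proof (intro conjI ballI E)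
    fix x e assume x: "x \<in> carrier G" and e: "e \<in> E"
    have "x \<otimes> e \<otimes> inv x = e" using x EG[OF e] by (simp add: comm[OF e x, symmetric] m_assoc)
    then show "x \<otimes> e \<otimes> inv x \<in> E" using e by simp
  qed
  moreover have "E <#> H = H <#> E"
  proof -
    have "e \<otimes> h \<in> H <#> E" "h \<otimes> e \<in> E <#> H" if "e \<in> E" "h \<in> H" for e h
    proof -
      have "e \<otimes> h \<in> E <#> H" "h \<otimes> e \<in> H <#> E" using that by (auto simp: set_mult_def)
      then show "e \<otimes> h \<in> H <#> E" "h \<otimes> e \<in> E <#> H"
        using comm[OF that(1) HG[OF that(2)]] by simp_all
    qed
    note swap = this
    show ?thesis
    proof (intro equalityI subsetI)
      fix g assume "g \<in> E <#> H"
      then obtain e h where "e \<in> E" "h \<in> H" "g = e \<otimes> h" by (auto simp: set_mult_def)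
      then show "g \<in> H <#> E" using swap by simp
    next
      fix g assume "g \<in> H <#> E"
      then obtain e h where "e \<in> E" "h \<in> H" "g = h \<otimes> e" by (auto simp: set_mult_def)
      then show "g \<in> E <#> H" using swap by simp
    qed
  qed
  ultimately show ?thesis
    using assms subgroup.one_closed[OF E(1)] subgroup.one_closed[OF Hs]
    by (auto simp: direct_product_of_subgroups_def)
qed


section \<open>Groups with noncommuting elements of order greater than 2\<close>

text \<open>Each of u and v inverts the other, that is, v u v = u and u v u = v. Then v (u v u) = (v
  u v) u reads v^2 = u^2. This element commutes with v and is also inverted by it, so it is its own
  inverse.\<close>

lemma noncommuting_noninvolutions:
  assumes fi: "fixed_or_inverted G" and u: "u \<in> carrier G" "u \<otimes> u \<noteq> \<one>"
    and v: "v \<in> carrier G" "v \<otimes> v \<noteq> \<one>" and uv: "u \<otimes> v \<noteq> v \<otimes> u"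
  shows "u \<otimes> u = v \<otimes> v" "(u \<otimes> u) \<otimes> (u \<otimes> u) = \<one>"
proof -
  have 1: "u \<otimes> v = v \<otimes> inv u" using fi u v uv unfolding fixed_or_inverted_def by blast
  have 2: "v \<otimes> u = u \<otimes> inv v" using fi u v uv[symmetric] unfolding fixed_or_inverted_def by blast
  have vuv: "v \<otimes> u \<otimes> v = u" unfolding 2 using u v by (simp add: m_assoc)
  have uvu: "u \<otimes> v \<otimes> u = v" unfolding 1 using u v by (simp add: m_assoc)
  have "v \<otimes> v = v \<otimes> (u \<otimes> v \<otimes> u)" unfolding uvu ..
  also have "\<dots> = (v \<otimes> u \<otimes> v) \<otimes> u" using u v by (simp add: m_assoc)
  finally show e: "u \<otimes> u = v \<otimes> v" unfolding vuv ..
  have "u \<otimes> u \<otimes> v = u \<otimes> (u \<otimes> v)" using u v by (simp add: m_assoc)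
  also have "\<dots> = (u \<otimes> v) \<otimes> inv u" unfolding 1 using u v by (simp add: m_assoc 1[symmetric])
  also have "\<dots> = v \<otimes> inv (u \<otimes> u)" unfolding 1 using u v by (simp add: word_simps)
  finally have "v \<otimes> (u \<otimes> u) = v \<otimes> inv (u \<otimes> u)" unfolding e using v by (simp add: m_assoc)
  then have "u \<otimes> u = inv (u \<otimes> u)" using u v by (metis l_cancel m_closed inv_closed)
  then show "(u \<otimes> u) \<otimes> (u \<otimes> u) = \<one>" using u by (metis r_inv m_closed)
qed

text \<open>Two such elements generate a quaternion group of order \<open>8\<close>.\<close>

lemma noncommuting_imp_squares_central:
  assumes fi: "fixed_or_inverted G" and a: "a \<in> carrier G" "a \<otimes> a \<noteq> \<one>"
    and b: "b \<in> carrier G" "b \<otimes> b \<noteq> \<one>" and ab: "a \<otimes> b \<noteq> b \<otimes> a"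
  shows "squares_central G (a \<otimes> a)"
proof -
  define z where "z = a \<otimes> a"
  have z: "z \<in> carrier G" "z \<otimes> z = \<one>" "b \<otimes> b = z"
    unfolding z_def using noncommuting_noninvolutions[OF fi a b ab] a(1) b(1) by simp_all
  have iz: "inv z = z" using z by (simp add: inv_equality)
  have fi': "g \<otimes> x = x \<otimes> g \<or> g \<otimes> x = x \<otimes> inv g"
    if "g \<in> carrier G" "g \<otimes> g \<noteq> \<one>" "x \<in> carrier G" for g x
    using fi that unfolding fixed_or_inverted_def by blast
  \<comment> \<open>Otherwise g commutes with a and b by \<open>noncommuting_noninvolutions\<close>,
    and (a g)^2 = z g^2 is not 1, so b fixes or inverts a g. But b inverts the factor a and fixes g,
    which gives a^2 = 1 or g^2 = 1.\<close>
  have sq: "g \<otimes> g = z" if g: "g \<in> carrier G" "g \<otimes> g \<noteq> \<one>" for g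
  proof (rule ccontr)
    assume gz: "g \<otimes> g \<noteq> z"
    have ga: "a \<otimes> g = g \<otimes> a" using noncommuting_noninvolutions(1)[OF fi a g] gz by (auto simp: z_def)
    have gb: "b \<otimes> g = g \<otimes> b" using noncommuting_noninvolutions(1)[OF fi b g] gz z by auto
    have "(a \<otimes> g) \<otimes> (a \<otimes> g) = a \<otimes> (g \<otimes> a) \<otimes> g" using a g by (simp add: m_assoc)
    also have "\<dots> = z \<otimes> (g \<otimes> g)" unfolding ga[symmetric] z_def using a g by (simp add: m_assoc)
    finally have agag: "(a \<otimes> g) \<otimes> (a \<otimes> g) = z \<otimes> (g \<otimes> g)" .
    have "z \<otimes> (g \<otimes> g) \<noteq> \<one>"
      using gz iz z g by (metis inv_equality inv_inv m_closed)
    then consider "(a \<otimes> g) \<otimes> b = b \<otimes> (a \<otimes> g)" | "(a \<otimes> g) \<otimes> b = b \<otimes> inv (a \<otimes> g)"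
      using fi'[of "a \<otimes> g" b] a b g agag by auto
    moreover have "(a \<otimes> g) \<otimes> b = b \<otimes> (inv a \<otimes> g)"
    proof -
      have "(a \<otimes> g) \<otimes> b = (a \<otimes> b) \<otimes> g" using a b g gb by (simp add: m_assoc)
      also have "a \<otimes> b = b \<otimes> inv a" using fi'[OF a b(1)] ab by blast
      finally show ?thesis using a b g by (simp add: m_assoc)
    qed
    ultimately consider "inv a \<otimes> g = a \<otimes> g" | "inv a \<otimes> g = inv (g \<otimes> a)"
      using a b g ga by (metis l_cancel m_closed inv_closed)
    then show False
    proof cases
      case 1
      then have "inv a = a" using a g by (metis r_cancel inv_closed)
      then show False using a by (metis r_inv)
    next
      case 2
      then have "inv a \<otimes> g = inv a \<otimes> inv g" using a g by (simp add: inv_mult_group)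
      then have "g = inv g" using a g by (metis l_cancel inv_closed)
      then show False using g by (metis r_inv)
    qed
  qed
  \<comment> \<open>Conjugation by x maps a to a or a^-1, hence z = a^2 to z or z^-1, which are
    equal.\<close>
  have zcomm: "z \<otimes> x = x \<otimes> z" if x: "x \<in> carrier G" for x
  proof -
    have zx: "z \<otimes> x = a \<otimes> (a \<otimes> x)" using a x by (simp add: z_def m_assoc)
    consider "a \<otimes> x = x \<otimes> a" | "a \<otimes> x = x \<otimes> inv a" using fi'[OF a x] by blast
    then show ?thesis
    proof cases
      case 1
      have "a \<otimes> (a \<otimes> x) = (a \<otimes> x) \<otimes> a" using a x by (simp add: m_assoc 1[symmetric])
      also have "\<dots> = x \<otimes> z" unfolding 1 using a x by (simp add: m_assoc z_def)
      finally show ?thesis unfolding zx .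
    next
      case 2
      have "a \<otimes> (a \<otimes> x) = (a \<otimes> x) \<otimes> inv a" using a x by (simp add: m_assoc 2[symmetric])
      also have "\<dots> = x \<otimes> inv z" unfolding 2 using a x by (simp add: z_def m_assoc inv_mult_group)
      finally show ?thesis unfolding zx iz .
    qed
  qed
  show ?thesis unfolding squares_central_def group_centre_def z_def[symmetric]
    using z(1) zcomm sq by blast
qed

lemma elementary_abelian_subgroupI:
  assumes "subgroup E G" "\<And>x y. x \<in> E \<Longrightarrow> y \<in> E \<Longrightarrow> x \<otimes> y = y \<otimes> x" "\<And>x. x \<in> E \<Longrightarrow> x \<otimes> x = \<one>"
  shows "elementary_abelian_2_group (G\<lparr>carrier := E\<rparr>)"
  unfolding elementary_abelian_2_group_def
  using group.group_comm_groupI[OF subgroup_imp_group[OF assms(1)]] assms(2,3) by simp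

text \<open>\<open>H\<close> is a relative complement of \<open>E\<close> over \<open>P\<close>. As
  \<open>E\<close> is central and \<open>H <#> E\<close> is everything, the centre of
  \<open>H\<close> is central in \<open>G\<close>, so it lies in \<open>P <#> E\<close>, of which
  \<open>H\<close> contains only \<open>P\<close>. The choices for \<open>P\<close> will be {1, z}
  and a cyclic group of order 4.\<close>

lemma split_off_central_factor:
  assumes sc: "squares_central G z" and P: "subgroup P G" "P \<subseteq> group_centre G" "z \<in> P"
    and E: "subgroup E G" "E \<subseteq> group_centre G" "P \<inter> E \<subseteq> {\<one>}"
    and Z: "group_centre G \<subseteq> P <#> E"
    and ab: "a \<in> carrier G" "b \<in> carrier G" "a \<otimes> b \<noteq> b \<otimes> a"
  obtains H c d where "subgroup H G" "direct_product_of_subgroups G E H"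
    "squares_central (G\<lparr>carrier := H\<rparr>) z" "group_centre (G\<lparr>carrier := H\<rparr>) = P"
    "c \<in> H" "d \<in> H" "c \<otimes> d \<noteq> d \<otimes> c"
proof -
  have sqP: "x \<otimes> x \<in> P" if "x \<in> carrier G" for x
    using sc that P subgroup.one_closed[OF P(1)] by (auto simp: squares_central_def)
  obtain H where H: "subgroup H G" "P \<subseteq> H" "H \<inter> E \<subseteq> P" "H <#> E = carrier G"
    using exists_relative_complement[OF P(1) sqP subgroup.subset[OF E(1)] subgroup.one_closed[OF E(1)]] by blast
  note HG = subgroup.mem_carrier[OF H(1)] and EG = subgroup.mem_carrier[OF E(1)]
  have Ecomm: "e \<otimes> x = x \<otimes> e" if "e \<in> E" "x \<in> carrier G" for e x
    using that E(2) group_centreD(2) by blast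
  have "H \<lhd> G" by (rule normal_if_squares[OF H(1)]) (use sqP H(2) in blast)
  then have dp: "direct_product_of_subgroups G E H"
    using direct_product_centralI[OF E(1,2)] H E(3) by blast
  have split: "\<exists>h\<in>H. \<exists>e\<in>E. g = h \<otimes> e" if "g \<in> carrier G" for g
    using that H(4) unfolding set_mult_def by blast
  have central: "q \<in> group_centre G" if q: "q \<in> H" "\<And>r. r \<in> H \<Longrightarrow> q \<otimes> r = r \<otimes> q" for q
    unfolding group_centre_def
  proof (intro CollectI conjI ballI)
    fix g assume "g \<in> carrier G"
    then obtain r e where g: "r \<in> H" "e \<in> E" "g = r \<otimes> e" using split by blast
    have "q \<otimes> g = r \<otimes> (q \<otimes> e)"
      using g q(1) HG EG q(2)[OF g(1)] by (simp add: m_assoc[symmetric])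
    also have "\<dots> = g \<otimes> q"
      using g q(1) HG EG Ecomm[OF g(2) HG[OF q(1)]] by (simp add: m_assoc)
    finally show "q \<otimes> g = g \<otimes> q" .
  qed (use q HG in blast)
  have ZH: "group_centre (G\<lparr>carrier := H\<rparr>) = P"
  proof
    show "P \<subseteq> group_centre (G\<lparr>carrier := H\<rparr>)"
    proof
      fix x assume "x \<in> P"
      then show "x \<in> group_centre (G\<lparr>carrier := H\<rparr>)"
        using H(2) P(2) HG group_centreD(2)[of x] unfolding group_centre_def[of "G\<lparr>carrier := H\<rparr>"]
        by (simp add: subsetD)
    qed
    show "group_centre (G\<lparr>carrier := H\<rparr>) \<subseteq> P"
    proof
      fix x assume "x \<in> group_centre (G\<lparr>carrier := H\<rparr>)"
      then have x: "x \<in> H" "\<And>r. r \<in> H \<Longrightarrow> x \<otimes> r = r \<otimes> x" by (simp_all add: group_centre_def)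
      then have "x \<in> P <#> E" using central Z by blast
      then obtain y e where y: "y \<in> P" "e \<in> E" "x = y \<otimes> e" by (auto simp: set_mult_def)
      have "e = inv y \<otimes> x" using y EG subsetD[OF H(2)] HG by (simp add: inv_cancel_left)
      then have "e \<in> H" using y(1) x(1) H(1,2) subgroup.m_closed subgroup.m_inv_closed by (metis subsetD)
      then have "e = \<one>" using y(2) H(3) E(3) by blast
      then show "x \<in> P" using y subsetD[OF H(2) y(1)] HG by simp
    qed
  qed
  have "squares_central (G\<lparr>carrier := H\<rparr>) z"
    using sc ZH P(3) HG by (simp add: squares_central_def)
  moreover have "\<exists>q\<in>H. \<exists>r\<in>H. q \<otimes> r \<noteq> r \<otimes> q"
  proof (rule ccontr)
    assume "\<not> ?thesis"
    then have "H \<subseteq> group_centre G" using central by blast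
    then have "H <#> E \<subseteq> group_centre G"
      using subgroup.m_closed[OF group_centre_subgroup] E(2) by (force simp: set_mult_def)
    then have "a \<in> group_centre G" using H(4) ab(1) by blast
    then show False using ab group_centreD(2) by blast
  qed
  ultimately show thesis using that H(1) dp ZH by blast
qed

text \<open>The exponent of the centre decides between the two cases. If the centre contains c with
  c^2 = z, then every central x with x^2 = z differs from c by an element of order at most 2, so the
  centre is the product of \<open>E\<close> and the group generated by c.\<close>

lemma squares_central_imp_structure:
  assumes p: "p_group 2 G" and sc: "squares_central G z" and z1: "z \<noteq> \<one>"
    and ab: "a \<in> carrier G" "b \<in> carrier G" "a \<otimes> b \<noteq> b \<otimes> a"
  shows "\<exists>E H. direct_product_of_subgroups G E H \<and> elementary_abelian_2_group (G\<lparr>carrier := E\<rparr>) \<and>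
    (extraspecial 2 (G\<lparr>carrier := H\<rparr>) \<or> extraspecial_central_product_C4 (G\<lparr>carrier := H\<rparr>))"
proof -
  have zc: "z \<in> group_centre G" using sc by (simp add: squares_central_def)
  note zG = group_centreD(1)[OF zc] and zz = squares_central_involution[OF sc]
  note Zs = group_centre_subgroup
  have zs: "subgroup {\<one>, z} G"
    by (rule subgroupI) (use zG zz inv_equality[OF zz zG zG] in auto)
  define V where "V = {x \<in> group_centre G. x \<otimes> x = \<one>}"
  have VG: "x \<in> carrier G" if "x \<in> V" for x using that group_centreD(1) by (auto simp: V_def)
  have Vcomm: "x \<otimes> y = y \<otimes> x" if "x \<in> V" "y \<in> carrier G" for x y
    using that group_centreD(2) unfolding V_def by blast
  have Vs: "subgroup V G"
  proof (rule subgroupI)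
    show "V \<subseteq> carrier G" using VG by blast
    show "V \<noteq> {}" using subgroup.one_closed[OF Zs] by (auto simp: V_def)
    show "inv x \<in> V" if "x \<in> V" for x
      using that VG[OF that] inv_equality[of x x] by (auto simp: V_def)
    show "x \<otimes> y \<in> V" if x: "x \<in> V" and y: "y \<in> V" for x y
    proof -
      have "(x \<otimes> y) \<otimes> (x \<otimes> y) = x \<otimes> (y \<otimes> x) \<otimes> y" using VG x y by (simp add: m_assoc)
      also have "\<dots> = (x \<otimes> x) \<otimes> (y \<otimes> y)" unfolding Vcomm[OF y VG[OF x]] using VG x y by (simp add: m_assoc)
      finally show ?thesis using x y subgroup.m_closed[OF Zs] by (simp add: V_def)
    qed
  qed
  have sqV: "x \<otimes> x \<in> {\<one>}" if "x \<in> V" for x using that by (simp add: V_def)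
  have 1: "{\<one>} \<subseteq> V" "{\<one>, z} \<subseteq> V" using zc zz subgroup.one_closed[OF Vs] by (simp_all add: V_def)
  obtain E where Es: "subgroup E G" and EV: "E \<subseteq> V" and E: "E \<inter> {\<one>, z} \<subseteq> {\<one>}" "E <#> {\<one>, z} = V"
    by (rule exists_relative_complement_in_subgroup[OF Vs triv_subgroup 1(1) sqV 1(2) insertI1])
  have EZ: "E \<subseteq> group_centre G" using EV by (auto simp: V_def)
  note EG = subgroup.mem_carrier[OF Es]
  have VE: "V \<subseteq> {\<one>, z} <#> E"
  proof
    fix x assume "x \<in> V"
    then obtain e y where e: "e \<in> E" "y \<in> {\<one>, z}" "x = e \<otimes> y" using E(2) by (auto simp: set_mult_def)
    moreover have "e \<otimes> y = y \<otimes> e" using Vcomm e EV zG by blast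
    ultimately show "x \<in> {\<one>, z} <#> E" unfolding set_mult_def by blast
  qed
  have el: "elementary_abelian_2_group (G\<lparr>carrier := E\<rparr>)"
  proof (rule elementary_abelian_subgroupI[OF Es])
    show "x \<otimes> y = y \<otimes> x" if "x \<in> E" "y \<in> E" for x y using that Vcomm EV EG by blast
    show "x \<otimes> x = \<one>" if "x \<in> E" for x using that EV by (auto simp: V_def)
  qed
  show ?thesis
  proof (cases "group_centre G \<subseteq> V")
    case True
    have "{\<one>, z} \<subseteq> group_centre G" "z \<in> {\<one>, z}" "{\<one>, z} \<inter> E \<subseteq> {\<one>}"
      "group_centre G \<subseteq> {\<one>, z} <#> E"
      using zc subgroup.one_closed[OF Zs] E(1) True VE by auto
    note split_off = split_off_central_factor[OF sc zs this(1,2) Es EZ this(3,4) ab]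
    obtain H c d where H: "subgroup H G" "direct_product_of_subgroups G E H"
      "squares_central (G\<lparr>carrier := H\<rparr>) z" "group_centre (G\<lparr>carrier := H\<rparr>) = {\<one>, z}"
      "c \<in> H" "d \<in> H" "c \<otimes> d \<noteq> d \<otimes> c"
      using split_off by blast
    interpret H: group "G\<lparr>carrier := H\<rparr>" using subgroup_imp_group[OF H(1)] .
    have "extraspecial 2 (G\<lparr>carrier := H\<rparr>)"
      by (rule H.extraspecialI[of z c d]) (use p_group_subgroup[OF p H(1)] H z1 in simp_all)
    then show ?thesis using H(2) el by blast
  next
    case False
    then obtain c where c: "c \<in> group_centre G" "c \<otimes> c = z"
      using sc group_centreD(1) unfolding V_def squares_central_def by blast
    note cG = group_centreD(1)[OF c(1)] and ccomm = group_centreD(2)[OF c(1)]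
    define P where "P = {\<one>, z, c, z \<otimes> c}"
    have "c \<otimes> m \<otimes> inv c \<in> {\<one>, z}" if "m \<in> {\<one>, z}" for m
      using that cG zG ccomm[OF zG] by (auto simp: m_assoc)
    then have "subgroup ({\<one>, z} \<union> (\<lambda>m. m \<otimes> c) ` {\<one>, z}) G"
      using subgroup_Un_rcoset[OF zs cG] c(2) by blast
    moreover have "{\<one>, z} \<union> (\<lambda>m. m \<otimes> c) ` {\<one>, z} = P" using cG by (auto simp: P_def)
    ultimately have Ps: "subgroup P G" by simp
    have PZ: "P \<subseteq> group_centre G"
      using c(1) zc subgroup.one_closed[OF Zs] subgroup.m_closed[OF Zs zc c(1)] by (simp add: P_def)
    have zczc: "(z \<otimes> c) \<otimes> (z \<otimes> c) = z"
    proof -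
      have "(z \<otimes> c) \<otimes> (z \<otimes> c) = z \<otimes> (c \<otimes> z) \<otimes> c" using zG cG by (simp add: m_assoc)
      also have "\<dots> = (z \<otimes> z) \<otimes> (c \<otimes> c)" unfolding ccomm[OF zG] using zG cG by (simp add: m_assoc)
      finally show ?thesis using c(2) zz zG by simp
    qed
    \<comment> \<open>c and z c have square z, which is not 1, so they are not in \<open>V\<close>
      and hence not in \<open>E\<close>.\<close>
    have PE: "P \<inter> E \<subseteq> {\<one>}"
      using E(1) EV c(2) zczc z1 by (auto simp: P_def V_def)
    have "group_centre G \<subseteq> P <#> E"
    proof
      fix x assume x: "x \<in> group_centre G"
      note xG = group_centreD(1)[OF x]
      show "x \<in> P <#> E"
      proof (cases "x \<otimes> x = \<one>")
        case True
        then have "x \<in> {\<one>, z} <#> E" using x VE by (auto simp: V_def)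
        then show ?thesis by (auto simp: set_mult_def P_def)
      next
        case False
        then have xx: "x \<otimes> x = z" using sc xG by (auto simp: squares_central_def)
        have "(c \<otimes> x) \<otimes> (c \<otimes> x) = c \<otimes> (x \<otimes> c) \<otimes> x" using xG cG by (simp add: m_assoc)
        also have "\<dots> = (c \<otimes> c) \<otimes> (x \<otimes> x)" unfolding ccomm[OF xG, symmetric] using xG cG by (simp add: m_assoc)
        finally have "c \<otimes> x \<in> V" using c xx zz subgroup.m_closed[OF Zs c(1) x] by (simp add: V_def)
        then have "c \<otimes> x \<in> {\<one>, z} <#> E" using VE by blast
        then obtain y e where y: "y \<in> {\<one>, z}" "e \<in> E" "c \<otimes> x = y \<otimes> e"
          unfolding set_mult_def by blast
        have yG: "y \<in> carrier G" and yP: "y \<in> P" using y(1) zG by (auto simp: P_def)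
        have "x = inv c \<otimes> y \<otimes> e" using y yG xG cG EG by (metis inv_cancel_left(1) m_assoc inv_closed)
        moreover have "inv c \<otimes> y \<in> P"
          using subgroup.m_closed[OF Ps subgroup.m_inv_closed[OF Ps] yP] by (simp add: P_def)
        ultimately show ?thesis using y(2) unfolding set_mult_def by blast
      qed
    qed
    note split_off = split_off_central_factor[OF sc Ps PZ _ Es EZ PE this ab]
    obtain H a' b' where H: "subgroup H G" "direct_product_of_subgroups G E H"
      "squares_central (G\<lparr>carrier := H\<rparr>) z" "group_centre (G\<lparr>carrier := H\<rparr>) = P"
      "a' \<in> H" "b' \<in> H" "a' \<otimes> b' \<noteq> b' \<otimes> a'"
      using split_off by (auto simp: P_def)
    interpret H: group "G\<lparr>carrier := H\<rparr>" using subgroup_imp_group[OF H(1)] .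
    have "extraspecial_central_product_C4 (G\<lparr>carrier := H\<rparr>)"
      by (rule H.extraspecial_central_product_C4I[of z c a' b'])
        (use p_group_subgroup[OF p H(1)] H z1 c in \<open>simp_all add: P_def\<close>)
    then show ?thesis using H(2) el by blast
  qed
qed


section \<open>Groups in which the elements of order greater than 2 commute\<close>

text \<open>The generator c of a direct factor of order 2 is a central involution but not a square:
  from c = d^2 and the decomposition d = a b follows c = b^2, which lies in both factors.\<close>

lemma no_direct_factor_of_order_2I:
  assumes sq: "\<And>c. c \<in> carrier G \<Longrightarrow> c \<otimes> c = \<one> \<Longrightarrow> (\<And>x. x \<in> carrier G \<Longrightarrow> c \<otimes> x = x \<otimes> c)
      \<Longrightarrow> \<exists>d\<in>carrier G. c = d \<otimes> d"
  shows "\<not> has_direct_factor_of_order_2 G"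
proof
  assume "has_direct_factor_of_order_2 G"
  then obtain A B where A: "A \<lhd> G" "B \<lhd> G" "A \<inter> B = {\<one>}" "A <#> B = carrier G" "card A = 2"
    by (auto simp: has_direct_factor_of_order_2_def direct_product_of_subgroups_def)
  have As: "subgroup A G" and Bs: "subgroup B G" using A normal_imp_subgroup by blast+
  note AG = subgroup.mem_carrier[OF As] and BG = subgroup.mem_carrier[OF Bs]
  obtain c where c: "A = {\<one>, c}" "c \<noteq> \<one>"
    using A(5) subgroup.one_closed[OF As] unfolding card_2_iff by fastforce
  have cG: "c \<in> carrier G" using c AG by blast
  have cc: "c \<otimes> c = \<one>"
    using subgroup.m_closed[OF As, of c c] c cG by auto
  have ccomm: "c \<otimes> x = x \<otimes> c" if x: "x \<in> carrier G" for x
  proof -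
    have e: "x \<otimes> c = (x \<otimes> c \<otimes> inv x) \<otimes> x" using x cG by (simp add: m_assoc)
    have "x \<otimes> c \<otimes> inv x \<in> A" using A(1) x c unfolding normal_inv_iff by blast
    moreover have "x \<otimes> c \<otimes> inv x \<noteq> \<one>"
    proof
      assume "x \<otimes> c \<otimes> inv x = \<one>"
      then have "x \<otimes> c = x" using e x by simp
      then show False using c x cG by simp
    qed
    ultimately show ?thesis using e c by auto
  qed
  obtain d where d: "d \<in> carrier G" "c = d \<otimes> d" using sq[OF cG cc ccomm] by blast
  then have "d \<in> A <#> B" using A(4) by simp
  then obtain a b where ab: "a \<in> A" "b \<in> B" "d = a \<otimes> b" by (auto simp: set_mult_def)
  have ba: "b \<otimes> a = a \<otimes> b" "a \<otimes> a = \<one>" using ab(1) c ccomm[OF BG[OF ab(2)]] cc BG[OF ab(2)] by auto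
  have "d \<otimes> d = a \<otimes> (b \<otimes> a) \<otimes> b" using ab AG BG by (simp add: m_assoc)
  also have "\<dots> = (a \<otimes> a) \<otimes> (b \<otimes> b)" unfolding ba(1) using ab AG BG by (simp add: m_assoc)
  finally have "c = b \<otimes> b" using d ba ab BG by simp
  then have "c \<in> A \<inter> B" using c subgroup.m_closed[OF Bs ab(2,2)] by simp
  then show False using A(3) c by blast
qed

text \<open>\<open>E\<close> has exponent 2 and contains no square of \<open>A\<close> except 1, so
  it splits off from \<open>A\<close>; the complement \<open>B\<close> is a relative complement over
  the subgroup \<open>S\<close> of squares. An involution t outside \<open>A\<close> together with
  \<open>B\<close> forms \<open>H\<close>. In \<open>H\<close> every central element of order at
  most 2 turns out to be a square.\<close>

lemma commuting_imp_structure: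
  assumes p: "p_group 2 G" and fi: "fixed_or_inverted G" and nc: "\<not> comm_group G"
    and comm: "\<And>u v. u \<in> carrier G \<Longrightarrow> u \<otimes> u \<noteq> \<one> \<Longrightarrow> v \<in> carrier G \<Longrightarrow> v \<otimes> v \<noteq> \<one> \<Longrightarrow> u \<otimes> v = v \<otimes> u"
  shows "\<exists>E H. direct_product_of_subgroups G E H \<and> elementary_abelian_2_group (G\<lparr>carrier := E\<rparr>) \<and>
    \<not> has_direct_factor_of_order_2 (G\<lparr>carrier := H\<rparr>) \<and> inverting_semidirect_product (G\<lparr>carrier := H\<rparr>)"
proof -
  have inv_self: "inv x = x" if "x \<in> carrier G" "x \<otimes> x = \<one>" for x
    using that inv_equality by blast
  have "\<exists>w\<in>carrier G. w \<otimes> w \<noteq> \<one>"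
  proof (rule ccontr)
    assume n: "\<not> ?thesis"
    have "x \<otimes> y = y \<otimes> x" if "x \<in> carrier G" "y \<in> carrier G" for x y
      using n that inv_self[of x] inv_self[of y] inv_self[of "x \<otimes> y"] inv_mult_group[of x y] by simp
    then show False using nc group_comm_groupI by blast
  qed
  then obtain w where w: "w \<in> carrier G" "w \<otimes> w \<noteq> \<one>" by blast
  define A where "A = {x \<in> carrier G. \<forall>u\<in>carrier G. u \<otimes> u \<noteq> \<one> \<longrightarrow> u \<otimes> x = x \<otimes> u}"
  have AG: "x \<in> carrier G" if "x \<in> A" for x using that by (simp add: A_def)
  have Acomm: "u \<otimes> x = x \<otimes> u" if "x \<in> A" "u \<in> carrier G" "u \<otimes> u \<noteq> \<one>" for x u
    using that unfolding A_def by blast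
  have As: "subgroup A G"
  proof (rule subgroupI)
    show "inv x \<in> A" if x: "x \<in> A" for x
    proof -
      have "u \<otimes> inv x = inv x \<otimes> u" if u: "u \<in> carrier G" "u \<otimes> u \<noteq> \<one>" for u
      proof -
        have "u \<otimes> inv x = inv x \<otimes> (x \<otimes> u) \<otimes> inv x" using x u AG by (simp add: m_assoc inv_cancel_left)
        also have "x \<otimes> u = u \<otimes> x" using Acomm[OF x u] by simp
        finally show ?thesis using x u AG by (simp add: m_assoc)
      qed
      then show ?thesis using AG[OF x] unfolding A_def by blast
    qed
    show "x \<otimes> y \<in> A" if x: "x \<in> A" and y: "y \<in> A" for x y
    proof -
      have "u \<otimes> (x \<otimes> y) = x \<otimes> y \<otimes> u" if u: "u \<in> carrier G" "u \<otimes> u \<noteq> \<one>" for u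
      proof -
        have "u \<otimes> (x \<otimes> y) = (u \<otimes> x) \<otimes> y" using x y u AG by (simp add: m_assoc)
        also have "u \<otimes> x = x \<otimes> u" using Acomm[OF x u] by simp
        also have "x \<otimes> u \<otimes> y = x \<otimes> (u \<otimes> y)" using x y u AG by (simp add: m_assoc)
        also have "u \<otimes> y = y \<otimes> u" using Acomm[OF y u] by simp
        finally show ?thesis using x y u AG by (simp add: m_assoc)
      qed
      then show ?thesis using AG[OF x] AG[OF y] unfolding A_def by blast
    qed
  qed (auto simp: A_def)
  have wA: "w \<in> A" using w comm unfolding A_def by blast
  have outside: "x \<otimes> x = \<one>" if "x \<in> carrier G" "x \<notin> A" for x
    using that comm unfolding A_def by blast
  \<comment> \<open>The remaining case is x^2 = 1. Then x w has the same square as w, so y commutes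
    with x w and with w, and therefore with x.\<close>
  have Ac: "x \<otimes> y = y \<otimes> x" if x: "x \<in> A" and y: "y \<in> A" for x y
  proof (cases "x \<otimes> x = \<one>")
    case False then show ?thesis using Acomm[OF y AG[OF x]] by blast
  next
    case True
    have "w \<otimes> x = x \<otimes> w" using Acomm[OF x w] .
    then have "(x \<otimes> w) \<otimes> (x \<otimes> w) = (x \<otimes> x) \<otimes> (w \<otimes> w)"
      using AG[OF x] w by (simp add: m_assoc) (simp add: m_assoc[symmetric])
    then have "(x \<otimes> w) \<otimes> (x \<otimes> w) \<noteq> \<one>" using True w by simp
    then have "(x \<otimes> w) \<otimes> y = y \<otimes> (x \<otimes> w)" using Acomm[OF y] AG[OF x] w(1) by simp
    also have "\<dots> = (y \<otimes> x) \<otimes> w" using x y AG w by (simp add: m_assoc)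
    finally have "(x \<otimes> y) \<otimes> w = (y \<otimes> x) \<otimes> w"
      using Acomm[OF y w] AG[OF x] AG[OF y] w(1) by (simp add: m_assoc)
    then show ?thesis using x y AG w by (metis r_cancel m_closed)
  qed
  have "\<not> carrier G \<subseteq> A" using Ac nc group_comm_groupI by blast
  then obtain t where t: "t \<in> carrier G" "t \<notin> A" by blast
  have tt: "t \<otimes> t = \<one>" and it: "inv t = t" using outside t inv_self by blast+
  \<comment> \<open>With s also s a is outside \<open>A\<close>, so both are involutions and s a =
    (s a)^-1 = a^-1 s.\<close>
  have invert: "a \<otimes> s = s \<otimes> inv a" if s: "s \<in> carrier G" "s \<notin> A" and a: "a \<in> A" for s a
  proof -
    have "s \<otimes> a \<notin> A"
    proof
      assume "s \<otimes> a \<in> A"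
      then have "s \<otimes> a \<otimes> inv a \<in> A" using a As by (simp add: subgroup.m_closed subgroup.m_inv_closed)
      then show False using s a AG by (simp add: m_assoc)
    qed
    then have "inv (s \<otimes> a) = s \<otimes> a" using outside[of "s \<otimes> a"] inv_self s a AG by simp
    moreover have "inv s = s" using outside inv_self s by blast
    ultimately have "inv a \<otimes> s = s \<otimes> a" using s a AG by (simp add: inv_mult_group)
    then have "a \<otimes> (inv a \<otimes> s) \<otimes> inv a = a \<otimes> (s \<otimes> a) \<otimes> inv a" by simp
    then show ?thesis using s a AG by (simp add: m_assoc inv_cancel_left)
  qed
  \<comment> \<open>\<open>A\<close> has index 2: if x and x t were both outside, then x t would
    invert w. But it also centralizes w, as x and t both invert w, and w^2 would be 1.\<close>
  have split: "x \<in> A \<or> (\<exists>a\<in>A. x = a \<otimes> t)" if x: "x \<in> carrier G" for x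
  proof (cases "x \<in> A")
    case xA: False
    have "x \<otimes> t \<in> A"
    proof (rule ccontr)
      assume "x \<otimes> t \<notin> A"
      then have "w \<otimes> (x \<otimes> t) = x \<otimes> t \<otimes> inv w" using invert[of "x \<otimes> t" w] x t wA by simp
      moreover have "w \<otimes> (x \<otimes> t) = x \<otimes> (inv w \<otimes> t)"
        using invert[OF x xA wA] x t w by (simp add: m_assoc[symmetric])
      moreover have "inv w \<otimes> t = t \<otimes> w"
        using invert[OF t subgroup.m_inv_closed[OF As wA]] w by simp
      ultimately have "x \<otimes> t \<otimes> w = x \<otimes> t \<otimes> inv w" using x t w by (simp add: m_assoc)
      then have "w = inv w" using x t w by (metis l_cancel m_closed inv_closed)
      then show False using w by (metis r_inv)
    qed
    moreover have "x = (x \<otimes> t) \<otimes> t" using x t tt by (simp add: m_assoc)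
    ultimately show ?thesis by blast
  qed blast
  define S where "S = (\<lambda>a. a \<otimes> a) ` A"
  have sq_mult: "(a \<otimes> b) \<otimes> (a \<otimes> b) = (a \<otimes> a) \<otimes> (b \<otimes> b)" if a: "a \<in> A" and b: "b \<in> A" for a b
  proof -
    have "(a \<otimes> b) \<otimes> (a \<otimes> b) = a \<otimes> (b \<otimes> a) \<otimes> b" using a b AG by (simp add: m_assoc)
    also have "\<dots> = (a \<otimes> a) \<otimes> (b \<otimes> b)" unfolding Ac[OF b a] using a b AG by (simp add: m_assoc)
    finally show ?thesis .
  qed
  have SA: "S \<subseteq> A" using subgroup.m_closed[OF As] by (auto simp: S_def)
  have Ss: "subgroup S G"
  proof (rule subgroupI)
    show "S \<subseteq> carrier G" using SA AG by blast
    show "S \<noteq> {}" using wA by (auto simp: S_def)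
    show "inv x \<in> S" if x: "x \<in> S" for x
    proof -
      obtain a where a: "a \<in> A" "x = a \<otimes> a" using x by (auto simp: S_def)
      then have "inv x = inv a \<otimes> inv a" using AG by (simp add: inv_mult_group)
      then show ?thesis using subgroup.m_inv_closed[OF As a(1)] by (simp add: S_def)
    qed
    show "x \<otimes> y \<in> S" if x: "x \<in> S" and y: "y \<in> S" for x y
    proof -
      obtain a b where ab: "a \<in> A" "x = a \<otimes> a" "b \<in> A" "y = b \<otimes> b" using x y by (auto simp: S_def)
      have "x \<otimes> y = (a \<otimes> b) \<otimes> (a \<otimes> b)" using sq_mult[OF ab(1,3)] ab(2,4) by simp
      then show ?thesis using subgroup.m_closed[OF As ab(1,3)] unfolding S_def by blast
    qed
  qed
  define V where "V = {a \<in> A. a \<otimes> a = \<one>}"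
  have VA: "V \<subseteq> A" by (auto simp: V_def)
  have Vs: "subgroup V G"
  proof (rule subgroupI)
    show "V \<subseteq> carrier G" using AG by (auto simp: V_def)
    show "V \<noteq> {}" using subgroup.one_closed[OF As] by (auto simp: V_def)
    show "inv x \<in> V" if "x \<in> V" for x using that inv_self[of x] AG by (simp add: V_def)
    show "x \<otimes> y \<in> V" if "x \<in> V" "y \<in> V" for x y
      using that sq_mult subgroup.m_closed[OF As] by (simp add: V_def)
  qed
  have sqV: "x \<otimes> x \<in> {\<one>}" if "x \<in> V" for x using that by (simp add: V_def)
  have 1: "{\<one>} \<subseteq> V" "S \<inter> V \<subseteq> V" "\<one> \<in> S \<inter> V"
    using subgroup.one_closed[OF Vs] subgroup.one_closed[OF Ss] by auto
  \<comment> \<open>In the vector space \<open>V\<close> of elements of order at most 2 in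
    \<open>A\<close>, \<open>E\<close> is a complement of those that are squares in
    \<open>A\<close>.\<close>
  obtain E where Es: "subgroup E G" and EV: "E \<subseteq> V" and E: "E \<inter> (S \<inter> V) \<subseteq> {\<one>}" "E <#> (S \<inter> V) = V"
    by (rule exists_relative_complement_in_subgroup[OF Vs triv_subgroup 1(1) sqV 1(2,3)])
  have ES: "E \<inter> S \<subseteq> {\<one>}" using E(1) EV by blast
  note EG = subgroup.mem_carrier[OF Es]
  have EA: "E \<subseteq> A" using EV VA by blast
  have sqA: "x \<otimes> x \<in> S" if "x \<in> A" for x using that by (simp add: S_def)
  \<comment> \<open>Working over \<open>S\<close> makes \<open>B\<close> and \<open>E\<close> meet
    only in squares, and 1 is the only square in \<open>E\<close>.\<close>
  obtain B where Bs: "subgroup B G" and SB: "S \<subseteq> B" and BA: "B \<subseteq> A" and B: "B \<inter> E \<subseteq> S" "B <#> E = A"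
    by (rule exists_relative_complement_in_subgroup[OF As Ss SA sqA EA subgroup.one_closed[OF Es]])
  note BG = subgroup.mem_carrier[OF Bs]
  have BE: "B \<inter> E \<subseteq> {\<one>}" using B(1) ES by blast
  have Ee: "e \<otimes> e = \<one>" "inv e = e" if "e \<in> E" for e
    using that EV EG inv_self by (auto simp: V_def)
  have EZ: "E \<subseteq> group_centre G"
  proof
    fix e assume e: "e \<in> E"
    have "e \<otimes> x = x \<otimes> e" if x: "x \<in> carrier G" for x
    proof (cases "x \<in> A")
      case True then show ?thesis using Ac e EA by blast
    next
      case False then show ?thesis using invert[OF x False] e EA Ee[OF e] by auto
    qed
    then show "e \<in> group_centre G" using EG[OF e] by (simp add: group_centre_def)
  qed
  define H where "H = B \<union> (\<lambda>b. b \<otimes> t) ` B"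
  have conjB: "t \<otimes> b \<otimes> inv t = inv b" if b: "b \<in> B" for b
  proof -
    have "t \<otimes> b \<otimes> inv t = t \<otimes> (b \<otimes> t)" using t BG[OF b] it by (simp add: m_assoc)
    also have "b \<otimes> t = t \<otimes> inv b" using invert[OF t] b BA by blast
    also have "t \<otimes> (t \<otimes> inv b) = inv b" using t BG[OF b] tt by (simp add: m_assoc[symmetric])
    finally show ?thesis .
  qed
  have Hs: "subgroup H G" unfolding H_def
    by (rule subgroup_Un_rcoset[OF Bs t(1)])
      (use tt conjB subgroup.one_closed[OF Bs] subgroup.m_inv_closed[OF Bs] in auto)
  have BH: "B \<subseteq> H" by (simp add: H_def)
  have tH: "t \<in> H" using t subgroup.one_closed[OF Bs] unfolding H_def by (force intro: image_eqI[of _ _ "\<one>"])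
  have Hn: "H \<lhd> G"
  proof (rule normal_if_squares[OF Hs])
    fix x assume x: "x \<in> carrier G"
    show "x \<otimes> x \<in> H"
      using sqA[of x] outside[OF x] SB BH subgroup.one_closed[OF Hs] by (cases "x \<in> A") auto
  qed
  have tB: "b \<otimes> t \<notin> A" if b: "b \<in> B" for b
  proof
    assume "b \<otimes> t \<in> A"
    then have "inv b \<otimes> (b \<otimes> t) \<in> A"
      using b BA As by (blast intro: subgroup.m_closed subgroup.m_inv_closed)
    then show False using t b BG by (simp add: inv_cancel_left)
  qed
  have HE: "H \<inter> E \<subseteq> {\<one>}" using BE tB EA by (auto simp: H_def)
  have dp: "direct_product_of_subgroups G E H"
  proof (rule direct_product_centralI[OF Es EZ Hn HE])
    show "H <#> E = carrier G"
    proof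
      show "H <#> E \<subseteq> carrier G"
        using set_mult_closed[of H E] subgroup.subset[OF Hs] subgroup.subset[OF Es] by blast
      show "carrier G \<subseteq> H <#> E"
      proof
        fix x assume x: "x \<in> carrier G"
        consider "x \<in> A" | a where "a \<in> A" "x = a \<otimes> t" using split[OF x] by blast
        then show "x \<in> H <#> E"
        proof cases
          case 1 then show ?thesis using B(2) BH unfolding set_mult_def by blast
        next
          case 2
          then obtain b e where b: "b \<in> B" "e \<in> E" "a = b \<otimes> e" using B(2) by (auto simp: set_mult_def)
          have "x = (b \<otimes> t) \<otimes> e"
            using 2 b BG EG t group_centreD(2)[of e t] EZ by (auto simp: m_assoc)
          moreover have "b \<otimes> t \<in> H" using b by (simp add: H_def)
          ultimately show ?thesis using b unfolding set_mult_def by blast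
        qed
      qed
    qed
  qed
  have el: "elementary_abelian_2_group (G\<lparr>carrier := E\<rparr>)"
    by (rule elementary_abelian_subgroupI[OF Es]) (use Ac EA Ee in auto)
  interpret H: group "G\<lparr>carrier := H\<rparr>" using subgroup_imp_group[OF Hs] .
  have BHs: "subgroup B (G\<lparr>carrier := H\<rparr>)" by (rule subgroup_incl[OF Bs Hs BH])
  have Hinv: "inv\<^bsub>G\<lparr>carrier := H\<rparr>\<^esub> x = inv x" if "x \<in> H" for x
    using m_inv_consistent[OF Hs that] .
  have inverting: "inverting_semidirect_product (G\<lparr>carrier := H\<rparr>)"
    unfolding inverting_semidirect_product_def
  proof (intro exI[of _ B] bexI[of _ t] conjI ballI)
    have sqH: "x \<otimes> x \<in> B" if "x \<in> H" for x
    proof (cases "x \<in> A")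
      case True then show ?thesis using sqA SB by blast
    next
      case False then show ?thesis
        using outside subgroup.mem_carrier[OF Hs that] subgroup.one_closed[OF Bs] by simp
    qed
    then show "B \<lhd> (G\<lparr>carrier := H\<rparr>)" using H.normal_if_squares[OF BHs] by simp
    have "comm_group (G\<lparr>carrier := B\<rparr>)"
      by (rule group.group_comm_groupI[OF subgroup_imp_group[OF Bs]]) (use Ac BA in auto)
    then show "comm_group (G\<lparr>carrier := H, carrier := B\<rparr>)" by simp
    show "p_group 2 (G\<lparr>carrier := H, carrier := B\<rparr>)" using p_group_subgroup[OF p Bs] by simp
    have t1: "t \<noteq> \<one>" using t subgroup.one_closed[OF As] by blast
    show "H.ord t = 2"
    proof -
      have "t [^] (2::nat) = \<one>" using t tt by (simp add: numeral_2_eq_2)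
      then have "ord t dvd 2" using t pow_eq_id by blast
      moreover have "ord t \<noteq> 1" using t t1 ord_eq_1 by blast
      ultimately have "ord t = 2" using prime_nat_iff two_is_prime_nat by blast
      then show ?thesis using ord_subgroup[OF Hs tH] by simp
    qed
    have gen: "generate (G\<lparr>carrier := H\<rparr>) {t} = {\<one>, t}"
    proof
      have "subgroup {\<one>, t} (G\<lparr>carrier := H\<rparr>)"
        by (rule H.subgroupI) (use tH tt it Hinv subgroup.one_closed[OF Hs] t in auto)
      then show "generate (G\<lparr>carrier := H\<rparr>) {t} \<subseteq> {\<one>, t}" by (intro H.generate_subgroup_incl) auto
      show "{\<one>, t} \<subseteq> generate (G\<lparr>carrier := H\<rparr>) {t}"
        using generate.one[of "G\<lparr>carrier := H\<rparr>" "{t}"] generate.incl[of t "{t}" "G\<lparr>carrier := H\<rparr>"] by simp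
    qed
    show "generate (G\<lparr>carrier := H\<rparr>) {t} \<inter> B = {\<one>\<^bsub>G\<lparr>carrier := H\<rparr>\<^esub>}"
      using t BA subgroup.one_closed[OF Bs] unfolding gen by auto
    show "generate (G\<lparr>carrier := H\<rparr>) {t} <#>\<^bsub>G\<lparr>carrier := H\<rparr>\<^esub> B = carrier (G\<lparr>carrier := H\<rparr>)"
    proof -
      have 1: "b \<otimes> t = t \<otimes> inv b" "inv b \<in> B" if b: "b \<in> B" for b
        using invert[OF t subsetD[OF BA b]] subgroup.m_inv_closed[OF Bs b] by blast+
      have 2: "t \<otimes> b = inv b \<otimes> t" if b: "b \<in> B" for b
        using 1[OF 1(2)[OF b]] BG[OF b] by simp
      \<comment> \<open>\<open>H\<close> is built from right cosets, the semidirect product from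
        left ones; they agree because t inverts \<open>B\<close>.\<close>
      have "(\<lambda>b. b \<otimes> t) ` B = (\<lambda>b. t \<otimes> b) ` B"
        using 1 2 by (intro equalityI image_subsetI) (metis image_eqI)+
      moreover have "generate (G\<lparr>carrier := H\<rparr>) {t} <#>\<^bsub>G\<lparr>carrier := H\<rparr>\<^esub> B = B \<union> (\<lambda>b. t \<otimes> b) ` B"
        unfolding gen using BG by (auto simp: set_mult_def)
      ultimately show ?thesis by (simp add: H_def)
    qed
    show "inv\<^bsub>G\<lparr>carrier := H\<rparr>\<^esub> t \<otimes>\<^bsub>G\<lparr>carrier := H\<rparr>\<^esub> b \<otimes>\<^bsub>G\<lparr>carrier := H\<rparr>\<^esub> t = inv\<^bsub>G\<lparr>carrier := H\<rparr>\<^esub> b"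
      if "b \<in> B" for b
      using conjB[OF that] Hinv[OF tH] Hinv[of b] that BH it by auto
    show "t \<in> carrier (G\<lparr>carrier := H\<rparr>)" using tH by simp
  qed
  \<comment> \<open>A central c outside \<open>B\<close> would both fix and invert \<open>B\<close>,
    so \<open>B\<close> and with it \<open>A\<close> would have exponent 2, contrary to the choice
    of w. For c in \<open>B\<close>, write c = e s with e in \<open>E\<close> and s a square; then e
    lies in \<open>B\<close> too, so e = 1 and c = d^2 with d in \<open>A\<close>. The part of d in
    \<open>E\<close> does not affect the square.\<close>
  have sqc: "\<exists>d\<in>H. c = d \<otimes> d" if c: "c \<in> H" "c \<otimes> c = \<one>" and cc: "\<And>x. x \<in> H \<Longrightarrow> c \<otimes> x = x \<otimes> c" for c
  proof -
    have cB: "c \<in> B"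
    proof (rule ccontr)
      assume "c \<notin> B"
      then obtain b where "b \<in> B" "c = b \<otimes> t" using c by (auto simp: H_def)
      then have cA: "c \<in> carrier G" "c \<notin> A" using tB BG t by auto
      have B2: "b \<otimes> b = \<one>" if b: "b \<in> B" for b
      proof -
        have "c \<otimes> b = c \<otimes> inv b" using invert[OF cA subsetD[OF BA b]] cc[OF subsetD[OF BH b]] by simp
        then have "b = inv b" using cA BG[OF b] by (metis l_cancel inv_closed)
        then show ?thesis using BG[OF b] by (metis r_inv)
      qed
      obtain b e where b: "b \<in> B" "e \<in> E" "w = b \<otimes> e"
        using wA B(2) unfolding set_mult_def by blast
      then have "w \<otimes> w = \<one>" 
        using sq_mult[OF subsetD[OF BA b(1)] subsetD[OF EA b(2)]] B2[OF b(1)] Ee(1)[OF b(2)] by simp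
      then show False using w by blast
    qed
    then have "c \<in> V" using c(2) BA by (auto simp: V_def)
    then obtain e s where e: "e \<in> E" "s \<in> S" "c = e \<otimes> s"
      using E(2) unfolding set_mult_def by blast
    have sB: "s \<in> B" using e SB by blast
    have "e = c \<otimes> inv s" using e EG BG[OF sB] by (simp add: m_assoc)
    then have "e \<in> B" using cB subgroup.m_inv_closed[OF Bs sB] subgroup.m_closed[OF Bs] by simp
    then have "e = \<one>" using BE e by blast
    then have "c \<in> S" using e BG[OF sB] by simp
    then obtain d where d: "d \<in> A" "c = d \<otimes> d" by (auto simp: S_def)
    then obtain b f where b: "b \<in> B" "f \<in> E" "d = b \<otimes> f"
      using B(2) unfolding set_mult_def by blast
    have "c = b \<otimes> b" 
      using d b sq_mult[OF subsetD[OF BA b(1)] subsetD[OF EA b(2)]] Ee(1)[OF b(2)] BG[OF b(1)] by simp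
    then show ?thesis using b BH by blast
  qed
  have "\<not> has_direct_factor_of_order_2 (G\<lparr>carrier := H\<rparr>)"
  proof (rule H.no_direct_factor_of_order_2I)
    let ?H = "G\<lparr>carrier := H\<rparr>"
    fix c assume c: "c \<in> carrier ?H" "c \<otimes>\<^bsub>?H\<^esub> c = \<one>\<^bsub>?H\<^esub>"
      "\<And>x. x \<in> carrier ?H \<Longrightarrow> c \<otimes>\<^bsub>?H\<^esub> x = x \<otimes>\<^bsub>?H\<^esub> c"
    have comm: "c \<otimes> x = x \<otimes> c" if "x \<in> H" for x using c(3)[of x] that by simp
    have "c \<in> H" "c \<otimes> c = \<one>" using c(1,2) by simp_all
    then have "\<exists>d\<in>H. c = d \<otimes> d" using comm by (rule sqc)
    then show "\<exists>d\<in>carrier ?H. c = d \<otimes>\<^bsub>?H\<^esub> d" by simp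
  qed
  then show ?thesis using dp el inverting by blast
qed

section \<open>From the conjugation condition to the list of groups and back\<close>

lemma structure_if_fixed_or_inverted:
  assumes p: "p_group 2 G" and fi: "fixed_or_inverted G" and nc: "\<not> comm_group G"
  shows "\<exists>E H. direct_product_of_subgroups G E H \<and> elementary_abelian_2_group (G\<lparr>carrier := E\<rparr>) \<and>
    ((\<not> has_direct_factor_of_order_2 (G\<lparr>carrier := H\<rparr>) \<and> inverting_semidirect_product (G\<lparr>carrier := H\<rparr>)) \<or>
     (extraspecial 2 (G\<lparr>carrier := H\<rparr>) \<or> extraspecial_central_product_C4 (G\<lparr>carrier := H\<rparr>)))"
proof (cases "\<exists>a\<in>carrier G. \<exists>b\<in>carrier G. a \<otimes> a \<noteq> \<one> \<and> b \<otimes> b \<noteq> \<one> \<and> a \<otimes> b \<noteq> b \<otimes> a")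
  case True
  then obtain a b where ab: "a \<in> carrier G" "a \<otimes> a \<noteq> \<one>" "b \<in> carrier G" "b \<otimes> b \<noteq> \<one>" "a \<otimes> b \<noteq> b \<otimes> a"
    by blast
  show ?thesis
    using squares_central_imp_structure[OF p noncommuting_imp_squares_central[OF fi ab] ab(2,1,3,5)] by blast
next
  case False
  then show ?thesis using commuting_imp_structure[OF p fi nc] by blast
qed

lemma fixed_or_inverted_if_structure:
  assumes dp: "direct_product_of_subgroups G E H" and E: "elementary_abelian_2_group (G\<lparr>carrier := E\<rparr>)"
    and H: "inverting_semidirect_product (G\<lparr>carrier := H\<rparr>) \<or> extraspecial 2 (G\<lparr>carrier := H\<rparr>)
      \<or> extraspecial_central_product_C4 (G\<lparr>carrier := H\<rparr>)"
  shows "fixed_or_inverted G"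
proof -
  have "subgroup H G" using dp normal_imp_subgroup by (auto simp: direct_product_of_subgroups_def)
  then interpret H: group "G\<lparr>carrier := H\<rparr>" by (rule subgroup_imp_group)
  have "fixed_or_inverted (G\<lparr>carrier := H\<rparr>)"
    using H H.inverting_imp_fixed_or_inverted H.squares_central_imp_fixed_or_inverted
      H.extraspecial_imp_squares_central H.central_product_C4_squares_central by metis
  then show ?thesis using direct_product_fixed_or_inverted[OF dp E] by blast
qed

end

section \<open>The characterization\<close>

theorem theorem1p1:
  fixes G :: "('g, 'm) monoid_scheme" and p :: nat
  assumes "Factorial_Ring.prime p"
    and "CHAR('k::field) = p"
    and "group G"
    and "\<not> comm_group G"
    and "locally_finite_group G"
    and "p_group p G"
  shows "unitary_normalized_units TYPE('k) G \<lhd> normalized_units TYPE('k) G \<longleftrightarrow>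
    p = 2 \<and>
    (\<exists>E H. direct_product_of_subgroups G E H \<and>
       elementary_abelian_2_group (G\<lparr>carrier := E\<rparr>) \<and>
       ((\<not> has_direct_factor_of_order_2 (G\<lparr>carrier := H\<rparr>) \<and>
           inverting_semidirect_product (G\<lparr>carrier := H\<rparr>)) \<or>
        (extraspecial 2 (G\<lparr>carrier := H\<rparr>) \<or>
           extraspecial_central_product_C4 (G\<lparr>carrier := H\<rparr>))))"
proof -
  interpret group G by (rule assms(3))
  have two: "a + a = 0" if "p = 2" for a :: 'k
  proof -
    have "of_nat CHAR('k) = (0 :: 'k)" by (rule of_nat_CHAR)
    then have "(2 :: 'k) = 0" using assms(2) that by simp
    then show ?thesis by (metis mult_2 mult_zero_left)
  qed
  show ?thesis
  proof (intro iffI conjI)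
    assume N: "unitary_normalized_units TYPE('k) G \<lhd> normalized_units TYPE('k) G"
    show p2: "p = 2"
    proof (rule ccontr)
      assume "p \<noteq> 2"
      then have "odd p" using assms(1) prime_odd_nat prime_ge_2_nat[of p] by force
      then have odd: "odd (ord x)" if "x \<in> carrier G" for x
        using assms(6) that unfolding p_group_def by fastforce
      have "(2 :: 'k) \<noteq> 0"
      proof
        assume "(2 :: 'k) = 0"
        then have "of_nat 2 = (0 :: 'k)" by simp
        then have "p dvd 2" using assms(2) of_nat_eq_0_iff_char_dvd by blast
        then show False using assms(1) \<open>p \<noteq> 2\<close> primes_dvd_imp_eq two_is_prime_nat by blast
      qed
      then have "g \<otimes>\<^bsub>G\<^esub> x = x \<otimes>\<^bsub>G\<^esub> g" if "g \<in> carrier G" "x \<in> carrier G" for g x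
        using normal_imp_commute_if_odd[OF _ odd N that] by blast
      then show False using assms(4) group_comm_groupI by blast
    qed
    have "fixed_or_inverted G"
      using normal_imp_fixed_or_inverted[OF two[OF p2] assms(5) _ N] assms(6) p2 by blast
    then show "\<exists>E H. direct_product_of_subgroups G E H \<and>
       elementary_abelian_2_group (G\<lparr>carrier := E\<rparr>) \<and>
       ((\<not> has_direct_factor_of_order_2 (G\<lparr>carrier := H\<rparr>) \<and>
           inverting_semidirect_product (G\<lparr>carrier := H\<rparr>)) \<or>
        (extraspecial 2 (G\<lparr>carrier := H\<rparr>) \<or>
           extraspecial_central_product_C4 (G\<lparr>carrier := H\<rparr>)))"
      using structure_if_fixed_or_inverted assms(4,6) p2 by blast
  next
    assume r: "p = 2 \<and> (\<exists>E H. direct_product_of_subgroups G E H \<and>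
       elementary_abelian_2_group (G\<lparr>carrier := E\<rparr>) \<and>
       ((\<not> has_direct_factor_of_order_2 (G\<lparr>carrier := H\<rparr>) \<and>
           inverting_semidirect_product (G\<lparr>carrier := H\<rparr>)) \<or>
        (extraspecial 2 (G\<lparr>carrier := H\<rparr>) \<or>
           extraspecial_central_product_C4 (G\<lparr>carrier := H\<rparr>))))"
    then have "fixed_or_inverted G" using fixed_or_inverted_if_structure by blast
    then show "unitary_normalized_units TYPE('k) G \<lhd> normalized_units TYPE('k) G"
      using fixed_or_inverted_imp_normal two r by blast
  qed
qed

end
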